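(* Let $q$ be a positive integer, $T$ an abstract group, and $\mathcal{I}=(\rho_1,\ldots,\rho_r)$ an ordered $r$-tuple of (not necessarily distinct) permutation representations of $T$ into $S_q$ (that is, homomorphisms $T\to S_q$). Then the twisted permutation code $C(T,\mathcal{I})$ is a frequency permutation array of length $rq$ (every letter of $\{1,\ldots,q\}$ occurs exactly $r$ times in each codeword) with minimum distance $$\delta_{\mathrm{tw}}:=\delta(C(T,\mathcal{I}))\ \geq\ \delta_{\mathrm{rep}}:=\min_{\rho\in\mathcal{I}}\delta(\mathrm{Rep}_r(C(T,\rho))).$$ Moreover, the following twisted permutation codes have a minimum distance that is strictly greater than this lower bound, i.e. $\delta_{\mathrm{tw}}>\delta_{\mathrm{rep}}$, with the values indicated: (1) $T=S_6$, $r=2$, $q=6$, $\mathcal{I}=(\rho_1,\rho_2)$ with $\rho_1$ the identity map and $\rho_2$ an outer automorphism of $S_6$ with $\rho_2^2=\rho_1$: $\delta_{\mathrm{rep}}=4$, $\delta_{\mathrm{tw}}=8$. (2) $T=A_6$, $r=2$, $q=6$, $\mathcal{I}=(\rho_1,\rho_2)$ with $\rho_1$ the identity map (viewed as a map into $S_6$) and $\rho_2$ an automorphism of $A_6$ (viewed as a map into $S_6$) that is not induced by conjugation by an element of $S_6$ and satisfies $\rho_2^2=\rho_1$: $\delta_{\mathrm{rep}}=6$, $\delta_{\mathrm{tw}}=8$. (3) $T=\mathrm{ASL}(3,2)=\mathrm{AGL}(3,2)$, $r=2$, $q=8$, $\mathcal{I}=(\rho_1,\rho_2)$ with $\rho_1,\rho_2$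 the actions of $T$ on the right cosets of $H_1$ and of $H_2$, where $H_1,H_2$ are representatives of the two $T$-conjugacy classes of complements in $T$ of the translation subgroup: $\delta_{\mathrm{rep}}=8$, $\delta_{\mathrm{tw}}=12$. (4) $T=S_6$, $r=4$, $q=60$, where $H_1,\ldots,H_4$ are representatives of the four conjugacy classes of subgroups of order $12$ in $S_6$, $\rho_i$ is the action of $S_6$ on the right cosets of $H_i$, and $\mathcal{I}$ is a $4$-tuple formed by taking any four elements of $\{\rho_1,\rho_2,\rho_3,\rho_4\}$, repeats allowed: $\delta_{\mathrm{rep}}$ lies in the range $176$ to $192$, and $\delta_{\mathrm{tw}}\leq 224$.
   Context: Let $Q=\{1,\ldots,q\}$ and $S_q=\mathrm{Sym}(Q)$; permutations act on the right, $i\mapsto i^{g}$, and the image of $t\in T$ under $\rho$ is written $t\rho$. The Hamming distance between two tuples of the same length over $Q$ is the number of entries in which they differ. The minimum distance $\delta(C)$ of a code $C$ (a set of tuples of the same length over $Q$) is the smallest Hamming distance between distinct codewords of $C$; if $C$ consists of exactly one codeword, then $\delta(C)=0$. For a homomorphism $\rho:T\to S_q$ and $t\in T$ put $\alpha(t,\rho)=(1^{t\rho},\ldots,q^{t\rho})\in Q^q$ and $C(T,\rho)=\{\alpha(t,\rho):t\in T\}$. For $\mathcal{I}=(\rho_1,\ldots,\rho_r)$ put $\alpha(t,\mathcal{I})=(\alpha(t,\rho_1),\ldots,\alpha(t,\rho_r))\in Q^{rq}$ and $C(T,\mathcal{I})=\{\alpha(t,\mathcal{I}):t\in T\}$; this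 is the twisted permutation code. $\mathrm{Rep}_r(C(T,\rho))$ is the code $\{(\alpha,\ldots,\alpha)\ (r\text{ copies}):\alpha\in C(T,\rho)\}$. Actions on sets of size $q$ are regarded as homomorphisms to $S_q$ by labelling the points with $1,\ldots,q$. In case (4) there are several different repetition codes and several different twisted codes: as the representation(s) vary, the minimum distances of the repetition codes range from $176$ to $192$ and those of the twisted codes range from $176$ to $224$.
   Formalization: The inequality δ_tw ≥ δ_rep is stated only when all ρ in I have the same kernel or some ρ is trivial (it fails for the two projections of S_2×S_2, q=r=2); in (4), δ_tw > δ_rep is stated only for 4-tuples with at least two distinct entries (constant tuples give equality). *)

theory Defs
  imports "HOL-Analysis.Analysis" "HOL-Algebra.Algebra" "HOL-Library.Z2"
begin

section \<open>Permutation groups acting on the right\<close>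

text \<open>
  Permutations act on the right, so \<open>i^(g h) = (i^g)^h\<close>: the product of \<open>g\<close> and \<open>h\<close> is
  \<open>h \<circ> g\<close>. The library groups \<^const>\<open>sym_group\<close> and \<^const>\<open>alt_group\<close> multiply by
  \<open>g \<circ> h\<close>, hence we pass to their opposite groups.
\<close>

definition opposite :: "('a, 'b) monoid_scheme \<Rightarrow> ('a, 'b) monoid_scheme"
  where "opposite G = G\<lparr>mult := \<lambda>x y. y \<otimes>\<^bsub>G\<^esub> x\<rparr>"

definition Sym :: "nat \<Rightarrow> (nat \<Rightarrow> nat) monoid"
  where "Sym q = opposite (sym_group q)"

definition Alt :: "nat \<Rightarrow> (nat \<Rightarrow> nat) monoid"
  where "Alt q = opposite (alt_group q)"

definition AGL :: "('a::field ^ 'n \<Rightarrow> 'a ^ 'n) monoid"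
  where "AGL = \<lparr>carrier = {\<lambda>v. v v* A + w | A w. invertible A}, mult = (\<lambda>g h. h \<circ> g), one = id\<rparr>"

definition ASL :: "('a::field ^ 'n \<Rightarrow> 'a ^ 'n) monoid"
  where "ASL = \<lparr>carrier = {\<lambda>v. v v* A + w | A w. det A = 1}, mult = (\<lambda>g h. h \<circ> g), one = id\<rparr>"

definition translation_subgroup :: "('a::field ^ 'n \<Rightarrow> 'a ^ 'n) set"
  where "translation_subgroup = {\<lambda>v. v + w | w. True}"

abbreviation AGL32 :: "(bit ^ 3 \<Rightarrow> bit ^ 3) monoid" where "AGL32 \<equiv> AGL"
abbreviation ASL32 :: "(bit ^ 3 \<Rightarrow> bit ^ 3) monoid" where "ASL32 \<equiv> ASL"


section \<open>Codes\<close>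

text \<open>Codewords are lists of equal length; the letters are \<open>1, \<dots>, q\<close>.\<close>

definition hamming :: "nat list \<Rightarrow> nat list \<Rightarrow> nat"
  where "hamming x y = card {i. i < length x \<and> x ! i \<noteq> y ! i}"

definition min_dist :: "nat list set \<Rightarrow> nat"
  where "min_dist C = (if is_singleton C then 0
    else (LEAST d. \<exists>x\<in>C. \<exists>y\<in>C. x \<noteq> y \<and> d = hamming x y))"

definition freq_perm_array :: "nat \<Rightarrow> nat \<Rightarrow> nat list set \<Rightarrow> bool"
  where "freq_perm_array q r C \<longleftrightarrow>
    (\<forall>c\<in>C. length c = r * q \<and> set c \<subseteq> {1..q} \<and> (\<forall>i\<in>{1..q}. count_list c i = r))"

definition alpha :: "nat \<Rightarrow> ('a \<Rightarrow> nat \<Rightarrow> nat) \<Rightarrow> 'a \<Rightarrow> nat list"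
  where "alpha q \<rho> t = map (\<rho> t) [1..<Suc q]"

definition perm_code :: "('a, 'b) monoid_scheme \<Rightarrow> nat \<Rightarrow> ('a \<Rightarrow> nat \<Rightarrow> nat) \<Rightarrow> nat list set"
  where "perm_code T q \<rho> = alpha q \<rho> ` carrier T"

definition twisted_code ::
    "('a, 'b) monoid_scheme \<Rightarrow> nat \<Rightarrow> ('a \<Rightarrow> nat \<Rightarrow> nat) list \<Rightarrow> nat list set"
  where "twisted_code T q I = (\<lambda>t. concat (map (\<lambda>\<rho>. alpha q \<rho> t) I)) ` carrier T"

definition rep_code :: "nat \<Rightarrow> nat list set \<Rightarrow> nat list set"
  where "rep_code r C = (\<lambda>a. concat (replicate r a)) ` C"

definition delta_tw :: "('a, 'b) monoid_scheme \<Rightarrow> nat \<Rightarrow> ('a \<Rightarrow> nat \<Rightarrow> nat) list \<Rightarrow> nat"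
  where "delta_tw T q I = min_dist (twisted_code T q I)"

definition delta_rep :: "('a, 'b) monoid_scheme \<Rightarrow> nat \<Rightarrow> ('a \<Rightarrow> nat \<Rightarrow> nat) list \<Rightarrow> nat"
  where "delta_rep T q I = Min ((\<lambda>\<rho>. min_dist (rep_code (length I) (perm_code T q \<rho>))) ` set I)"


section \<open>Automorphisms, conjugacy and coset actions\<close>

text \<open>An automorphism of \<open>G\<close> of square one that is not conjugation by an element of \<open>S \<supseteq> G\<close>.\<close>

definition outer_involution ::
    "('a, 'b) monoid_scheme \<Rightarrow> ('a, 'c) monoid_scheme \<Rightarrow> ('a \<Rightarrow> 'a) \<Rightarrow> bool"
  where "outer_involution S G \<phi> \<longleftrightarrow>
    \<phi> \<in> iso G G \<and>
    \<not> (\<exists>s\<in>carrier S. \<forall>g\<in>carrier G. \<phi> g = inv\<^bsub>S\<^esub> s \<otimes>\<^bsub>S\<^esub> g \<otimes>\<^bsub>S\<^esub> s) \<and>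
    (\<forall>g\<in>carrier G. \<phi> (\<phi> g) = g)"

definition conjugate :: "('a, 'b) monoid_scheme \<Rightarrow> 'a set \<Rightarrow> 'a set \<Rightarrow> bool"
  where "conjugate G H K \<longleftrightarrow> (\<exists>g\<in>carrier G. K = (inv\<^bsub>G\<^esub> g <#\<^bsub>G\<^esub> H) #>\<^bsub>G\<^esub> g)"

text \<open>\<open>Hs\<close> lists, without repetition, one member of each \<open>G\<close>-conjugacy class of the family \<open>\<F>\<close>
  of subgroups; in particular the number of classes is \<open>length Hs\<close>.\<close>

definition class_reps :: "('a, 'b) monoid_scheme \<Rightarrow> 'a set set \<Rightarrow> 'a set list \<Rightarrow> bool"
  where "class_reps G \<F> Hs \<longleftrightarrow>
    set Hs \<subseteq> \<F> \<and> (\<forall>K\<in>\<F>. \<exists>!i. i < length Hs \<and> conjugate G (Hs ! i) K)"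

definition complements :: "('a, 'b) monoid_scheme \<Rightarrow> 'a set \<Rightarrow> 'a set set"
  where "complements G N =
    {H. subgroup H G \<and> H \<inter> N = {\<one>\<^bsub>G\<^esub>} \<and> H <#>\<^bsub>G\<^esub> N = carrier G}"

definition subgroups_of_order :: "('a, 'b) monoid_scheme \<Rightarrow> nat \<Rightarrow> 'a set set"
  where "subgroups_of_order G n = {H. subgroup H G \<and> card H = n}"

definition labelling :: "('a, 'b) monoid_scheme \<Rightarrow> 'a set \<Rightarrow> nat \<Rightarrow> (nat \<Rightarrow> 'a set) \<Rightarrow> bool"
  where "labelling T H q l \<longleftrightarrow> bij_betw l {1..q} (rcosets\<^bsub>T\<^esub> H)"

definition coset_rep ::
    "('a, 'b) monoid_scheme \<Rightarrow> nat \<Rightarrow> (nat \<Rightarrow> 'a set) \<Rightarrow> 'a \<Rightarrow> nat \<Rightarrow> nat"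
  where "coset_rep T q l t i =
    (if i \<in> {1..q} then inv_into {1..q} l (l i #>\<^bsub>T\<^esub> t) else i)"

lemma coset_rep_hom:
  fixes T (structure)
  assumes "group T" "subgroup H T" "labelling T H q l"
  shows "coset_rep T q l \<in> hom T (Sym q)"
proof -
  interpret group T by fact
  have l: "bij_betw l {1..q} (rcosets H)" using assms(3) by (simp add: labelling_def)
  have HT: "H \<subseteq> carrier T" using assms(2) by (rule subgroup.subset)
  have sub: "C \<subseteq> carrier T" if "C \<in> rcosets H" for C
    using that HT by (auto simp: RCOSETS_def r_coset_def)
  have cl: "C #> t \<in> rcosets H" if "C \<in> rcosets H" "t \<in> carrier T" for C t
    using that HT by (auto simp: RCOSETS_def coset_mult_assoc)
  have ml: "l i \<in> rcosets H" if "i \<in> {1..q}" for i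
    using l that by (auto simp: bij_betw_def)
  have il: "inv_into {1..q} l C \<in> {1..q}" "l (inv_into {1..q} l C) = C" if "C \<in> rcosets H" for C
    using that l by (auto simp: bij_betw_def inv_into_into f_inv_into_f simp del: atLeastAtMost_iff)
  have li: "inv_into {1..q} l (l i) = i" if "i \<in> {1..q}" for i
    using l that by (auto simp: bij_betw_def)
  have mult: "coset_rep T q l (s \<otimes> t) = coset_rep T q l t \<circ> coset_rep T q l s"
    if "s \<in> carrier T" "t \<in> carrier T" for s t
  proof
    fix i
    show "coset_rep T q l (s \<otimes> t) i = (coset_rep T q l t \<circ> coset_rep T q l s) i"
      using that il cl ml sub by (simp add: coset_rep_def coset_mult_assoc del: atLeastAtMost_iff)
  qed
  have one: "coset_rep T q l \<one> = id"
    using li ml sub by (auto simp: coset_rep_def fun_eq_iff)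
  have perm: "coset_rep T q l t permutes {1..q}" if "t \<in> carrier T" for t
  proof (rule bij_imp_permutes)
    have "coset_rep T q l (inv t) \<circ> coset_rep T q l t = id"
         "coset_rep T q l t \<circ> coset_rep T q l (inv t) = id"
      using that mult[of t "inv t"] mult[of "inv t" t] one by simp_all
    moreover have "coset_rep T q l s i \<in> {1..q}" if "s \<in> carrier T" "i \<in> {1..q}" for s i
      using that il cl ml by (simp add: coset_rep_def del: atLeastAtMost_iff)
    ultimately show "bij_betw (coset_rep T q l t) {1..q} {1..q}"
      using that
      by (intro bij_betwI[where g = "coset_rep T q l (inv t)"]) (auto simp: fun_eq_iff simp del: atLeastAtMost_iff)
  qed (auto simp: coset_rep_def)
  show ?thesis
    by (rule homI) (use mult perm in \<open>simp_all add: Sym_def opposite_def sym_group_def\<close>)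
qed


section \<open>Representations with different kernels\<close>

text \<open>
  \<open>\<delta>_tw \<ge> \<delta>_rep\<close> fails for arbitrary tuples of homomorphisms: an element in the kernel of some but
  not all of the \<open>\<rho>\<^sub>i\<close> gives two codewords of the twisted code that agree in whole blocks, while the
  codes of the \<open>\<rho>\<^sub>i\<close>, being sets, do not see the kernels. Therefore the inequality is stated
  for tuples with a common kernel (e.g. faithful representations), or with some trivial
  member, in which case \<open>\<delta>_rep = 0\<close>.
\<close>

lemma hamming_simps [simp]:
  "hamming [] [] = 0"
  "hamming (a # x) (b # y) = (if a = b then 0 else 1) + hamming x y"
proof -
  have "{i. i < length (a # x) \<and> (a # x) ! i \<noteq> (b # y) ! i} =
      (if a = b then {} else {0}) \<union> Suc ` {i. i < length x \<and> x ! i \<noteq> y ! i}" (is "?L = ?A \<union> ?B")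
    by (auto simp: less_Suc_eq_0_disj)
  moreover have "card (?A \<union> ?B) = card ?A + card ?B"
    by (rule card_Un_disjoint) auto
  moreover have "card ?B = card {i. i < length x \<and> x ! i \<noteq> y ! i}"
    by (rule card_image) simp
  ultimately show "hamming (a # x) (b # y) = (if a = b then 0 else 1) + hamming x y"
    by (simp add: hamming_def)
qed (simp add: hamming_def)

lemma min_dist_eqI:
  assumes "x \<in> C" "y \<in> C" "x \<noteq> y" "hamming x y = d"
    and "\<And>x y. x \<in> C \<Longrightarrow> y \<in> C \<Longrightarrow> x \<noteq> y \<Longrightarrow> d \<le> hamming x y"
  shows "min_dist C = d"
proof -
  have "\<not> is_singleton C" using assms(1-3) by (auto simp: is_singleton_def)
  moreover have "(LEAST d. \<exists>x\<in>C. \<exists>y\<in>C. x \<noteq> y \<and> d = hamming x y) = d"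
    using assms by (intro Least_equality) auto
  ultimately show ?thesis by (simp add: min_dist_def)
qed

lemma delta_rep_le_delta_tw_counterexample:
  fixes T :: "((nat \<Rightarrow> nat) \<times> (nat \<Rightarrow> nat)) monoid" and I
  defines "T \<equiv> Sym 2 \<times>\<times> Sym 2" and "I \<equiv> [fst, snd]"
  shows "group T" "set I \<subseteq> hom T (Sym 2)" "delta_tw T 2 I = 2" "delta_rep T 2 I = 4"
proof -
  let ?\<tau> = "Transposition.transpose 1 (2::nat)"
  have two: "{1..2} = {1, 2::nat}" by auto
  have S: "carrier (Sym 2) = {id, ?\<tau>}"
    unfolding Sym_def opposite_def sym_group_def two by (auto simp: permutes_doubleton_iff)
  have T: "carrier T = {(id, id), (id, ?\<tau>), (?\<tau>, id), (?\<tau>, ?\<tau>)}"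
    by (auto simp: T_def S)
  interpret S: group "sym_group 2" by (rule sym_group_is_group)
  have "group (Sym 2)"
    by (rule groupI)
       (use S.l_inv_ex S.r_inv_ex in \<open>auto simp: Sym_def opposite_def S.m_assoc intro: S.r_inv_ex\<close>)
  then show "group T" by (simp add: T_def DirProd_group)
  show "set I \<subseteq> hom T (Sym 2)" by (auto simp: I_def T_def hom_def)
  have u: "[Suc 0..<3] = [1, 2]" by (simp add: upt_rec)
  have tw: "twisted_code T 2 I = {[1,2,1,2], [1,2,2,1], [2,1,1,2], [2,1,2,1]}"
    by (auto simp: twisted_code_def T I_def alpha_def u)
  show "delta_tw T 2 I = 2"
    unfolding delta_tw_def tw
    by (rule min_dist_eqI[where x = "[1,2,1,2]" and y = "[1,2,2,1]"]) auto
  have r2: "concat (replicate 2 a) = a @ a" for a :: "nat list" by (simp add: numeral_2_eq_2)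
  have rep: "rep_code 2 (perm_code T 2 \<rho>) = {[1,2,1,2], [2,1,2,1]}" if "\<rho> \<in> {fst, snd}" for \<rho>
    using that unfolding rep_code_def perm_code_def T
    by (elim insertE emptyE) (simp_all add: alpha_def u r2 insert_commute)
  have "min_dist {[1,2,1,2], [2,1,2,1::nat]} = 4"
    by (rule min_dist_eqI[where x = "[1,2,1,2]" and y = "[2,1,2,1]"]) auto
  moreover have l: "length [fst, snd] = 2" by simp
  ultimately show "delta_rep T 2 I = 4"
    unfolding delta_rep_def I_def by (simp only: l rep list.set image_insert image_empty insert_iff simp_thms) simp
qed

end

theory Submission
  imports Defs
begin

section \<open>Code distances as numbers of moved points, and the general inequality\<close>

section \<open>Distances in twisted permutation codes\<close>

text \<open>Two codewords, those of \<open>s\<close> and \<open>t\<close>, differ in an entry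
  exactly when \<open>s t^-1\<close> moves the corresponding point, so their distance is the number
  of points moved by \<open>s t^-1\<close>, summed over the representations
  (\<open>hamming_twisted\<close>). A minimum distance is therefore the least nonzero
  \<open>weight\<close> of a group element (\<open>min_dist_twisted\<close>,
  \<open>delta_tw_eqI\<close>). The general inequality is an averaging argument
  (\<open>delta_rep_le_delta_tw\<close>): at an element of least nonzero weight every representation
  moves a point if the kernels agree, so \<open>r\<close> times each summand is at least the
  repetition bound, and adding the \<open>r\<close> summands gives the claim. If some member is
  trivial, the repetition bound is zero.

  The special codes then ask how many fixed points a nonidentity element can have in all
  representations together.

  For S6 and A6, an automorphism that sends a three-cycle to a three-cycle is a conjugation
  (\<open>conj_if_fixed_3\<close>): it sends the cycles (1 2 i) to three-cycles through one common
  directed edge, and the conjugating permutation can be read off. Any other automorphism sends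
  three-cycles and transpositions to elements without fixed points, so an involutory one leaves at
  most four fixed points to an element and its image together
  (\<open>fixed_add_fixed_\<phi>_le\<close>). An example, \<open>outer6\<close>, comes from a
  self-dual labelling of the six synthematic totals.

  For the affine group, a complement of the translations contains one element over each linear map.
  Its elements over two generators of GL(3,2) can be normalized by translations, which leaves two
  classes (\<open>compl_cases\<close>): the point stabilizer \<open>GL3\<close>, and the group
  \<open>K2\<close> of affine maps that stay affine after conjugation by the field inversion
  \<open>quad\<close>. The number of fixed cosets of an element is zero or the size of the fixed
  space of its linear part. Since a nonidentity element of \<open>K2\<close> fixes at most two
  points (\<open>K2_card_fixpoints_le\<close>), the counts for the two classes add up to at most
  four (\<open>cfix_GL3_K2\<close>).

  For degree sixty, a subgroup of order twelve of S6 has an element of order three, which is a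
  three-cycle, possibly after applying \<open>outer6\<close>. If it is a three-cycle, the subgroup
  is conjugate to \<open>A4\<close> or to \<open>D12\<close> (\<open>order_12_three_cycle\<close>);
  hence there are four classes. Their cosets have concrete models (an ordered pair of points with a
  sign, a point with a disjoint pair) in which fixed points are counted by explicit formulas. Only
  transpositions, three-cycles and the \<open>outer6\<close>-images of these have more than four
  fixed points somewhere (\<open>fix12_cases\<close>), so the distance is 240 minus the largest of
  four linear forms in the multiplicities of the classes (\<open>code_max\<close>,
  \<open>delta_tw_\<rho>\<close>).\<close>

definition moved :: "nat \<Rightarrow> (nat \<Rightarrow> nat) \<Rightarrow> nat"
  where "moved q p = card {i \<in> {1..q}. p i \<noteq> i}"

definition fixed :: "nat \<Rightarrow> (nat \<Rightarrow> nat) \<Rightarrow> nat"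
  where "fixed q p = card {i \<in> {1..q}. p i = i}"

definition weight :: "nat \<Rightarrow> ('a \<Rightarrow> nat \<Rightarrow> nat) list \<Rightarrow> 'a \<Rightarrow> nat"
  where "weight q I t = (\<Sum>\<rho>\<leftarrow>I. moved q (\<rho> t))"

lemma fixed_add_moved: "fixed q p + moved q p = q"
proof -
  have "fixed q p + moved q p = card ({i \<in> {1..q}. p i = i} \<union> {i \<in> {1..q}. p i \<noteq> i})"
    unfolding fixed_def moved_def by (rule card_Un_disjoint[symmetric]) auto
  also have "{i \<in> {1..q}. p i = i} \<union> {i \<in> {1..q}. p i \<noteq> i} = {1..q}" by auto
  finally show ?thesis by simp
qed

lemma moved_eq: "moved q p = q - fixed q p"
  using fixed_add_moved[of q p] by simp

lemma fixed_le: "fixed q p \<le> q"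
  using fixed_add_moved[of q p] by simp

lemma carrier_Sym: "carrier (Sym q) = {p. p permutes {1..q}}"
  and mult_Sym: "g \<otimes>\<^bsub>Sym q\<^esub> h = h \<circ> g"
  and one_Sym: "\<one>\<^bsub>Sym q\<^esub> = id"
  by (simp_all add: Sym_def opposite_def sym_group_def)

lemma carrier_Alt: "carrier (Alt q) = {p. p permutes {1..q} \<and> evenperm p}"
  and mult_Alt: "g \<otimes>\<^bsub>Alt q\<^esub> h = h \<circ> g"
  and one_Alt: "\<one>\<^bsub>Alt q\<^esub> = id"
  by (simp_all add: Alt_def opposite_def alt_group_def sym_group_def)

lemma group_Sym: "group (Sym q)"
proof (rule groupI)
  fix x assume "x \<in> carrier (Sym q)"
  then show "\<exists>y\<in>carrier (Sym q). y \<otimes>\<^bsub>Sym q\<^esub> x = \<one>\<^bsub>Sym q\<^esub>"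
    by (intro bexI[of _ "inv' x"]) (auto simp: carrier_Sym mult_Sym one_Sym permutes_inv permutes_inv_o)
qed (auto simp: carrier_Sym mult_Sym one_Sym permutes_compose permutes_id o_assoc)

lemma evenperm_compose_permutes:
  "p permutes {1..q::nat} \<Longrightarrow> r permutes {1..q} \<Longrightarrow> evenperm (p \<circ> r) = (evenperm p = evenperm r)"
  by (rule evenperm_comp) (auto simp: permutation_permutes)

lemma evenperm_inv_permutes: "p permutes {1..q::nat} \<Longrightarrow> evenperm (inv' p) = evenperm p"
  by (rule evenperm_inv) (auto simp: permutation_permutes)

lemma group_Alt: "group (Alt q)"
proof (rule groupI)
  fix x assume "x \<in> carrier (Alt q)"
  then show "\<exists>y\<in>carrier (Alt q). y \<otimes>\<^bsub>Alt q\<^esub> x = \<one>\<^bsub>Alt q\<^esub>"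
    by (intro bexI[of _ "inv' x"])
       (auto simp: carrier_Alt mult_Alt one_Alt permutes_inv permutes_inv_o evenperm_inv_permutes)
qed (auto simp: carrier_Alt mult_Alt one_Alt permutes_compose permutes_id o_assoc
       evenperm_compose_permutes evenperm_id)

lemma inv_Sym: "p permutes {1..q} \<Longrightarrow> inv\<^bsub>Sym q\<^esub> p = inv' p"
  by (rule group.inv_equality[OF group_Sym])
     (auto simp: carrier_Sym mult_Sym one_Sym permutes_inv permutes_inv_o)

lemma hamming_eq_0_iff: "length x = length y \<Longrightarrow> hamming x y = 0 \<longleftrightarrow> x = y"
  by (induction x y rule: list_induct2) auto

lemma hamming_append:
  "length x = length y \<Longrightarrow> hamming (x @ u) (y @ v) = hamming x y + hamming u v"
  by (induction x y rule: list_induct2) auto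

lemma hamming_alpha: "hamming (alpha q \<rho> s) (alpha q \<rho> t) = card {i \<in> {1..q}. \<rho> s i \<noteq> \<rho> t i}"
proof -
  \<comment> \<open>List positions start at 0 while points start at 1; hence the shift by
    \<open>Suc\<close>.\<close>
  have "{i \<in> {1..q}. \<rho> s i \<noteq> \<rho> t i} = Suc ` {i. i < q \<and> \<rho> s (Suc i) \<noteq> \<rho> t (Suc i)}"
    by (auto simp: image_iff) (metis Suc_le_D less_eq_Suc_le not_less_eq_eq)
  then show ?thesis
    by (simp add: hamming_def alpha_def card_image del: upt_Suc cong: conj_cong)
qed

lemma length_alpha [simp]: "length (alpha q \<rho> t) = q"
  by (simp add: alpha_def)

lemma hamming_concat_alpha:
  "hamming (concat (map (\<lambda>\<rho>. alpha q \<rho> s) I)) (concat (map (\<lambda>\<rho>. alpha q \<rho> t) I)) =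
    (\<Sum>\<rho>\<leftarrow>I. card {i \<in> {1..q}. \<rho> s i \<noteq> \<rho> t i})"
  by (induction I) (simp_all add: hamming_append hamming_alpha)

text \<open>Apply the inverse of \<open>\<rho> t\<close> to both letters; as permutations act on the
  right, this gives the image of \<open>s\<close> times the inverse of \<open>t\<close>.\<close>

lemma Sym_hom_differ:
  assumes "group T" "\<rho> \<in> hom T (Sym q)" "s \<in> carrier T" "t \<in> carrier T"
  shows "\<rho> s i \<noteq> \<rho> t i \<longleftrightarrow> \<rho> (s \<otimes>\<^bsub>T\<^esub> inv\<^bsub>T\<^esub> t) i \<noteq> i"
proof -
  interpret group T by fact
  interpret h: group_hom T "Sym q" \<rho>
    using assms group_Sym by (auto simp: group_hom_def group_hom_axioms_def)
  have t: "\<rho> t permutes {1..q}" using assms(4) h.hom_closed[of t] by (simp add: carrier_Sym)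
  have "\<rho> (s \<otimes>\<^bsub>T\<^esub> inv\<^bsub>T\<^esub> t) = inv' (\<rho> t) \<circ> \<rho> s"
    using assms t by (simp add: mult_Sym inv_Sym)
  then show ?thesis using t by (simp add: permutes_inv_eq) (metis)
qed

lemma hamming_twisted:
  assumes "group T" "set I \<subseteq> hom T (Sym q)" "s \<in> carrier T" "t \<in> carrier T"
  shows "hamming (concat (map (\<lambda>\<rho>. alpha q \<rho> s) I)) (concat (map (\<lambda>\<rho>. alpha q \<rho> t) I)) =
    weight q I (s \<otimes>\<^bsub>T\<^esub> inv\<^bsub>T\<^esub> t)"
proof -
  have "card {i \<in> {1..q}. \<rho> s i \<noteq> \<rho> t i} = moved q (\<rho> (s \<otimes>\<^bsub>T\<^esub> inv\<^bsub>T\<^esub> t))" if "\<rho> \<in> set I" for \<rho>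
    using Sym_hom_differ[of T \<rho> q s t] assms that by (auto simp: moved_def)
  then show ?thesis
    unfolding hamming_concat_alpha weight_def by (intro arg_cong[of _ _ sum_list] map_cong) auto
qed

text \<open>Distances depend only on the quotient of the two group elements, and comparison with the
  codeword of the identity realizes every weight. The value 0 is the convention of
  \<open>min_dist\<close> for a single codeword.\<close>

lemma min_dist_twisted:
  fixes T (structure)
  assumes "group T" "set I \<subseteq> hom T (Sym q)"
  shows "delta_tw T q I = (if \<forall>t\<in>carrier T. weight q I t = 0 then 0
    else LEAST d. \<exists>t\<in>carrier T. weight q I t \<noteq> 0 \<and> d = weight q I t)"
proof -
  interpret group T by fact
  define c where "c t = concat (map (\<lambda>\<rho>. alpha q \<rho> t) I)" for t
  let ?C = "twisted_code T q I"
  have C: "?C = c ` carrier T" by (simp add: twisted_code_def c_def)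
  have len: "length (c t) = length (c s)" for s t by (simp add: c_def length_concat comp_def)
  have ham: "hamming (c s) (c t) = weight q I (s \<otimes> inv t)"
    if "s \<in> carrier T" "t \<in> carrier T" for s t
    using hamming_twisted[OF assms that] unfolding c_def .
  have neq: "c s \<noteq> c t \<longleftrightarrow> weight q I (s \<otimes> inv t) \<noteq> 0" if "s \<in> carrier T" "t \<in> carrier T" for s t
    unfolding ham[OF that, symmetric] using hamming_eq_0_iff[OF len] by metis
  have "(\<exists>x\<in>?C. \<exists>y\<in>?C. x \<noteq> y \<and> d = hamming x y) \<longleftrightarrow>
      (\<exists>t\<in>carrier T. weight q I t \<noteq> 0 \<and> d = weight q I t)" (is "?L = ?R") for d
  proof
    assume ?L
    then obtain s t where st: "s \<in> carrier T" "t \<in> carrier T" "c s \<noteq> c t"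
      "d = hamming (c s) (c t)" unfolding C by auto
    then show ?R using neq[OF st(1,2)] ham[OF st(1,2)]
      by (intro bexI[of _ "s \<otimes> inv t"]) auto
  next
    assume ?R
    then obtain t where t: "t \<in> carrier T" "weight q I t \<noteq> 0" "d = weight q I t" by auto
    then have "c t \<noteq> c \<one>" "d = hamming (c t) (c \<one>)"
      using neq[of t \<one>] ham[OF t(1) one_closed] by simp_all
    then show ?L unfolding C using t(1) by blast
  qed
  note D = this
  have "is_singleton ?C \<longleftrightarrow> (\<forall>t\<in>carrier T. weight q I t = 0)"
  proof
    assume "is_singleton ?C"
    then obtain x where x: "?C = {x}" by (auto simp: is_singleton_def)
    show "\<forall>t\<in>carrier T. weight q I t = 0"
    proof
      fix t assume t: "t \<in> carrier T"
      have "c t \<in> ?C" "c \<one> \<in> ?C" using t unfolding C by blast+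
      then show "weight q I t = 0" using neq[OF t one_closed] t x by simp
    qed
  next
    assume w: "\<forall>t\<in>carrier T. weight q I t = 0"
    have "c t = c \<one>" if "t \<in> carrier T" for t using neq[OF that one_closed] w that by simp
    then have "?C = {c \<one>}" unfolding C using one_closed by blast
    then show "is_singleton ?C" by (auto simp: is_singleton_def)
  qed
  then show ?thesis by (simp add: delta_tw_def min_dist_def D)
qed

lemma delta_tw_eqI:
  assumes "group T" "set I \<subseteq> hom T (Sym q)"
    and "t \<in> carrier T" "weight q I t = d" "d > 0"
    and "\<And>s. s \<in> carrier T \<Longrightarrow> weight q I s = 0 \<or> d \<le> weight q I s"
  shows "delta_tw T q I = d"
proof -
  have least: "(LEAST d. \<exists>t\<in>carrier T. weight q I t \<noteq> 0 \<and> d = weight q I t) = d"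
  proof (rule Least_equality)
    show "\<exists>t\<in>carrier T. weight q I t \<noteq> 0 \<and> d = weight q I t"
      using assms(3-5) by (intro bexI[of _ t] conjI) simp_all
    show "d \<le> e" if "\<exists>t\<in>carrier T. weight q I t \<noteq> 0 \<and> e = weight q I t" for e
      using that assms(6) by metis
  qed
  have nz: "\<not> (\<forall>t\<in>carrier T. weight q I t = 0)"
  proof
    assume "\<forall>t\<in>carrier T. weight q I t = 0"
    then have "weight q I t = 0" using assms(3) by blast
    then show False using assms(4,5) by simp
  qed
  show ?thesis unfolding min_dist_twisted[OF assms(1,2)] if_not_P[OF nz] by (rule least)
qed

lemma delta_tw_least:
  assumes "group T" "set I \<subseteq> hom T (Sym q)" "t \<in> carrier T" "weight q I t \<noteq> 0"
  obtains s where "s \<in> carrier T" "weight q I s \<noteq> 0" "delta_tw T q I = weight q I s"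
    "\<And>t. t \<in> carrier T \<Longrightarrow> weight q I t \<noteq> 0 \<Longrightarrow> delta_tw T q I \<le> weight q I t"
proof -
  let ?P = "\<lambda>d. \<exists>t\<in>carrier T. weight q I t \<noteq> 0 \<and> d = weight q I t"
  have d: "delta_tw T q I = (LEAST d. ?P d)"
  proof -
    have "\<not> (\<forall>t\<in>carrier T. weight q I t = 0)" using assms(3,4) by auto
    then show ?thesis unfolding min_dist_twisted[OF assms(1,2)] by (rule if_not_P)
  qed
  have P: "?P (LEAST d. ?P d)" by (rule LeastI_ex) (use assms(3,4) in blast)
  have le: "delta_tw T q I \<le> weight q I t" if "t \<in> carrier T" "weight q I t \<noteq> 0" for t
    unfolding d by (rule Least_le) (use that in blast)
  from P obtain s where "s \<in> carrier T" "weight q I s \<noteq> 0" "delta_tw T q I = weight q I s"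
    unfolding d[symmetric] by blast
  then show ?thesis by (rule that) (rule le)
qed

lemma weight_replicate: "weight q (replicate r \<rho>) t = r * moved q (\<rho> t)"
  by (simp add: weight_def sum_list_replicate)

lemma rep_code_eq: "rep_code r (perm_code T q \<rho>) = twisted_code T q (replicate r \<rho>)"
  by (simp add: rep_code_def perm_code_def twisted_code_def image_image)

lemma delta_rep_eq:
  "delta_rep T q I = Min ((\<lambda>\<rho>. delta_tw T q (replicate (length I) \<rho>)) ` set I)"
  by (simp add: delta_rep_def rep_code_eq delta_tw_def)

lemma kernel_Sym: "kernel T (Sym q) \<rho> = {t \<in> carrier T. \<rho> t = id}"
  by (simp add: kernel_def one_Sym)

lemma moved_eq_0_iff: "p permutes {1..q} \<Longrightarrow> moved q p = 0 \<longleftrightarrow> p = id"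
  unfolding moved_def by (subst card_0_eq) (auto simp: permutes_def fun_eq_iff)

text \<open>Each block lists the values of one permutation, so it contains every letter
  once.\<close>

lemma freq_perm_array_twisted:
  assumes "set I \<subseteq> hom T (Sym q)"
  shows "freq_perm_array q (length I) (twisted_code T q I)"
proof -
  have "length (concat (map (\<lambda>\<rho>. alpha q \<rho> t) I)) = length I * q \<and>
      set (concat (map (\<lambda>\<rho>. alpha q \<rho> t) I)) \<subseteq> {1..q} \<and>
      (\<forall>i\<in>{1..q}. count_list (concat (map (\<lambda>\<rho>. alpha q \<rho> t) I)) i = length I)"
    if t: "t \<in> carrier T" for t
    using assms
  proof (induction I)
    case (Cons \<rho> I)
    have p: "\<rho> t permutes {1..q}" using Cons.prems t by (auto simp: hom_def carrier_Sym)
    have s: "set (alpha q \<rho> t) = {1..q}"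
      using permutes_image[OF p] by (simp add: alpha_def atLeastLessThanSuc_atLeastAtMost del: upt_Suc)
    have "distinct (alpha q \<rho> t)"
      using permutes_inj[OF p] by (auto simp: alpha_def distinct_map intro: inj_on_subset)
    then have "count_list (alpha q \<rho> t) i = 1" if "i \<in> {1..q}" for i
      using that s by (simp add: distinct_count_atmost_1 count_mset[symmetric] flip: s)
    then show ?case using Cons s by (auto simp: alpha_def simp del: upt_Suc)
  qed simp
  then show ?thesis by (auto simp: freq_perm_array_def twisted_code_def)
qed

text \<open>Averaging: evaluate all members of \<open>I\<close> at one element \<open>s\<close> of
  least nonzero weight. A trivial member makes its repetition code a single word, and then the left
  side is 0.\<close>

lemma delta_rep_le_delta_tw:
  assumes T: "group T" and I: "I \<noteq> []" "set I \<subseteq> hom T (Sym q)"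
    and ker: "(\<forall>\<rho>\<in>set I. \<forall>\<sigma>\<in>set I. kernel T (Sym q) \<rho> = kernel T (Sym q) \<sigma>) \<or>
      (\<exists>\<rho>\<in>set I. kernel T (Sym q) \<rho> = carrier T)"
  shows "delta_rep T q I \<le> delta_tw T q I"
proof -
  let ?r = "length I"
  have perm: "\<rho> t permutes {1..q}" if "\<rho> \<in> set I" "t \<in> carrier T" for \<rho> t
    using that I(2) by (auto simp: hom_def carrier_Sym)
  have sub: "set (replicate ?r \<rho>) \<subseteq> hom T (Sym q)" if "\<rho> \<in> set I" for \<rho>
    using that I(2) by auto
  have le: "delta_rep T q I \<le> delta_tw T q (replicate ?r \<rho>)" if "\<rho> \<in> set I" for \<rho>
    unfolding delta_rep_eq using that by (intro Min_le) auto
  show ?thesis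
  proof (cases "\<exists>\<rho>\<in>set I. kernel T (Sym q) \<rho> = carrier T")
    case True
    then obtain \<rho> where \<rho>: "\<rho> \<in> set I" "kernel T (Sym q) \<rho> = carrier T" by blast
    then have "weight q (replicate ?r \<rho>) t = 0" if "t \<in> carrier T" for t
      using that perm by (auto simp: weight_replicate kernel_Sym moved_eq_0_iff)
    then have "delta_tw T q (replicate ?r \<rho>) = 0" by (simp add: min_dist_twisted[OF T sub[OF \<rho>(1)]])
    then show ?thesis using le[OF \<rho>(1)] by simp
  next
    case False
    then have ker: "kernel T (Sym q) \<rho> = kernel T (Sym q) \<sigma>" if "\<rho> \<in> set I" "\<sigma> \<in> set I" for \<rho> \<sigma>
      using ker that by blast
    obtain \<rho> where \<rho>: "\<rho> \<in> set I" using I(1) by (meson last_in_set)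
    then obtain t where t: "t \<in> carrier T" "\<rho> t \<noteq> id" using False by (auto simp: kernel_Sym)
    have "moved q (\<rho> t) \<in> set (map (\<lambda>\<rho>. moved q (\<rho> t)) I)" using \<rho> by simp
    then have "moved q (\<rho> t) \<le> weight q I t" unfolding weight_def by (rule member_le_sum_list) simp
    then have "weight q I t \<noteq> 0" using moved_eq_0_iff[OF perm[OF \<rho> t(1)]] t(2) by simp
    from delta_tw_least[OF T I(2) t(1) this] obtain s where s: "s \<in> carrier T"
      "weight q I s \<noteq> 0" "delta_tw T q I = weight q I s" by metis
    obtain \<sigma> where \<sigma>: "\<sigma> \<in> set I" "moved q (\<sigma> s) \<noteq> 0"
      using s(2) by (auto simp: weight_def)
    \<comment> \<open>The member \<open>\<sigma>\<close> acts nontrivially at \<open>s\<close>,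
      hence by the common kernel so does \<open>\<tau>\<close>, and \<open>s\<close> yields a
      positive distance in the repetition code of \<open>\<tau>\<close>.\<close>
    have "delta_rep T q I \<le> ?r * moved q (\<tau> s)" if \<tau>: "\<tau> \<in> set I" for \<tau>
    proof -
      have "\<tau> s \<noteq> id"
        using ker[OF \<tau> \<sigma>(1)] \<sigma>(2) s(1) moved_eq_0_iff[OF perm[OF \<sigma>(1) s(1)]] by (auto simp: kernel_Sym)
      then have w: "weight q (replicate ?r \<tau>) s \<noteq> 0"
        using moved_eq_0_iff[OF perm[OF \<tau> s(1)]] I(1) by (simp add: weight_replicate)
      from delta_tw_least[OF T sub[OF \<tau>] s(1) w] s(1) w
      have "delta_tw T q (replicate ?r \<tau>) \<le> weight q (replicate ?r \<tau>) s" by metis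
      then show ?thesis using le[OF \<tau>] by (simp add: weight_replicate)
    qed
    then have "(\<Sum>\<tau>\<leftarrow>I. delta_rep T q I) \<le> (\<Sum>\<tau>\<leftarrow>I. ?r * moved q (\<tau> s))"
      by (intro sum_list_mono) auto
    also have "\<dots> = ?r * weight q I s" by (simp add: weight_def sum_list_const_mult)
    finally show ?thesis using I(1) s(3) by (simp add: sum_list_triv)
  qed
qed

section \<open>Counting fixed cosets in a concrete model of the coset space\<close>

section \<open>Fixed points of coset actions\<close>

text \<open>The map \<open>f\<close> separates exactly the right cosets of \<open>H\<close>, so its
  image is a model of the coset space, and there \<open>t\<close> acts as \<open>m\<close>. Fixed
  points can be counted in the model, whatever the labelling \<open>l\<close>.\<close>

lemma fixed_coset_rep:
  fixes T (structure)
  assumes T: "group T" and H: "subgroup H T" and l: "labelling T H q l" and t: "t \<in> carrier T"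
    and f: "\<And>g g'. g \<in> carrier T \<Longrightarrow> g' \<in> carrier T \<Longrightarrow> f g = f g' \<longleftrightarrow> g' \<otimes> inv g \<in> H"
    and m: "\<And>g. g \<in> carrier T \<Longrightarrow> f (g \<otimes> t) = m (f g)"
  shows "fixed q (coset_rep T q l t) = card {y \<in> f ` carrier T. m y = y}"
proof -
  interpret group T by fact
  have bl: "bij_betw l {1..q} (rcosets H)" using l by (simp add: labelling_def)
  have HT: "H \<subseteq> carrier T" using H by (rule subgroup.subset)
  have eq: "H #> g = H #> g' \<longleftrightarrow> f g = f g'" if g: "g \<in> carrier T" "g' \<in> carrier T" for g g'
  proof -
    have "H #> g = H #> g' \<longleftrightarrow> g' \<in> H #> g"
      using repr_independence[OF _ g(1) H, of g'] g H rcos_self by metis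
    also have "\<dots> \<longleftrightarrow> g' \<otimes> inv g \<in> H"
    proof
      assume "g' \<in> H #> g"
      then obtain h where "h \<in> H" "g' = h \<otimes> g" by (auto simp: r_coset_def)
      then show "g' \<otimes> inv g \<in> H" using g HT by (auto simp: m_assoc)
    next
      assume "g' \<otimes> inv g \<in> H"
      moreover have "g' = g' \<otimes> inv g \<otimes> g" using g by (simp add: m_assoc)
      ultimately show "g' \<in> H #> g" unfolding r_coset_def by blast
    qed
    finally show ?thesis using f g by simp
  qed
  let ?F = "{i \<in> {1..q}. coset_rep T q l t i = i}"
  let ?G = "{C \<in> rcosets H. C #> t = C}"
  have mem: "C #> t \<in> rcosets H" if "C \<in> rcosets H" for C
    using that HT t by (auto simp: RCOSETS_def coset_mult_assoc)
  have fx: "coset_rep T q l t i = i \<longleftrightarrow> l i #> t = l i" if i: "i \<in> {1..q}" for i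
  proof -
    have "l i \<in> rcosets H" using bl i by (auto simp: bij_betw_def)
    then have *: "l i #> t \<in> l ` {1..q}" using mem bl by (simp add: bij_betw_def)
    have "inv_into {1..q} l (l i #> t) = i \<longleftrightarrow> l i #> t = l i"
      using * f_inv_into_f[OF *] bl i by (metis bij_betw_inv_into_left)
    then show ?thesis using i by (simp add: coset_rep_def)
  qed
  have "bij_betw l ?F ?G"
  proof (rule bij_betw_subset[OF bl])
    show "?F \<subseteq> {1..q}" by blast
    show "l ` ?F = ?G"
    proof (intro equalityI subsetI)
      fix C assume C: "C \<in> ?G"
      then obtain i where "i \<in> {1..q}" "C = l i" using bl unfolding bij_betw_def by blast
      then show "C \<in> l ` ?F" using fx C by blast
    qed (use bl fx in \<open>auto simp: bij_betw_def\<close>)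
  qed
  then have cF: "fixed q (coset_rep T q l t) = card ?G" unfolding fixed_def by (rule bij_betw_same_card)
  \<comment> \<open>A value of \<open>f\<close> recovers its coset through an arbitrarily chosen
    preimage.\<close>
  have "bij_betw (\<lambda>y. H #> (SOME g. g \<in> carrier T \<and> f g = y)) {y \<in> f ` carrier T. m y = y} ?G"
    (is "bij_betw ?k _ _")
  proof -
    have some: "?k (f g) = H #> g" if g: "g \<in> carrier T" for g
    proof -
      have "(SOME g'. g' \<in> carrier T \<and> f g' = f g) \<in> carrier T \<and> f (SOME g'. g' \<in> carrier T \<and> f g' = f g) = f g"
        by (rule someI[of _ g]) (use g in blast)
      then show ?thesis using eq g by simp
    qed
    have fixg: "(H #> g) #> t = H #> g \<longleftrightarrow> m (f g) = f g" if "g \<in> carrier T" for g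
      using that eq[of "g \<otimes> t" g] t HT m by (simp add: coset_mult_assoc)
    show ?thesis
    proof (rule bij_betw_imageI)
      show "inj_on ?k {y \<in> f ` carrier T. m y = y}"
        by (rule inj_onI) (auto simp: some eq)
      show "?k ` {y \<in> f ` carrier T. m y = y} = ?G"
      proof (intro equalityI subsetI)
        fix C assume "C \<in> ?k ` {y \<in> f ` carrier T. m y = y}"
        then obtain g where "g \<in> carrier T" "m (f g) = f g" "C = H #> g" by (auto simp: some)
        then show "C \<in> ?G" using fixg by (auto simp: RCOSETS_def)
      next
        fix C assume "C \<in> ?G"
        then obtain g where "g \<in> carrier T" "C = H #> g" "m (f g) = f g"
          using fixg by (auto simp: RCOSETS_def)
        then show "C \<in> ?k ` {y \<in> f ` carrier T. m y = y}"
          by (intro image_eqI[of _ _ "f g"]) (auto simp: some)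
      qed
    qed
  qed
  then show ?thesis unfolding cF by (rule bij_betw_same_card[symmetric])
qed

section \<open>Conjugacy of subsets as an equivalence relation\<close>

section \<open>Conjugacy and class representatives\<close>

lemma conjugate_iff:
  fixes G (structure)
  assumes "group G" "H \<subseteq> carrier G"
  shows "conjugate G H K \<longleftrightarrow> (\<exists>g\<in>carrier G. K = (\<lambda>h. inv g \<otimes> h \<otimes> g) ` H)"
  by (auto simp: conjugate_def l_coset_def r_coset_def)

lemma conjugate_subset:
  fixes G (structure)
  assumes "group G" "H \<subseteq> carrier G" "conjugate G H K"
  shows "K \<subseteq> carrier G"
proof -
  interpret group G by fact
  show ?thesis using assms unfolding conjugate_iff[OF assms(1,2)] by auto
qed

lemma conjugate_refl:
  fixes G (structure)
  assumes "group G" "H \<subseteq> carrier G"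
  shows "conjugate G H H"
proof -
  interpret group G by fact
  have "(\<lambda>h. inv \<one> \<otimes> h \<otimes> \<one>) ` H = id ` H" using assms(2) by (intro image_cong) auto
  then show ?thesis unfolding conjugate_iff[OF assms] by (intro bexI[of _ \<one>]) auto
qed

lemma conjugate_trans:
  fixes G (structure)
  assumes G: "group G" and H: "H \<subseteq> carrier G" and "conjugate G H K" "conjugate G K L"
  shows "conjugate G H L"
proof -
  interpret group G by fact
  have K: "K \<subseteq> carrier G" by (rule conjugate_subset) fact+
  obtain g where g: "g \<in> carrier G" "K = (\<lambda>h. inv g \<otimes> h \<otimes> g) ` H"
    using assms(3) unfolding conjugate_iff[OF G H] by blast
  obtain k where k: "k \<in> carrier G" "L = (\<lambda>h. inv k \<otimes> h \<otimes> k) ` K"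
    using assms(4) unfolding conjugate_iff[OF G K] by blast
  have "L = (\<lambda>h. inv (g \<otimes> k) \<otimes> h \<otimes> (g \<otimes> k)) ` H"
    unfolding k(2) g(2) image_image using g(1) k(1) H
    by (intro image_cong) (auto simp: inv_mult_group m_assoc)
  then show ?thesis unfolding conjugate_iff[OF G H] using g(1) k(1) by blast
qed

lemma conjugate_sym:
  fixes G (structure)
  assumes G: "group G" and H: "H \<subseteq> carrier G" and "conjugate G H K"
  shows "conjugate G K H"
proof -
  interpret group G by fact
  have K: "K \<subseteq> carrier G" by (rule conjugate_subset) fact+
  obtain g where g: "g \<in> carrier G" "K = (\<lambda>h. inv g \<otimes> h \<otimes> g) ` H"
    using assms(3) unfolding conjugate_iff[OF G H] by blast
  have "(\<lambda>h. inv (inv g) \<otimes> h \<otimes> inv g) ` K = id ` H"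
    unfolding g(2) image_image
  proof (intro image_cong refl)
    fix h assume "h \<in> H"
    then have "h \<in> carrier G" using H by blast
    moreover from this have "g \<otimes> (inv g \<otimes> (h \<otimes> (g \<otimes> inv g))) = h"
      using g(1) by (simp flip: m_assoc)
    ultimately show "inv (inv g) \<otimes> (inv g \<otimes> h \<otimes> g) \<otimes> inv g = id h" using g(1) by (simp add: m_assoc)
  qed
  then show ?thesis unfolding conjugate_iff[OF G K] using g(1)
    by (intro bexI[of _ "inv g"]) auto
qed

lemma weight_one:
  assumes "group T" "set I \<subseteq> hom T (Sym q)"
  shows "weight q I \<one>\<^bsub>T\<^esub> = 0"
proof -
  have "\<rho> \<one>\<^bsub>T\<^esub> = id" if "\<rho> \<in> set I" for \<rho>
    using hom_one[of \<rho> T "Sym q"] assms group_Sym that by (auto simp: one_Sym)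
  then show ?thesis by (auto simp: weight_def moved_def)
qed

section \<open>AGL(3,2) as the group of bijections preserving sums of three points\<close>

section \<open>Affine maps of the binary three-space\<close>

lemma bit_vec_add_self [simp]: "v + v = (0 :: bit ^ 'n)"
  by (simp add: vec_eq_iff)

lemma bit_vec_add_left_self [simp]: "v + (v + w) = (w :: bit ^ 'n)"
  by (simp add: add.assoc[symmetric])

lemma bit_vec_add_eq_0_iff: "v + w = 0 \<longleftrightarrow> v = (w :: bit ^ 'n)"
  by (metis bit_vec_add_self add_left_cancel)

lemma bit_vec_add_eq_iff: "v + w = u \<longleftrightarrow> v = u + (w :: bit ^ 'n)"
  by (auto simp: add.assoc)

text \<open>Over the two-element field, \<open>x + y + z\<close> is the general affine combination of three points.\<close>

definition affine_map :: "(bit ^ 3 \<Rightarrow> bit ^ 3) \<Rightarrow> bool"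
  where "affine_map f \<longleftrightarrow> (\<forall>x y z. f (x + y + z) = f x + f y + f z)"

text \<open>The linear part of an affine map; in characteristic two, subtracting \<open>f 0\<close>
  is adding it.\<close>

definition lin :: "(bit ^ 3 \<Rightarrow> bit ^ 3) \<Rightarrow> bit ^ 3 \<Rightarrow> bit ^ 3"
  where "lin f v = f v + f 0"

definition transl :: "bit ^ 3 \<Rightarrow> bit ^ 3 \<Rightarrow> bit ^ 3"
  where "transl w v = v + w"

definition affs :: "(bit ^ 3 \<Rightarrow> bit ^ 3) set"
  where "affs = {f. bij f \<and> affine_map f}"

lemma affine_mapD: "affine_map f \<Longrightarrow> f (x + y + z) = f x + f y + f z"
  by (simp add: affine_map_def)

lemma lin_add: "affine_map f \<Longrightarrow> lin f (x + y) = lin f x + lin f y"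
  using affine_mapD[of f x y 0] by (simp add: lin_def ac_simps)

lemma lin_0 [simp]: "lin f 0 = 0"
  by (simp add: lin_def)

lemma affine_map_add: "affine_map f \<Longrightarrow> f (x + y) = f x + lin f y"
  using affine_mapD[of f x y 0] by (simp add: lin_def ac_simps)

lemma bit_smult_vec: "affine_map f \<Longrightarrow> lin f (c *s x) = c *s lin f x"
  by (cases c) simp_all

text \<open>Matrices act on row vectors here, so the rows are the images of the basis
  vectors.\<close>

lemma lin_matrix:
  assumes "affine_map f"
  shows "lin f v = v v* (\<chi> i. lin f (axis i 1))"
proof -
  have "lin f v = lin f (\<Sum>i\<in>UNIV. v $ i *s axis i 1)" by (simp add: basis_expansion)
  also have "\<dots> = (\<Sum>i\<in>UNIV. v $ i *s lin f (axis i 1))"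
    using assms by (simp add: sum_3 lin_add bit_smult_vec)
  also have "\<dots> = v v* (\<chi> i. lin f (axis i 1))"
    by (simp add: vector_matrix_mult_def vec_eq_iff sum_3)
  finally show ?thesis .
qed

text \<open>For the harder inclusion, an affine bijection is its linear part, given by the matrix of
  \<open>lin_matrix\<close>, followed by the translation by \<open>f 0\<close>.\<close>

lemma affs_carrier: "carrier AGL32 = affs"
proof (intro equalityI subsetI)
  fix f assume "f \<in> carrier AGL32"
  then obtain A :: "bit ^ 3 ^ 3" and w where A: "invertible A" and f: "f = (\<lambda>v. v v* A + w)"
    by (auto simp: AGL_def)
  obtain B where B: "A ** B = mat 1" "B ** A = mat 1" using A by (auto simp: invertible_def)
  have "bij f"
  proof (rule o_bij)
    show "(\<lambda>v. (v + w) v* B) \<circ> f = id" using B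
      by (auto simp: f fun_eq_iff vector_matrix_mul_assoc add.assoc)
    show "f \<circ> (\<lambda>v. (v + w) v* B) = id" using B
      by (auto simp: f fun_eq_iff vector_matrix_mul_assoc add.assoc)
  qed
  moreover have "affine_map f"
    by (simp add: affine_map_def f vector_matrix_left_distrib ac_simps)
  ultimately show "f \<in> affs" by (simp add: affs_def)
next
  fix f assume "f \<in> affs"
  then have f: "bij f" "affine_map f" by (auto simp: affs_def)
  let ?A = "\<chi> i. lin f (axis i 1) :: bit ^ 3 ^ 3"
  \<comment> \<open>The criterion \<open>matrix_left_invertible_injective\<close> is about column
    vectors; hence the detour through the transpose.\<close>
  have "inj (\<lambda>v. transpose ?A *v v)"
    using bij_is_inj[OF f(1)]
    by (simp add: lin_matrix[OF f(2), symmetric] inj_def) (simp add: lin_def)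
  then obtain B where "B ** transpose ?A = mat 1" using matrix_left_invertible_injective by blast
  then have "transpose (B ** transpose ?A) = mat 1" by (simp add: transpose_mat)
  then have "?A ** transpose B = mat 1" by (simp add: matrix_transpose_mul)
  then have "invertible ?A" using invertible_right_inverse by blast
  moreover have "f = (\<lambda>v. v v* ?A + f 0)"
  proof
    fix v
    have "f v = lin f v + f 0" by (simp add: lin_def add.assoc)
    then show "f v = v v* ?A + f 0" by (simp only: lin_matrix[OF f(2), of v])
  qed
  ultimately show "f \<in> carrier AGL32" unfolding AGL_def by auto
qed

text \<open>The only nonzero determinant over the field of two elements is 1.\<close>

lemma ASL32_eq_AGL32: "ASL32 = AGL32"
  by (simp add: ASL_def AGL_def invertible_det_nz)

lemma carrier_ASL32: "carrier ASL32 = affs"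
  and mult_ASL32: "g \<otimes>\<^bsub>ASL32\<^esub> h = h \<circ> g"
  and one_ASL32: "\<one>\<^bsub>ASL32\<^esub> = id"
  unfolding affs_carrier[symmetric] ASL32_eq_AGL32 by (simp_all add: AGL_def)

lemma affsD: "f \<in> affs \<Longrightarrow> bij f" "f \<in> affs \<Longrightarrow> affine_map f"
  by (simp_all add: affs_def)

lemma affine_map_comp: "affine_map f \<Longrightarrow> affine_map g \<Longrightarrow> affine_map (f \<circ> g)"
  by (simp add: affine_map_def)

lemma affine_map_inv: "bij f \<Longrightarrow> affine_map f \<Longrightarrow> affine_map (inv' f)"
  unfolding affine_map_def by (metis bij_inv_eq_iff)

lemma affs_comp: "f \<in> affs \<Longrightarrow> g \<in> affs \<Longrightarrow> f \<circ> g \<in> affs"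
  by (simp add: affs_def affine_map_comp bij_comp)

lemma affs_inv: "f \<in> affs \<Longrightarrow> inv' f \<in> affs"
  by (simp add: affs_def affine_map_inv bij_imp_bij_inv)

lemma id_affs: "id \<in> affs"
  by (simp add: affs_def affine_map_def)

lemma group_ASL32: "group ASL32"
proof (rule groupI)
  fix x assume "x \<in> carrier ASL32"
  then show "\<exists>y\<in>carrier ASL32. y \<otimes>\<^bsub>ASL32\<^esub> x = \<one>\<^bsub>ASL32\<^esub>"
    by (intro bexI[of _ "inv' x"])
       (auto simp: carrier_ASL32 mult_ASL32 one_ASL32 affs_inv affsD bij_is_surj surj_iff[symmetric])
qed (auto simp: carrier_ASL32 mult_ASL32 one_ASL32 affs_comp id_affs o_assoc)

lemma inv_ASL32: "f \<in> affs \<Longrightarrow> inv\<^bsub>ASL32\<^esub> f = inv' f"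
  by (rule group.inv_equality[OF group_ASL32])
     (auto simp: carrier_ASL32 mult_ASL32 one_ASL32 affs_inv affsD bij_is_surj surj_iff[symmetric])

lemma transl_comp: "transl v \<circ> transl w = transl (v + w)"
  by (simp add: transl_def fun_eq_iff ac_simps)

lemma transl_0: "transl 0 = id"
  by (simp add: transl_def fun_eq_iff)

lemma transl_transl: "transl w \<circ> transl w = id"
  by (simp add: transl_comp transl_0)

lemma transl_transl_apply [simp]: "transl w (transl w v) = v"
  by (simp add: transl_def add.assoc)

lemma transl_affs: "transl w \<in> affs"
proof -
  have "bij (transl w)" by (rule o_bij[of "transl w"]) (simp_all add: transl_transl)
  then show ?thesis by (simp add: affs_def affine_map_def transl_def ac_simps)
qed

lemma inv_transl: "inv' (transl w) = transl w"
  using transl_affs by (intro inv_unique_comp) (simp_all add: transl_transl)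

lemma transl_inject: "transl v = transl w \<longleftrightarrow> v = w"
  by (metis transl_def add_0)

lemma translation_subgroup_eq: "translation_subgroup = range transl"
  by (auto simp: translation_subgroup_def transl_def fun_eq_iff)

lemma lin_transl_comp: "lin (transl w \<circ> f) = lin f"
  by (simp add: lin_def transl_def fun_eq_iff ac_simps)

lemma lin_comp: "affine_map f \<Longrightarrow> lin (f \<circ> g) = lin f \<circ> lin g"
proof
  fix v assume "affine_map f"
  then show "lin (f \<circ> g) v = (lin f \<circ> lin g) v"
    using affine_mapD[of f "g v" "g 0" 0] by (simp add: lin_def ac_simps)
qed

lemma lin_comp_transl: "affine_map f \<Longrightarrow> lin (f \<circ> transl w) = lin f"
  by (simp add: lin_comp) (simp add: lin_def transl_def fun_eq_iff add.assoc)

lemma lin_id: "lin id = id"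
  by (simp add: lin_def fun_eq_iff)

lemma transl_lin: "transl (f 0) \<circ> lin f = f"
  by (simp add: lin_def transl_def fun_eq_iff add.assoc)

lemma lin_affs: "f \<in> affs \<Longrightarrow> lin f \<in> affs"
  using affs_comp[OF transl_affs[of "f 0"], of "f"] by (simp add: comp_def lin_def[abs_def] transl_def)

lemma lin_eq_imp: "lin f = lin g \<Longrightarrow> f = transl (f 0 + g 0) \<circ> g"
proof
  fix v assume "lin f = lin g"
  then have "lin f v = lin g v" by simp
  then have "lin f v + f 0 = g v + g 0 + f 0" by (simp add: lin_def)
  then show "f v = (transl (f 0 + g 0) \<circ> g) v" by (simp add: lin_def transl_def ac_simps)
qed

lemma lin_eq_id_iff: "lin f = id \<longleftrightarrow> f \<in> range transl"
proof
  assume "lin f = id"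
  then have "transl (f 0) = f" using transl_lin[of f] by simp
  then show "f \<in> range transl" using rangeI[of transl "f 0"] by simp
next
  assume "f \<in> range transl"
  then show "lin f = id" by (auto simp: lin_def transl_def fun_eq_iff ac_simps)
qed

lemma forall_bit: "(\<forall>x::bit. P x) \<longleftrightarrow> P 0 \<and> P 1"
  by (metis bit.exhaust)

lemma forall_bit3: "(\<forall>v::bit^3. P v) \<longleftrightarrow>
   P (vector [0,0,0]) \<and> P (vector [0,0,1]) \<and> P (vector [0,1,0]) \<and> P (vector [0,1,1]) \<and>
   P (vector [1,0,0]) \<and> P (vector [1,0,1]) \<and> P (vector [1,1,0]) \<and> P (vector [1,1,1])"
  unfolding forall_vector_3 forall_bit by blast

lemma vec3_eq_iff: "u = v \<longleftrightarrow> u $ 1 = v $ 1 \<and> u $ 2 = v $ 2 \<and> u $ 3 = (v $ 3 :: 'a)" for u v :: "'a ^ 3"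
  by (simp add: vec_eq_iff forall_3)

lemma UNIV_bit3: "(UNIV :: (bit ^ 3) set) = {vector [0,0,0], vector [0,0,1], vector [0,1,0], vector [0,1,1],
   vector [1,0,0], vector [1,0,1], vector [1,1,0], vector [1,1,1]}"
proof -
  have "\<forall>v::bit^3. v \<in> {vector [0,0,0], vector [0,0,1], vector [0,1,0], vector [0,1,1],
   vector [1,0,0], vector [1,0,1], vector [1,1,0], vector [1,1,1]}"
    unfolding forall_bit3 by simp
  then show ?thesis by blast
qed

lemma finite_bit3: "finite (S :: (bit ^ 3) set)"
  by (rule finite_subset[OF subset_UNIV]) (simp add: UNIV_bit3)

lemma card_UNIV_bit3: "card (UNIV :: (bit ^ 3) set) = 8"
  unfolding UNIV_bit3 by (simp add: vec3_eq_iff)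

text \<open>For \<open>a\<close> in \<open>F\<close> and \<open>p\<close> outside, the translation
  by \<open>a + p\<close> moves \<open>F\<close> off itself, so two disjoint copies of
  \<open>F\<close> fit into eight points.\<close>

lemma affine_subspace_card_le:
  fixes F :: "(bit ^ 3) set"
  assumes F: "\<And>x y z. x \<in> F \<Longrightarrow> y \<in> F \<Longrightarrow> z \<in> F \<Longrightarrow> x + y + z \<in> F" and "F \<noteq> UNIV"
  shows "card F \<le> 4"
proof (cases "F = {}")
  case False
  then obtain a where a: "a \<in> F" by auto
  obtain p where p: "p \<notin> F" using assms(2) by auto
  have "x + a + p \<notin> F" if "x \<in> F" for x
  proof
    assume "x + a + p \<in> F"
    then have "(x + a + p) + x + a \<in> F" using F a that by blast
    then show False using p by (simp add: ac_simps)
  qed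
  then have "F \<inter> (\<lambda>x. x + a + p) ` F = {}" by auto
  then have "card (F \<union> (\<lambda>x. x + a + p) ` F) = card F + card ((\<lambda>x. x + a + p) ` F)"
    by (intro card_Un_disjoint finite_bit3)
  also have "card ((\<lambda>x. x + a + p) ` F) = card F"
    by (intro card_image inj_onI) simp
  finally show ?thesis
    using card_mono[OF finite_bit3, of "F \<union> (\<lambda>x. x + a + p) ` F" UNIV] card_UNIV_bit3 by simp
qed simp

lemma fixpoints_closed:
  "affine_map f \<Longrightarrow> x \<in> {v. f v = v} \<Longrightarrow> y \<in> {v. f v = v} \<Longrightarrow> z \<in> {v. f v = v} \<Longrightarrow> x + y + z \<in> {v. f v = v}"
  by (simp add: affine_mapD)

lemma card_fixpoints_le: "affine_map f \<Longrightarrow> f \<noteq> id \<Longrightarrow> card {v. f v = v} \<le> 4"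
  by (rule affine_subspace_card_le) (auto simp: affine_mapD fun_eq_iff)

text \<open>Take the fixed point \<open>p\<close> as origin: the other fixed points are
  \<open>p\<close> plus the fixed vectors of the linear part.\<close>

lemma card_fixpoints:
  assumes "affine_map f" "f p = p"
  shows "card {v. f v = v} = card {u. lin f u = u}"
proof -
  have "{v. f v = v} = (\<lambda>u. p + u) ` {u. lin f u = u}"
  proof (intro equalityI subsetI)
    fix v assume "v \<in> {v. f v = v}"
    then have "f (p + (p + v)) = p + (p + v)" by simp
    then have "lin f (p + v) = p + v" unfolding affine_map_add[OF assms(1)] assms(2) by (rule add_left_imp_eq)
    then show "v \<in> (\<lambda>u. p + u) ` {u. lin f u = u}" by (intro image_eqI[of _ _ "p + v"]) auto
  qed (auto simp: affine_map_add[OF assms(1)] assms(2))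
  then show ?thesis by (simp add: card_image)
qed

section \<open>GL(3,2) is generated by a cyclic coordinate shift and one transvection\<close>

section \<open>Generators of the general linear group\<close>

abbreviation e1 :: "bit ^ 3" where "e1 \<equiv> vector [1,0,0]"
abbreviation e2 :: "bit ^ 3" where "e2 \<equiv> vector [0,1,0]"
abbreviation e3 :: "bit ^ 3" where "e3 \<equiv> vector [0,0,1]"

definition shift :: "bit ^ 3 \<Rightarrow> bit ^ 3"
  where "shift v = vector [v $ 3, v $ 1, v $ 2]"

definition transv :: "3 \<Rightarrow> 3 \<Rightarrow> bit ^ 3 \<Rightarrow> bit ^ 3"
  where "transv i j v = v + v $ i *s axis j 1"

lemma axis_bit3: "axis 1 1 = e1" "axis 2 1 = e2" "axis 3 1 = e3"
  by (simp_all add: vec3_eq_iff axis_def)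

lemma bit3_add_component: "(u + v) $ i = u $ i + (v $ i :: bit)"
  by simp

lemma shift_shift_shift: "shift (shift (shift v)) = v"
  by (simp add: shift_def vec3_eq_iff)

lemma shift_add: "shift (u + v) = shift u + shift v"
  by (simp add: shift_def vec3_eq_iff)

lemma transv_add: "transv i j (u + v) = transv i j u + transv i j v"
  by (cases "u $ i"; cases "v $ i") (simp_all add: transv_def ac_simps)

lemma transv_transv: "i \<noteq> j \<Longrightarrow> transv i j (transv i j v) = v"
  by (cases "v $ i") (simp_all add: transv_def axis_def add.assoc)

lemma additive_affine_map: "(\<And>u v. f (u + v) = f u + f v) \<Longrightarrow> affine_map f"
  by (simp add: affine_map_def)

lemma shift_affs: "shift \<in> affs"
proof -
  have "bij shift" by (rule o_bij[of "shift \<circ> shift"]) (auto simp: fun_eq_iff shift_shift_shift)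
  then show ?thesis by (simp add: affs_def additive_affine_map shift_add)
qed

lemma transv_affs: "i \<noteq> j \<Longrightarrow> transv i j \<in> affs"
proof -
  assume "i \<noteq> j"
  then have "bij (transv i j)" by (intro o_bij[of "transv i j"]) (auto simp: fun_eq_iff transv_transv)
  then show ?thesis by (simp add: affs_def additive_affine_map transv_add)
qed

lemma lin_shift: "lin shift = shift"
  using shift_add[of _ 0] by (simp add: lin_def fun_eq_iff)

lemma lin_transv: "lin (transv i j) = transv i j"
  by (simp add: lin_def fun_eq_iff transv_def)

lemma lin_eqI:
  assumes "affine_map f" "affine_map g" "\<And>i. lin f (axis i 1) = lin g (axis i 1)"
  shows "lin f = lin g"
proof
  fix v show "lin f v = lin g v"
    by (simp only: lin_matrix[OF assms(1), of v] lin_matrix[OF assms(2), of v] assms(3))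
qed

text \<open>Conjugation by \<open>shift\<close> (whose inverse is its square) and one commutator
  produce all six elementary transvections. With these, basis vectors can be moved one after the
  other to any independent position while the earlier ones stay fixed, and a linear map is
  determined by its values on the basis.\<close>

lemma linear_maps_generated:
  assumes S: "\<And>f g. f \<in> S \<Longrightarrow> g \<in> S \<Longrightarrow> f \<circ> g \<in> S" and "shift \<in> S" and "transv 1 2 \<in> S"
    and A: "A \<in> affs" "A 0 = 0"
  shows "A \<in> S"
proof -
  have id: "id \<in> S"
  proof -
    have "shift \<circ> (shift \<circ> shift) \<in> S" using S assms(2) by blast
    then show ?thesis by (simp add: comp_def shift_shift_shift id_def[symmetric])
  qed
  have conj: "shift \<circ> (f \<circ> (shift \<circ> shift)) \<in> S" if "f \<in> S" for f
    using that S assms(2) by blast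
  have t23: "transv 2 3 = shift \<circ> (transv 1 2 \<circ> (shift \<circ> shift))"
    and t31: "transv 3 1 = shift \<circ> (transv 2 3 \<circ> (shift \<circ> shift))"
    and t21: "transv 2 1 = shift \<circ> (transv 1 3 \<circ> (shift \<circ> shift))"
    and t32: "transv 3 2 = shift \<circ> (transv 2 1 \<circ> (shift \<circ> shift))"
    by (simp_all add: fun_eq_iff transv_def shift_def vec3_eq_iff axis_def)
  \<comment> \<open>A commutator, since both transvections are involutions.\<close>
  have t13: "transv 1 3 = transv 1 2 \<circ> (transv 2 3 \<circ> (transv 1 2 \<circ> transv 2 3))"
    unfolding fun_eq_iff forall_bit3 by (simp add: transv_def vec3_eq_iff axis_def)
  have T23: "transv 2 3 \<in> S" unfolding t23 by (rule conj) (rule assms(3))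
  have T31: "transv 3 1 \<in> S" unfolding t31 by (rule conj) (rule T23)
  have T13: "transv 1 3 \<in> S" unfolding t13 using S T23 assms(3) by blast
  have T21: "transv 2 1 \<in> S" unfolding t21 by (rule conj) (rule T13)
  have T32: "transv 3 2 \<in> S" unfolding t32 by (rule conj) (rule T21)
  note T = assms(3) T23 T31 T13 T21 T32
  \<comment> \<open>These are the positions reachable by the next basis vector when the previous
    ones are held fixed. The claims \<open>o1\<close>, \<open>o2\<close>, \<open>o3\<close> below
    say that everything outside the span of the previous vectors is reached.\<close>
  define O1 where "O1 = {r. \<exists>g\<in>S \<inter> affs. g 0 = 0 \<and> g e1 = r}"
  define O2 where "O2 = {r. \<exists>g\<in>S \<inter> affs. g 0 = 0 \<and> g e1 = e1 \<and> g e2 = r}"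
  define O3 where "O3 = {r. \<exists>g\<in>S \<inter> affs. g 0 = 0 \<and> g e1 = e1 \<and> g e2 = e2 \<and> g e3 = r}"
  have t0: "transv i j 0 = 0" for i j by (simp add: transv_def)
  have c1: "transv i j r \<in> O1" if "transv i j \<in> S" "i \<noteq> j" "r \<in> O1" for i j r
  proof -
    from that(3) obtain g where g: "g \<in> S" "g \<in> affs" "g 0 = 0" "g e1 = r" by (auto simp: O1_def)
    have "transv i j \<circ> g \<in> S \<inter> affs"
      using S[OF that(1) g(1)] affs_comp[OF transv_affs[OF that(2)] g(2)] by blast
    then show ?thesis unfolding O1_def
      by (intro CollectI bexI[of _ "transv i j \<circ> g"]) (simp_all add: g t0)
  qed
  have c2: "transv i j r \<in> O2" if "transv i j \<in> S" "i \<noteq> j" "transv i j e1 = e1" "r \<in> O2" for i j r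
  proof -
    from that(4) obtain g where g: "g \<in> S" "g \<in> affs" "g 0 = 0" "g e1 = e1" "g e2 = r"
      by (auto simp: O2_def)
    have "transv i j \<circ> g \<in> S \<inter> affs"
      using S[OF that(1) g(1)] affs_comp[OF transv_affs[OF that(2)] g(2)] by blast
    then show ?thesis unfolding O2_def
      by (intro CollectI bexI[of _ "transv i j \<circ> g"]) (simp_all add: g t0 that(3))
  qed
  have c3: "transv i j r \<in> O3"
    if "transv i j \<in> S" "i \<noteq> j" "transv i j e1 = e1" "transv i j e2 = e2" "r \<in> O3" for i j r
  proof -
    from that(5) obtain g where g: "g \<in> S" "g \<in> affs" "g 0 = 0" "g e1 = e1" "g e2 = e2" "g e3 = r"
      by (auto simp: O3_def)
    have "transv i j \<circ> g \<in> S \<inter> affs"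
      using S[OF that(1) g(1)] affs_comp[OF transv_affs[OF that(2)] g(2)] by blast
    then show ?thesis unfolding O3_def
      by (intro CollectI bexI[of _ "transv i j \<circ> g"]) (simp_all add: g t0 that(3,4))
  qed
  have s: "transv 2 1 e1 = e1" "transv 2 3 e1 = e1" "transv 3 1 e1 = e1" "transv 3 2 e1 = e1"
    "transv 3 1 e2 = e2" "transv 3 2 e2 = e2"
    by (simp_all add: transv_def)
  have tv: "transv 1 2 r = vector [r $ 1, r $ 1 + r $ 2, r $ 3]"
    "transv 1 3 r = vector [r $ 1, r $ 2, r $ 1 + r $ 3]"
    "transv 2 1 r = vector [r $ 1 + r $ 2, r $ 2, r $ 3]"
    "transv 2 3 r = vector [r $ 1, r $ 2, r $ 2 + r $ 3]"
    "transv 3 1 r = vector [r $ 1 + r $ 3, r $ 2, r $ 3]"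
    "transv 3 2 r = vector [r $ 1, r $ 2 + r $ 3, r $ 3]" for r
    by (simp_all add: transv_def vec3_eq_iff axis_def add.commute)
  have b: "e1 \<in> O1" "e2 \<in> O2" "e3 \<in> O3"
    unfolding O1_def O2_def O3_def using id id_affs by (simp_all add: bexI[of _ id])
  have o1: "r \<in> O1" if "r \<noteq> 0" for r
  proof -
    have 110: "vector [1,1,0] \<in> O1" using c1[OF T(1) _ b(1)] by (simp add: tv)
    have 101: "vector [1,0,1] \<in> O1" using c1[OF T(4) _ b(1)] by (simp add: tv)
    have 111: "vector [1,1,1] \<in> O1" using c1[OF T(4) _ 110] by (simp add: tv)
    have 010: "vector [0,1,0] \<in> O1" using c1[OF T(5) _ 110] by (simp add: tv)
    have 001: "vector [0,0,1] \<in> O1" using c1[OF T(3) _ 101] by (simp add: tv)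
    have 011: "vector [0,1,1] \<in> O1" using c1[OF T(2) _ 010] by (simp add: tv)
    have "\<forall>r. r \<noteq> 0 \<longrightarrow> r \<in> O1"
      unfolding forall_bit3 using b(1) 110 101 111 010 001 011 by (simp add: vec3_eq_iff)
    then show ?thesis using that by blast
  qed
  have o2: "r \<in> O2" if "r \<noteq> 0" "r \<noteq> e1" for r
  proof -
    have 110: "vector [1,1,0] \<in> O2" using c2[OF T(5) _ s(1) b(2)] by (simp add: tv)
    have 011: "vector [0,1,1] \<in> O2" using c2[OF T(2) _ s(2) b(2)] by (simp add: tv)
    have 001: "vector [0,0,1] \<in> O2" using c2[OF T(6) _ s(4) 011] by (simp add: tv)
    have 101: "vector [1,0,1] \<in> O2" using c2[OF T(3) _ s(3) 001] by (simp add: tv)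
    have 111: "vector [1,1,1] \<in> O2" using c2[OF T(2) _ s(2) 110] by (simp add: tv)
    have "\<forall>r. r \<noteq> 0 \<longrightarrow> r \<noteq> e1 \<longrightarrow> r \<in> O2"
      unfolding forall_bit3 using b(2) 110 101 111 001 011 by (simp add: vec3_eq_iff)
    then show ?thesis using that by blast
  qed
  have o3: "r \<in> O3" if "r \<noteq> 0" "r \<noteq> e1" "r \<noteq> e2" "r \<noteq> e1 + e2" for r
  proof -
    have 101: "vector [1,0,1] \<in> O3" using c3[OF T(3) _ s(3,5) b(3)] by (simp add: tv)
    have 011: "vector [0,1,1] \<in> O3" using c3[OF T(6) _ s(4,6) b(3)] by (simp add: tv)
    have 111: "vector [1,1,1] \<in> O3" using c3[OF T(6) _ s(4,6) 101] by (simp add: tv)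
    have "\<forall>r. r \<noteq> 0 \<longrightarrow> r \<noteq> e1 \<longrightarrow> r \<noteq> e2 \<longrightarrow> r \<noteq> e1 + e2 \<longrightarrow> r \<in> O3"
      unfolding forall_bit3 using b(3) 101 111 011 by (simp add: vec3_eq_iff)
    then show ?thesis using that by blast
  qed
  have add: "f (u + v) = f u + f v" if "f \<in> affs" "f 0 = 0" for f u v
    using affine_mapD[OF affsD(2)[OF that(1)], of u v 0] that(2) by simp
  have inj: "f u = f v \<longleftrightarrow> u = v" if "f \<in> affs" for f u v
    using bij_is_inj[OF affsD(1)[OF that]] by (auto simp: inj_def)
  have quot: "inv' g \<circ> f \<in> affs" "(inv' g \<circ> f) 0 = 0" "g \<circ> (inv' g \<circ> f) = f"
    if "f \<in> affs" "f 0 = 0" "g \<in> affs" "g 0 = 0" for f g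
  proof -
    have "g (inv' g v) = v" for v using affsD(1)[OF that(3)] by (simp add: bij_is_surj surj_f_inv_f)
    then show "g \<circ> (inv' g \<circ> f) = f" by (simp add: fun_eq_iff)
    show "(inv' g \<circ> f) 0 = 0" 
      using that(2,4) inv_f_f[OF bij_is_inj[OF affsD(1)[OF that(3)]], of 0] by simp
    show "inv' g \<circ> f \<in> affs" using that by (simp add: affs_comp affs_inv)
  qed
  have iv: "inv' g (g v) = v" if "g \<in> affs" for g v
    using affsD(1)[OF that] by (simp add: bij_is_inj)
  have e: "e1 \<noteq> 0" "e2 \<noteq> 0" "e3 \<noteq> 0" "e2 \<noteq> e1" "e3 \<noteq> e1" "e3 \<noteq> e2" "e3 \<noteq> e1 + e2"
    by (simp_all add: vec3_eq_iff)
  \<comment> \<open>Factor \<open>A\<close> by successive division: \<open>A1\<close> fixes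
    \<open>e1\<close>, \<open>A2\<close> also fixes \<open>e2\<close>, and \<open>g3\<close> agrees
    with \<open>A2\<close> on the whole basis.\<close>
  have "A e1 \<in> O1" using o1 inj[OF A(1), of e1 0] A(2) e by auto
  then obtain g1 where g1: "g1 \<in> S" "g1 \<in> affs" "g1 0 = 0" "g1 e1 = A e1" by (auto simp: O1_def)
  define A1 where "A1 = inv' g1 \<circ> A"
  have A1: "A1 \<in> affs" "A1 0 = 0" "g1 \<circ> A1 = A" using quot[OF A g1(2,3)] by (auto simp: A1_def)
  have A1e: "A1 e1 = e1" using iv[OF g1(2), of e1] by (simp add: A1_def g1(4))
  have "A1 e2 \<in> O2" using o2 inj[OF A1(1), of e2 0] inj[OF A1(1), of e2 e1] A1(2) A1e e by auto
  then obtain g2 where g2: "g2 \<in> S" "g2 \<in> affs" "g2 0 = 0" "g2 e1 = e1" "g2 e2 = A1 e2"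
    by (auto simp: O2_def)
  define A2 where "A2 = inv' g2 \<circ> A1"
  have A2: "A2 \<in> affs" "A2 0 = 0" "g2 \<circ> A2 = A1" using quot[OF A1(1,2) g2(2,3)] by (auto simp: A2_def)
  have A2e: "A2 e1 = e1" "A2 e2 = e2"
    using iv[OF g2(2), of e1] iv[OF g2(2), of e2] A1e by (simp_all add: A2_def g2(4,5))
  have "A2 e3 \<in> O3"
    using o3 inj[OF A2(1), of e3 0] inj[OF A2(1), of e3 e1] inj[OF A2(1), of e3 e2]
      inj[OF A2(1), of e3 "e1 + e2"] A2(2) A2e e add[OF A2(1,2), of e1 e2] by auto
  then obtain g3 where g3: "g3 \<in> S" "g3 \<in> affs" "g3 0 = 0" "g3 e1 = e1" "g3 e2 = e2" "g3 e3 = A2 e3"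
    by (auto simp: O3_def)
  have "lin A2 = lin g3"
  proof (rule lin_eqI[OF affsD(2)[OF A2(1)] affsD(2)[OF g3(2)]])
    fix i :: 3
    consider "i = 1" | "i = 2" | "i = 3" using exhaust_3[of i] by blast
    then show "lin A2 (axis i 1) = lin g3 (axis i 1)"
      by cases (simp_all add: lin_def A2(2) g3(3) axis_bit3 A2e g3(4-6))
  qed
  then have "A2 = g3" by (simp add: lin_def[abs_def] A2(2) g3(3))
  then have "A = g1 \<circ> (g2 \<circ> g3)" using A1(3) A2(3) by simp
  then show ?thesis using S g1(1) g2(1) g3(1) by simp
qed

section \<open>Complements as lifts of GL(3,2), and two inequivalent examples\<close>

section \<open>The two classes of complements\<close>

text \<open>A complement described through linear parts: \<open>lin\<close> restricted to it is
  one-to-one and onto GL(3,2). The identity and inverses are supplied by \<open>compl_id\<close> and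
  \<open>compl_inv\<close>.\<close>

definition compl :: "(bit ^ 3 \<Rightarrow> bit ^ 3) set \<Rightarrow> bool"
  where "compl H \<longleftrightarrow> H \<subseteq> affs \<and> (\<forall>f\<in>H. \<forall>g\<in>H. f \<circ> g \<in> H) \<and>
    (\<forall>f\<in>H. lin f = id \<longrightarrow> f = id) \<and> (\<forall>f\<in>affs. \<exists>h\<in>H. lin h = lin f)"

lemma
  assumes "compl H"
  shows compl_affs: "f \<in> H \<Longrightarrow> f \<in> affs"
    and compl_comp: "f \<in> H \<Longrightarrow> g \<in> H \<Longrightarrow> f \<circ> g \<in> H"
    and compl_eq_id: "f \<in> H \<Longrightarrow> lin f = id \<Longrightarrow> f = id"
    and compl_ex: "f \<in> affs \<Longrightarrow> \<exists>h\<in>H. lin h = lin f"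
  using assms unfolding compl_def by blast+

lemma lin_inv_comp: "f \<in> affs \<Longrightarrow> lin (inv' f) \<circ> lin f = id"
  using lin_comp[of "inv' f" f] affsD[of "inv' f"] affs_inv[of f] affsD[of f]
  by (simp add: lin_id bij_is_inj)

lemma compl_id:
  assumes "compl H" shows "id \<in> H"
proof -
  obtain h where h: "h \<in> H" "lin h = lin id" using compl_ex[OF assms id_affs] by blast
  then have "h = id" using compl_eq_id[OF assms h(1)] by (simp add: lin_id)
  then show ?thesis using h(1) by simp
qed

lemma compl_inv:
  assumes H: "compl H" and f: "f \<in> H" shows "inv' f \<in> H"
proof -
  note fa = compl_affs[OF H f]
  obtain k where k: "k \<in> H" "lin k = lin (inv' f)" using compl_ex[OF H affs_inv[OF fa]] by blast
  have "lin (k \<circ> f) = id"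
    using lin_comp[OF affsD(2)[OF compl_affs[OF H k(1)]], of f] lin_inv_comp[OF fa] k(2) by simp
  then have "k \<circ> f = id" by (rule compl_eq_id[OF H compl_comp[OF H k(1) f]])
  then have "k \<circ> f \<circ> inv' f = inv' f" by simp
  moreover have "f \<circ> inv' f = id" using affsD(1)[OF fa] by (simp add: bij_is_surj surj_iff[symmetric])
  ultimately have "k = inv' f" by (simp add: comp_assoc)
  then show ?thesis using k(1) by simp
qed

lemma compl_lin_inject:
  assumes H: "compl H" and f: "f \<in> H" and g: "g \<in> H" and "lin f = lin g"
  shows "f = g"
proof -
  note fa = compl_affs[OF H f]
  have "lin (inv' f \<circ> g) = id"
    using lin_comp[OF affsD(2)[OF affs_inv[OF fa]], of g] lin_inv_comp[OF fa] assms(4) by simp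
  then have "inv' f \<circ> g = id" by (rule compl_eq_id[OF H compl_comp[OF H compl_inv[OF H f] g]])
  then have "f \<circ> (inv' f \<circ> g) = f" by simp
  moreover have "f \<circ> inv' f = id" using affsD(1)[OF fa] by (simp add: bij_is_surj surj_iff[symmetric])
  ultimately show ?thesis by (simp add: o_assoc)
qed

text \<open>Both sets contain exactly one element over each linear map, so an inclusion is an
  equality.\<close>

lemma compl_eqI:
  assumes "compl H" "compl K" "H \<subseteq> K" shows "H = K"
proof
  show "K \<subseteq> H"
  proof
    fix k assume k: "k \<in> K"
    obtain h where h: "h \<in> H" "lin h = lin k" using compl_ex[OF assms(1) compl_affs[OF assms(2) k]] by blast
    then have "h = k" using compl_lin_inject[OF assms(2) _ k] assms(3) by blast
    then show "k \<in> H" using h(1) by simp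
  qed
qed (rule assms(3))

text \<open>The translations are the maps with identical linear part. Trivial intersection thus
  makes \<open>lin\<close> injective on the subgroup, and the full product means that every linear
  part occurs.\<close>

lemma complements_eq: "complements ASL32 translation_subgroup = {H. compl H}"
proof (intro equalityI subsetI)
  fix H assume "H \<in> complements ASL32 translation_subgroup"
  then have sg: "subgroup H ASL32" and int: "H \<inter> range transl = {id}"
    and pr: "H <#>\<^bsub>ASL32\<^esub> range transl = affs"
    by (auto simp: complements_def translation_subgroup_eq one_ASL32 carrier_ASL32)
  have sub: "H \<subseteq> affs" using subgroup.subset[OF sg] by (simp add: carrier_ASL32)
  have "\<exists>h\<in>H. lin h = lin f" if "f \<in> affs" for f
  proof -
    have "f \<in> H <#>\<^bsub>ASL32\<^esub> range transl" using that pr by simp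
    then obtain h w where "h \<in> H" "f = transl w \<circ> h" by (auto simp: set_mult_def mult_ASL32)
    then show ?thesis by (auto simp: lin_transl_comp)
  qed
  moreover have "f \<circ> g \<in> H" if "f \<in> H" "g \<in> H" for f g
    using subgroup.m_closed[OF sg that(2,1)] by (simp add: mult_ASL32)
  moreover have "f = id" if "f \<in> H" "lin f = id" for f
    using that int unfolding lin_eq_id_iff by blast
  ultimately show "H \<in> {H. compl H}" using sub by (simp add: compl_def)
next
  fix H assume "H \<in> {H. compl H}"
  then have H: "compl H" by simp
  have "subgroup H ASL32"
    by (rule group.subgroupI[OF group_ASL32])
       (use H compl_id in \<open>auto simp: carrier_ASL32 mult_ASL32 inv_ASL32 compl_affs compl_comp compl_inv\<close>)
  moreover have "H \<inter> range transl = {id}"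
    using compl_id[OF H] compl_eq_id[OF H] lin_eq_id_iff lin_id by blast
  moreover have "H <#>\<^bsub>ASL32\<^esub> range transl = affs"
  proof (intro equalityI subsetI)
    fix f assume "f \<in> H <#>\<^bsub>ASL32\<^esub> range transl"
    then obtain h w where "h \<in> H" "f = transl w \<circ> h" by (auto simp: set_mult_def mult_ASL32)
    then show "f \<in> affs" using affs_comp[OF transl_affs compl_affs[OF H]] by simp
  next
    fix f assume "f \<in> affs"
    then obtain h where h: "h \<in> H" "lin h = lin f" using compl_ex[OF H] by blast
    then have "f = transl (f 0 + h 0) \<circ> h" by (intro lin_eq_imp) simp
    then show "f \<in> H <#>\<^bsub>ASL32\<^esub> range transl"
      using h(1) by (auto simp: set_mult_def mult_ASL32)
  qed
  ultimately show "H \<in> complements ASL32 translation_subgroup"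
    by (simp add: complements_def translation_subgroup_eq one_ASL32 carrier_ASL32)
qed

definition GL3 :: "(bit ^ 3 \<Rightarrow> bit ^ 3) set"
  where "GL3 = {f \<in> affs. f 0 = 0}"

lemma compl_GL3: "compl GL3"
proof -
  have "f = id" if "f 0 = 0" "lin f = id" for f
    using that transl_lin[of f] by (simp add: transl_0)
  moreover have "\<exists>h\<in>GL3. lin h = lin f" if "f \<in> affs" for f
    using that lin_affs[OF that] lin_transl_comp[of "f 0" "lin f"]
    by (intro bexI[of _ "lin f"]) (simp_all add: GL3_def transl_lin)
  ultimately show ?thesis by (auto simp: compl_def GL3_def affs_comp)
qed

text \<open>Inversion \<open>x \<mapsto> x\<^sup>6\<close> of the field with eight elements, written in a normal basis. It is
  quadratic, its polarization is the cross product, and it maps no affine plane to a plane.\<close>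

definition quad :: "bit ^ 3 \<Rightarrow> bit ^ 3"
  where "quad v = vector [v $ 1 + v $ 3 + v $ 2 * v $ 3, v $ 2 + v $ 1 + v $ 3 * v $ 1, v $ 3 + v $ 2 + v $ 1 * v $ 2]"

definition bcross :: "bit ^ 3 \<Rightarrow> bit ^ 3 \<Rightarrow> bit ^ 3"
  where "bcross u v = vector [u $ 2 * v $ 3 + u $ 3 * v $ 2, u $ 3 * v $ 1 + u $ 1 * v $ 3, u $ 1 * v $ 2 + u $ 2 * v $ 1]"

lemma quad_quad [simp]: "quad (quad v) = v"
proof -
  have "\<forall>v. quad (quad v) = v" unfolding forall_bit3 by (simp add: quad_def vec3_eq_iff)
  then show ?thesis by blast
qed

lemma quad_add: "quad (u + v) = quad u + quad v + bcross u v"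
proof -
  have "\<forall>u v. quad (u + v) = quad u + quad v + bcross u v"
    unfolding forall_bit3 by (simp add: quad_def bcross_def vec3_eq_iff)
  then show ?thesis by blast
qed

lemma bcross_eq_0_iff: "bcross u v = 0 \<longleftrightarrow> u = 0 \<or> v = 0 \<or> u = v"
proof -
  have "\<forall>u v. bcross u v = 0 \<longleftrightarrow> u = 0 \<or> v = 0 \<or> u = v"
    unfolding forall_bit3 by (simp add: bcross_def vec3_eq_iff)
  then show ?thesis by blast
qed

lemma bcross_add: "bcross (u + v) w = bcross u w + bcross v w"
proof -
  have "a * (b + c) = a * b + a * c" "(b + c) * a = b * a + c * a" for a b c :: bit
    by (rule distrib_left, rule distrib_right)
  then show ?thesis
    by (simp add: bcross_def vec3_eq_iff ac_simps del: add_bit_eq_xor mult_bit_eq_and)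
qed

text \<open>The affine group intersected with its conjugate by the involution \<open>quad\<close>.
  This is the second complement: PSL(2,7), isomorphic to GL(3,2), acting on eight points without a
  common fixed point.\<close>

definition K2 :: "(bit ^ 3 \<Rightarrow> bit ^ 3) set"
  where "K2 = {f \<in> affs. affine_map (quad \<circ> f \<circ> quad)}"

text \<open>The element of \<open>K2\<close> over \<open>transv 1 2\<close>; the translation by
  \<open>e3\<close> is what keeps it affine after conjugation by \<open>quad\<close>.\<close>

abbreviation transv' :: "bit ^ 3 \<Rightarrow> bit ^ 3"
  where "transv' \<equiv> transl e3 \<circ> transv 1 2"

lemma K2_comp:
  assumes "f \<in> K2" "g \<in> K2" shows "f \<circ> g \<in> K2"
proof -
  have "quad \<circ> (f \<circ> g) \<circ> quad = (quad \<circ> f \<circ> quad) \<circ> (quad \<circ> g \<circ> quad)" by (simp add: fun_eq_iff)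
  then show ?thesis using assms by (simp add: K2_def affs_comp affine_map_comp)
qed

lemma shift_K2: "shift \<in> K2"
proof -
  have "quad \<circ> shift \<circ> quad = shift"
    unfolding fun_eq_iff forall_bit3 by (simp add: quad_def shift_def vec3_eq_iff)
  then show ?thesis using shift_affs by (simp add: K2_def affsD)
qed

lemma transv'_K2: "transv' \<in> K2"
proof -
  have "quad \<circ> transv' \<circ> quad = transl (vector [1,0,1]) \<circ> transv 2 1"
    unfolding fun_eq_iff forall_bit3 by (simp add: quad_def transl_def transv_def vec3_eq_iff axis_def)
  then show ?thesis using affs_comp[OF transl_affs transv_affs] by (simp add: K2_def affsD)
qed

text \<open>Conjugated by \<open>quad\<close>, the translation by \<open>w\<close> becomes
  \<open>x + quad w + bcross (quad x) w\<close>. If this is affine in \<open>x\<close>, then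
  \<open>w\<close> has zero cross product with every cross product, in particular with
  \<open>e1\<close> and with \<open>e2\<close>, and only 0 is left.\<close>

lemma K2_transl:
  assumes "transl w \<in> K2" shows "w = 0"
proof -
  have a: "affine_map (quad \<circ> transl w \<circ> quad)" using assms by (simp add: K2_def)
  have q: "(quad \<circ> transl w \<circ> quad) x = x + quad w + bcross (quad x) w" for x
    by (simp add: transl_def quad_add)
  have q0: "quad 0 = 0" by (simp add: quad_def vec3_eq_iff)
  have "bcross (bcross y z) w = 0" for y z
  proof -
    have "y + z + quad w + bcross (quad (y + z)) w =
        (y + quad w + bcross (quad y) w) + (z + quad w + bcross (quad z) w) + (0 + quad w + bcross (quad 0) w)"
      using affine_mapD[OF a, of y z 0] unfolding q by simp
    then show ?thesis by (simp add: quad_add bcross_add q0 ac_simps bcross_eq_0_iff)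
  qed
  from this[of e2 e3] this[of e3 e1] show ?thesis
    by (simp add: bcross_eq_0_iff bcross_def vec3_eq_iff)
qed

text \<open>The linear parts of \<open>K2\<close> are closed under composition and include both
  generators, so all of GL(3,2) occurs; injectivity is \<open>K2_transl\<close>.\<close>

lemma compl_K2: "compl K2"
proof -
  have sub: "K2 \<subseteq> affs" by (auto simp: K2_def)
  have "\<exists>h\<in>K2. lin h = lin f" if f: "f \<in> affs" for f
  proof -
    let ?S = "lin ` K2"
    have "f \<circ> g \<in> ?S" if fg: "f \<in> ?S" "g \<in> ?S" for f g
    proof -
      obtain h k where hk: "h \<in> K2" "k \<in> K2" "f = lin h" "g = lin k" using fg by blast
      then have "f \<circ> g = lin (h \<circ> k)" using lin_comp[of h k] sub by (auto simp: affsD)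
      then show ?thesis using K2_comp[OF hk(1,2)] by blast
    qed
    moreover have "shift \<in> ?S" using shift_K2 lin_shift by (metis imageI)
    moreover have "transv 1 2 \<in> ?S"
      using imageI[OF transv'_K2, of lin] by (simp add: lin_transl_comp lin_transv)
    ultimately have "lin f \<in> ?S"
      by (rule linear_maps_generated) (simp_all add: lin_affs f)
    then show ?thesis by auto
  qed
  moreover have "f = id" if "f \<in> K2" "lin f = id" for f
    using that K2_transl transl_0 unfolding lin_eq_id_iff by blast
  ultimately show ?thesis using sub K2_comp by (auto simp: compl_def)
qed

section \<open>Fixed cosets of affine maps, classification of the complements, and the affine
  code\<close>

section \<open>Fixed points on the cosets of a complement\<close>

lemma ASL32_conjugate_iff:
  assumes "H \<subseteq> affs"
  shows "conjugate ASL32 H K \<longleftrightarrow> (\<exists>g\<in>affs. K = (\<lambda>h. g \<circ> h \<circ> inv' g) ` H)"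
proof -
  have "(\<lambda>h. inv\<^bsub>ASL32\<^esub> g \<otimes>\<^bsub>ASL32\<^esub> h \<otimes>\<^bsub>ASL32\<^esub> g) ` H = (\<lambda>h. g \<circ> h \<circ> inv' g) ` H" if "g \<in> affs" for g
    using that by (simp add: inv_ASL32 mult_ASL32 comp_assoc)
  then show ?thesis
    using conjugate_iff[OF group_ASL32, of H K] assms by (simp add: carrier_ASL32)
qed

abbreviation tconj :: "bit ^ 3 \<Rightarrow> (bit ^ 3 \<Rightarrow> bit ^ 3) \<Rightarrow> bit ^ 3 \<Rightarrow> bit ^ 3"
  where "tconj d f \<equiv> transl d \<circ> f \<circ> transl d"

lemma tconj_tconj: "tconj d (tconj c f) = tconj (d + c) f"
  by (simp add: fun_eq_iff transl_def ac_simps)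

lemma tconj_tconj_same [simp]: "tconj d (tconj d f) = f"
  by (simp add: fun_eq_iff)

lemma tconj_affs: "f \<in> affs \<Longrightarrow> tconj d f \<in> affs"
  by (simp add: affs_comp transl_affs)

lemma lin_tconj: "f \<in> affs \<Longrightarrow> lin (tconj d f) = lin f"
  by (simp add: lin_comp_transl lin_transl_comp affsD affs_comp transl_affs comp_assoc)

lemma compl_conjugate: "compl H \<Longrightarrow> conjugate ASL32 H (tconj d ` H)"
  unfolding compl_def by (subst ASL32_conjugate_iff) (auto simp: inv_transl intro!: bexI[OF _ transl_affs])

lemma compl_tconj:
  assumes "compl H" shows "compl (tconj d ` H)"
proof -
  have "tconj d f \<circ> tconj d g = tconj d (f \<circ> g)" for f g by (simp add: fun_eq_iff)
  moreover have "tconj d id = id" by (simp add: fun_eq_iff)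
  ultimately show ?thesis
    using assms by (auto simp: compl_def tconj_affs lin_tconj subset_iff)
qed

text \<open>Every coset of a complement contains exactly one translation. The vector
  \<open>w\<close> is counted when \<open>t\<close> fixes the coset of \<open>transl w\<close>, as
  \<open>fixed_coset_rep_compl\<close> makes precise.\<close>

definition cfix :: "(bit ^ 3 \<Rightarrow> bit ^ 3) set \<Rightarrow> (bit ^ 3 \<Rightarrow> bit ^ 3) \<Rightarrow> nat"
  where "cfix H t = card {w. tconj w t \<in> H}"

lemma cfix_tconj: "cfix (tconj d ` H) t = cfix H t"
proof -
  have "{w. tconj w t \<in> tconj d ` H} = (\<lambda>w. d + w) ` {w. tconj w t \<in> H}"
  proof (intro equalityI subsetI)
    fix w assume "w \<in> {w. tconj w t \<in> tconj d ` H}"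
    then obtain h where "h \<in> H" "tconj w t = tconj d h" by auto
    then have "tconj (d + w) t \<in> H" by (metis tconj_tconj tconj_tconj_same)
    then show "w \<in> (\<lambda>w. d + w) ` {w. tconj w t \<in> H}" by (intro image_eqI[of _ _ "d + w"]) auto
  next
    fix w assume "w \<in> (\<lambda>w. d + w) ` {w. tconj w t \<in> H}"
    then obtain v where "w = d + v" "tconj v t \<in> H" by auto
    then show "w \<in> {w. tconj w t \<in> tconj d ` H}"
      by (intro CollectI image_eqI[of _ _ "tconj v t"]) (simp_all only: tconj_tconj)
  qed
  then show ?thesis by (simp add: cfix_def card_image)
qed

text \<open>Translation conjugates of \<open>t\<close> share their linear part, so \<open>H\<close>
  contains at most one map among them; the conjugates by \<open>v\<close> and \<open>w\<close>
  coincide exactly when \<open>w + v\<close> is fixed by the linear part.\<close>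

lemma cfix_eq:
  assumes H: "compl H" and t: "t \<in> affs" and w: "tconj w t \<in> H"
  shows "cfix H t = card {u. lin t u = u}"
proof -
  have "tconj v t \<in> H \<longleftrightarrow> t v + v = t w + w" for v
  proof
    assume "tconj v t \<in> H"
    then have "tconj v t = tconj w t"
      using compl_lin_inject[OF H _ w] lin_tconj[OF t] by metis
    then have "tconj v t 0 = tconj w t 0" by simp
    then show "t v + v = t w + w" by (simp add: transl_def)
  next
    assume "t v + v = t w + w"
    then have "tconj v t 0 = tconj w t 0" by (simp add: transl_def)
    moreover have "lin (tconj v t) = lin (tconj w t)" by (simp only: lin_tconj[OF t])
    ultimately have "tconj v t = tconj w t" using lin_eq_imp[of "tconj v t" "tconj w t"]
      by (simp add: transl_0)
    then show "tconj v t \<in> H" using w by simp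
  qed
  moreover have "t v + v = t w + w \<longleftrightarrow> lin t (w + v) = w + v" for v
    using affine_map_add[OF affsD(2)[OF t], of w "w + v"] bit_vec_add_eq_iff[of "lin t (w + v)" v w]
    by (simp add: add.assoc)
  ultimately have S: "tconj v t \<in> H \<longleftrightarrow> lin t (w + v) = w + v" for v by simp
  have "{v. tconj v t \<in> H} = (\<lambda>u. w + u) ` {u. lin t u = u}"
  proof (intro equalityI subsetI)
    fix v assume "v \<in> {v. tconj v t \<in> H}"
    then show "v \<in> (\<lambda>u. w + u) ` {u. lin t u = u}"
      using S[of v] by (intro image_eqI[of _ _ "w + v"]) simp_all
  qed (auto simp: S)
  then show ?thesis by (simp add: cfix_def card_image)
qed

text \<open>A nonzero count is the size of the fixed space of a nonidentity linear map, that is, of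
  a proper subspace.\<close>

lemma cfix_le:
  assumes H: "compl H" and t: "t \<in> affs" and "t \<noteq> id"
  shows "cfix H t \<le> 4"
proof (cases "\<exists>w. tconj w t \<in> H")
  case True
  then obtain w where w: "tconj w t \<in> H" by blast
  have "lin t \<noteq> id"
  proof
    assume "lin t = id"
    then have "tconj w t = id" using compl_eq_id[OF H w] lin_tconj[OF t] by simp
    then have "tconj w (tconj w t) = tconj w id" by (simp only:)
    then show False using assms(3) by (simp add: transl_transl)
  qed
  then show ?thesis
    unfolding cfix_eq[OF H t w] by (intro card_fixpoints_le) (simp_all add: affsD lin_affs t)
qed (simp add: cfix_def)

lemma bcross_commute: "bcross u v = bcross v u"
  by (simp add: bcross_def vec3_eq_iff ac_simps del: add_bit_eq_xor mult_bit_eq_and)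

lemma bcross_add_right: "bcross w (u + v) = bcross w u + bcross w v"
  using bcross_add[of u v w] by (simp add: bcross_commute)

text \<open>Suppose \<open>f\<close> fixes three points \<open>a\<close>, \<open>b\<close>,
  \<open>c\<close>, and so also their sum. Its conjugate by \<open>quad\<close> is affine and fixes
  the \<open>quad\<close>-images of these four points as well as the sum of the images of
  \<open>a\<close>, \<open>b\<close>, \<open>c\<close>. Since \<open>quad\<close> maps no plane to a
  plane, these are five points, too many for a nonidentity affine map.\<close>

lemma K2_card_fixpoints_le:
  assumes f: "f \<in> K2" "f \<noteq> id" shows "card {v. f v = v} \<le> 2"
proof (rule ccontr)
  let ?g = "quad \<circ> f \<circ> quad"
  assume "\<not> card {v. f v = v} \<le> 2"
  then have "3 \<le> card {v. f v = v}" by simp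
  then obtain S where S: "S \<subseteq> {v. f v = v}" "card S = 3"
    by (rule obtain_subset_with_card_n)
  obtain a b c where abc: "S = {a, b, c}" and ne: "a \<noteq> b" "b \<noteq> c" "a \<noteq> c"
    using S(2) unfolding card_3_iff by blast
  have fx: "f a = a" "f b = b" "f c = c" using S(1) unfolding abc by simp_all
  have aff: "affine_map f" "affine_map ?g" using f(1) by (auto simp: K2_def affsD)
  have fd: "f (a + b + c) = a + b + c" using affine_mapD[OF aff(1)] fx by simp
  have g: "?g (quad v) = quad v" if "f v = v" for v using that by simp
  let ?s = "quad a + quad b + quad c"
  have gs: "?g ?s = ?s" using affine_mapD[OF aff(2), of "quad a" "quad b" "quad c"] g fx by simp
  have inj: "quad u = quad v \<longleftrightarrow> u = v" for u v by (metis quad_quad)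
  have "quad (a + b + c) \<noteq> ?s"
  proof
    assume "quad (a + b + c) = ?s"
    moreover have "quad (a + b + c) = ?s + (bcross a b + (bcross a c + bcross b c))"
      by (simp add: quad_add bcross_add bcross_add_right ac_simps)
    ultimately have "bcross a b + (bcross a c + bcross b c) = 0" by simp
    \<comment> \<open>The polarization terms collapse to a cross product of two distinct nonzero
      vectors, which does not vanish.\<close>
    moreover have "bcross (b + c) (a + c) = bcross a b + (bcross a c + bcross b c)"
      using bcross_add[of b c "a + c"] bcross_add[of a c b] bcross_add[of a c c]
        bcross_commute[of b "a + c"] bcross_commute[of c "a + c"] bcross_commute[of b c]
        bcross_eq_0_iff[of c c]
      by (simp add: ac_simps)
    ultimately have "b + c = 0 \<or> a + c = 0 \<or> b + c = a + c" using bcross_eq_0_iff[of "b + c" "a + c"] by simp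
    then show False using ne by (simp add: bit_vec_add_eq_0_iff)
  qed
  moreover have "?s \<noteq> quad a" "?s \<noteq> quad b" "?s \<noteq> quad c"
    using ne inj bit_vec_add_eq_0_iff[of "quad b" "quad c"] bit_vec_add_eq_0_iff[of "quad a" "quad c"]
      bit_vec_add_eq_0_iff[of "quad a" "quad b"] by (auto simp: add.assoc add.left_commute)
  moreover have "a + b + c \<noteq> a" "a + b + c \<noteq> b" "a + b + c \<noteq> c"
    using ne bit_vec_add_eq_0_iff[of b c] bit_vec_add_eq_0_iff[of a c]
      bit_vec_add_eq_0_iff[of a b] by (auto simp: add.assoc add.left_commute)
  ultimately have "card {?s, quad (a + b + c), quad a, quad b, quad c} = 5"
    using ne inj by auto
  moreover have "{?s, quad (a + b + c), quad a, quad b, quad c} \<subseteq> {v. ?g v = v}"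
    using gs g fx fd by simp
  ultimately have "5 \<le> card {v. ?g v = v}"
    using card_mono[OF finite_bit3, of "{?s, quad (a + b + c), quad a, quad b, quad c}" "{v. ?g v = v}"] by simp
  then have "\<not> card {v. ?g v = v} \<le> 4" by linarith
  then have g_id: "?g = id" using card_fixpoints_le[OF aff(2)] by blast
  have "f v = v" for v
  proof -
    have "quad (?g (quad v)) = v" unfolding g_id by simp
    then show ?thesis by simp
  qed
  then show False using f(2) by (simp add: fun_eq_iff)
qed

text \<open>If both counts are positive, \<open>t\<close> has a fixed point, hence so has its
  conjugate in \<open>K2\<close>; the fixed space of the linear part then has at most two vectors,
  and its size is the value of both counts. Otherwise one count is zero and the other is at most
  four.\<close>

lemma cfix_GL3_K2:
  assumes t: "t \<in> affs" "t \<noteq> id"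
  shows "cfix GL3 t + cfix K2 t \<le> 4"
proof (cases "cfix GL3 t = 0 \<or> cfix K2 t = 0")
  case True
  then show ?thesis using cfix_le[OF compl_GL3 t] cfix_le[OF compl_K2 t] by auto
next
  case False
  then obtain v w where v: "tconj v t \<in> GL3" and w: "tconj w t \<in> K2"
    unfolding cfix_def by (auto simp: card_eq_0_iff)
  have tv: "t v = v" using v bit_vec_add_eq_0_iff[of "t v" v] by (simp add: GL3_def transl_def)
  have "tconj w t \<noteq> id"
  proof
    assume "tconj w t = id"
    then have "tconj w (tconj w t) = tconj w id" by (simp only:)
    then show False using t(2) by (simp add: transl_transl)
  qed
  then have "card {u. tconj w t u = u} \<le> 2" using K2_card_fixpoints_le w by blast
  moreover have "tconj w t (v + w) = v + w" using tv by (simp add: transl_def add.assoc)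
  then have "card {u. tconj w t u = u} = card {u. lin (tconj w t) u = u}"
    by (rule card_fixpoints[OF affsD(2)[OF tconj_affs[OF t(1)]]])
  ultimately show ?thesis
    using cfix_eq[OF compl_GL3 t(1) v] cfix_eq[OF compl_K2 t(1) w] lin_tconj[OF t(1)] by simp
qed

lemma card_fix_transv: "card {u. transv 1 2 u = u} = 4"
proof -
  have "{u. transv 1 2 u = u} = {vector [0,0,0], vector [0,0,1], vector [0,1,0], vector [0,1,1]}"
    unfolding set_eq_iff forall_bit3 by (simp add: transv_def vec3_eq_iff axis_def)
  then show ?thesis by (simp add: vec3_eq_iff)
qed

lemma transv12_affs: "transv 1 2 \<in> affs"
  by (rule transv_affs) simp

lemma transv'_affs: "transv' \<in> affs"
  by (rule affs_comp[OF transl_affs transv12_affs])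

lemma cfix_GL3_transv: "cfix GL3 (transv 1 2) = 4"
proof -
  have "tconj 0 (transv 1 2) \<in> GL3" using transv12_affs by (simp add: transl_0 GL3_def transv_def)
  from cfix_eq[OF compl_GL3 transv12_affs this] show ?thesis by (simp add: lin_transv card_fix_transv)
qed

lemma cfix_K2_transv': "cfix K2 transv' = 4"
proof -
  have "tconj 0 transv' \<in> K2" using transv'_K2 by (simp add: transl_0)
  from cfix_eq[OF compl_K2 transv'_affs this] show ?thesis
    by (simp add: lin_transl_comp lin_transv card_fix_transv)
qed

text \<open>Instance of \<open>fixed_coset_rep\<close>: the label \<open>f g\<close> is the vector
  of the unique translation in the coset of \<open>g\<close>.\<close>

lemma fixed_coset_rep_compl:
  assumes H: "compl H" and l: "labelling ASL32 H 8 l" and t: "t \<in> affs"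
  shows "fixed 8 (coset_rep ASL32 8 l t) = cfix H t"
proof -
  have ex: "\<exists>w. transl w \<circ> g \<in> H" if "g \<in> affs" for g
  proof -
    obtain h where h: "h \<in> H" "lin h = lin g" using compl_ex[OF H \<open>g \<in> affs\<close>] by blast
    then have eq: "h = transl (h 0 + g 0) \<circ> g" by (intro lin_eq_imp)
    have "transl (h 0 + g 0) \<circ> g \<in> H" by (subst eq[symmetric]) (rule h(1))
    then show ?thesis by blast
  qed
  have uniq: "v = w" if "transl v \<circ> g \<in> H" "transl w \<circ> g \<in> H" for v w g
  proof -
    have "transl v \<circ> g = transl w \<circ> g" by (rule compl_lin_inject[OF H that]) (simp add: lin_transl_comp)
    then have "(transl v \<circ> g) 0 = (transl w \<circ> g) 0" by (simp only:)
    then show ?thesis by (simp add: transl_def)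
  qed
  define f where "f g = (SOME w. transl w \<circ> g \<in> H)" for g
  have f: "transl (f g) \<circ> g \<in> H" if "g \<in> affs" for g
    unfolding f_def by (rule someI_ex) (rule ex[OF that])
  have feq: "f g = w \<longleftrightarrow> transl w \<circ> g \<in> H" if "g \<in> affs" for g w
    using f[OF that] uniq by blast
  have sg: "subgroup H ASL32" using H complements_eq by (auto simp: complements_def)
  have "fixed 8 (coset_rep ASL32 8 l t) = card {y \<in> f ` carrier ASL32. f (t \<circ> transl y) = y}"
  proof (rule fixed_coset_rep[OF group_ASL32 sg l])
    show "t \<in> carrier ASL32" using t by (simp add: carrier_ASL32)
  next
    fix g g' assume "g \<in> carrier ASL32" "g' \<in> carrier ASL32"
    then have g: "g \<in> affs" "g' \<in> affs" by (simp_all add: carrier_ASL32)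
    have c: "inv' g \<circ> g' = inv' (transl (f g) \<circ> g) \<circ> (transl (f g) \<circ> g')"
    proof -
      have "inv' (transl (f g) \<circ> g) = inv' g \<circ> transl (f g)"
        using affsD(1)[OF g(1)] affsD(1)[OF transl_affs] by (simp add: o_inv_distrib inv_transl)
      then show ?thesis by (simp add: fun_eq_iff)
    qed
    have c': "transl (f g) \<circ> g' = (transl (f g) \<circ> g) \<circ> (inv' g \<circ> g')"
      using affsD(1)[OF g(1)] by (simp add: fun_eq_iff bij_is_surj surj_f_inv_f)
    have "f g = f g' \<longleftrightarrow> transl (f g) \<circ> g' \<in> H" using feq[OF g(2)] by metis
    also have "\<dots> \<longleftrightarrow> inv' g \<circ> g' \<in> H"
      using c c' compl_comp[OF H] compl_inv[OF H] f[OF g(1)] by metis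
    finally show "f g = f g' \<longleftrightarrow> g' \<otimes>\<^bsub>ASL32\<^esub> inv\<^bsub>ASL32\<^esub> g \<in> H"
      using g by (simp add: mult_ASL32 inv_ASL32)
  next
    fix g assume "g \<in> carrier ASL32"
    then have g: "g \<in> affs" by (simp add: carrier_ASL32)
    have tg: "t \<circ> transl (f g) \<in> affs" "t \<circ> g \<in> affs" using t g by (simp_all add: affs_comp transl_affs)
    have "transl (f (t \<circ> transl (f g))) \<circ> (t \<circ> g) =
        (transl (f (t \<circ> transl (f g))) \<circ> (t \<circ> transl (f g))) \<circ> (transl (f g) \<circ> g)" by (simp add: fun_eq_iff)
    then have "transl (f (t \<circ> transl (f g))) \<circ> (t \<circ> g) \<in> H"
      using compl_comp[OF H f[OF tg(1)] f[OF g]] by simp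
    then show "f (g \<otimes>\<^bsub>ASL32\<^esub> t) = f (t \<circ> transl (f g))" using feq[OF tg(2)] by (simp add: mult_ASL32)
  qed
  also have "{y \<in> f ` carrier ASL32. f (t \<circ> transl y) = y} = {w. tconj w t \<in> H}"
  proof -
    have "w \<in> f ` affs" for w
    proof (rule image_eqI[OF _ transl_affs])
      have "transl w \<circ> transl w \<in> H" using compl_id[OF H] by (simp add: transl_transl)
      then show "w = f (transl w)" using feq[OF transl_affs] by metis
    qed
    moreover have "f (t \<circ> transl w) = w \<longleftrightarrow> tconj w t \<in> H" for w
      using feq[of "t \<circ> transl w" w] t by (simp add: affs_comp transl_affs comp_assoc)
    ultimately show ?thesis by (auto simp: carrier_ASL32)
  qed
  finally show ?thesis by (simp add: cfix_def)
qed

lemma shift_0: "shift 0 = 0"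
  by (simp add: shift_def vec3_eq_iff)

text \<open>A complement is known once its elements over the generators \<open>shift\<close> and
  \<open>transv 1 2\<close> are known. Their translation parts are restricted by the orders three
  and two of the generators, and conjugation by translations normalizes them to two
  possibilities.\<close>

lemma compl_cases:
  assumes H: "compl H"
  obtains d where "tconj d ` H = GL3" | d where "tconj d ` H = K2"
proof -
  obtain h where h: "h \<in> H" "lin h = shift" using compl_ex[OF H shift_affs] by (auto simp: lin_shift)
  define a where "a = h 0"
  have h_eq: "h v = shift v + a" for v
    using fun_cong[OF h(2), of v] by (auto simp: lin_def a_def bit_vec_add_eq_iff)
  have "h \<circ> (h \<circ> h) = id"
  proof (rule compl_eq_id[OF H])
    show "h \<circ> (h \<circ> h) \<in> H" using compl_comp[OF H] h(1) by blast
    have "lin (h \<circ> (h \<circ> h)) = shift \<circ> (shift \<circ> shift)"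
      using lin_comp[OF affsD(2)[OF compl_affs[OF H h(1)]]] by (simp only: h(2))
    then show "lin (h \<circ> (h \<circ> h)) = id" by (simp add: fun_eq_iff shift_shift_shift)
  qed
  then have "h (h (h 0)) = 0" by (simp add: fun_eq_iff)
  \<comment> \<open>Order three puts \<open>a\<close> into the kernel of 1 + \<open>shift\<close> +
    \<open>shift\<close>^2, which is the image of 1 + \<open>shift\<close>. Conjugation by the
    resulting \<open>transl d\<close> replaces \<open>h\<close> by \<open>shift\<close>
    itself.\<close>
  then have a: "shift (shift a) + shift a + a = 0" by (simp add: h_eq shift_add shift_0)
  have "\<forall>a. shift (shift a) + shift a + a = 0 \<longrightarrow>
      shift 0 + 0 = a \<or> shift e1 + e1 = a \<or> shift e2 + e2 = a \<or> shift e3 + e3 = a"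
    unfolding forall_bit3 by (simp add: shift_def vec3_eq_iff)
  then obtain d where d: "shift d + d = a" using a by blast
  define K where "K = tconj d ` H"
  have K: "compl K" unfolding K_def by (rule compl_tconj[OF H])
  have "tconj d h = shift"
    by (simp add: fun_eq_iff transl_def h_eq shift_add d[symmetric] ac_simps)
  then have sK: "shift \<in> K" unfolding K_def using h(1) by (metis imageI)
  obtain k where k: "k \<in> K" "lin k = transv 1 2"
    using compl_ex[OF K transv12_affs] by (auto simp: lin_transv)
  define b where "b = k 0"
  have k_eq: "k v = transv 1 2 v + b" for v
    using fun_cong[OF k(2), of v] by (auto simp: lin_def b_def bit_vec_add_eq_iff)
  have "k \<circ> k = id"
  proof (rule compl_eq_id[OF K])
    show "k \<circ> k \<in> K" using compl_comp[OF K] k(1) by blast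
    have "lin (k \<circ> k) = transv 1 2 \<circ> transv 1 2"
      using lin_comp[OF affsD(2)[OF compl_affs[OF K k(1)]]] by (simp only: k(2))
    then show "lin (k \<circ> k) = id" by (simp add: fun_eq_iff transv_transv)
  qed
  then have "k (k 0) = 0" by (simp add: fun_eq_iff)
  then have "transv 1 2 b + b = 0" by (simp add: k_eq transv_def[of _ _ 0])
  \<comment> \<open>Further conjugation must keep \<open>shift\<close>, so only the two fixed
    vectors of \<open>shift\<close> are available. Order two puts \<open>b\<close> into the span of
    \<open>e2\<close> and \<open>e3\<close>, and the all-one vector changes \<open>b\<close> by
    \<open>e2\<close>, so \<open>b\<close> can be brought to 0 or \<open>e3\<close>.\<close>
  moreover have "\<forall>b. transv 1 2 b + b = 0 \<longrightarrow>
      (b + transv 1 2 0 + 0 = 0 \<or> b + transv 1 2 0 + 0 = e3) \<or>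
      (b + transv 1 2 (vector [1,1,1]) + vector [1,1,1] = 0 \<or>
       b + transv 1 2 (vector [1,1,1]) + vector [1,1,1] = e3)"
    unfolding forall_bit3 by (simp add: transv_def vec3_eq_iff axis_def)
  ultimately obtain c where c: "c = 0 \<or> c = vector [1,1,1]"
    and bc: "b + transv 1 2 c + c = 0 \<or> b + transv 1 2 c + c = e3" by blast
  define L where "L = tconj c ` K"
  have L: "compl L" unfolding L_def by (rule compl_tconj[OF K])
  have LH: "L = tconj (c + d) ` H"
    unfolding L_def K_def image_image by (intro image_cong refl tconj_tconj)
  have "shift c = c" using c by (auto simp: shift_def vec3_eq_iff)
  then have "tconj c shift = shift"
    by (simp add: fun_eq_iff transl_def shift_add ac_simps)
  then have sL: "shift \<in> L" unfolding L_def using sK by (metis imageI)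
  have "tconj c k = transl (b + transv 1 2 c + c) \<circ> transv 1 2"
    by (simp add: fun_eq_iff transl_def k_eq transv_add ac_simps)
  moreover have "tconj c k \<in> L" unfolding L_def using k(1) by blast
  ultimately have tL: "transv 1 2 \<in> L \<or> transv' \<in> L" using bc by (auto simp: transl_0)
  show ?thesis
  proof (cases "transv 1 2 \<in> L")
    case True
    have "GL3 \<subseteq> L"
    proof
      fix f assume "f \<in> GL3"
      then have "f \<in> affs" "f 0 = 0" by (auto simp: GL3_def)
      then show "f \<in> L" using linear_maps_generated[of L f] compl_comp[OF L] sL True by blast
    qed
    then have "GL3 = L" by (rule compl_eqI[OF compl_GL3 L])
    then show ?thesis using that(1) LH by blast
  next
    case False
    then have t: "transv' \<in> L" using tL by blast
    \<comment> \<open>The intersection already contains elements over both generators, so over every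
      linear map; uniqueness in \<open>L\<close> then forces \<open>L\<close> into
      \<open>K2\<close>.\<close>
    let ?S = "lin ` (L \<inter> K2)"
    have cl: "f \<circ> g \<in> ?S" if fg: "f \<in> ?S" "g \<in> ?S" for f g
    proof -
      obtain h k where hk: "h \<in> L \<inter> K2" "k \<in> L \<inter> K2" "f = lin h" "g = lin k" using fg by blast
      then have "f \<circ> g = lin (h \<circ> k)" using lin_comp[of h k] by (auto simp: affsD K2_def)
      moreover have "h \<circ> k \<in> L \<inter> K2" using hk K2_comp compl_comp[OF L] by blast
      ultimately show ?thesis by blast
    qed
    have s1: "shift \<in> ?S" using imageI[of shift "L \<inter> K2" lin] shift_K2 sL by (simp add: lin_shift)
    have s2: "transv 1 2 \<in> ?S"
      using imageI[of transv' "L \<inter> K2" lin] t transv'_K2 by (simp add: lin_transl_comp lin_transv)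
    have "L \<subseteq> K2"
    proof
      fix f assume f: "f \<in> L"
      have "lin f \<in> ?S"
        by (rule linear_maps_generated[OF cl s1 s2]) (simp_all add: lin_affs compl_affs[OF L f])
      then obtain g where g: "g \<in> L" "g \<in> K2" "lin f = lin g" by blast
      then have "f = g" by (intro compl_lin_inject[OF L f])
      then show "f \<in> K2" using g(2) by simp
    qed
    then have "L = K2" by (rule compl_eqI[OF L compl_K2])
    then show ?thesis using that(2) LH by blast
  qed
qed

text \<open>Every conjugate of \<open>GL3\<close> fixes a point, whereas \<open>shift\<close> and
  \<open>transv'\<close> have no fixed point in common.\<close>

lemma GL3_K2_not_conjugate: "\<not> conjugate ASL32 GL3 K2"
proof
  assume "conjugate ASL32 GL3 K2"
  then obtain g where g: "g \<in> affs" "K2 = (\<lambda>h. g \<circ> h \<circ> inv' g) ` GL3"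
    using ASL32_conjugate_iff[of GL3 K2] by (auto simp: GL3_def)
  have "f (g 0) = g 0" if "f \<in> K2" for f
    using that affsD(1)[OF g(1)] unfolding g(2) by (auto simp: GL3_def bij_is_inj)
  then have fx: "shift (g 0) = g 0" "transv' (g 0) = g 0" using shift_K2 transv'_K2 by blast+
  have "\<forall>p. shift p = p \<longrightarrow> transv' p \<noteq> p"
    unfolding forall_bit3 by (simp add: transv_def shift_def transl_def vec3_eq_iff axis_def)
  then show False using fx by blast
qed

lemma compl_subset: "compl H \<Longrightarrow> H \<subseteq> carrier ASL32"
  by (simp add: compl_def carrier_ASL32)

lemma compl_conjugate_GL3_or_K2:
  assumes "compl H"
  shows "(conjugate ASL32 GL3 H \<and> (\<forall>t. cfix H t = cfix GL3 t)) \<or>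
    (conjugate ASL32 K2 H \<and> (\<forall>t. cfix H t = cfix K2 t))"
proof (rule compl_cases[OF assms])
  fix d assume d: "tconj d ` H = GL3"
  then have "conjugate ASL32 GL3 H"
    using conjugate_sym[OF group_ASL32 compl_subset[OF assms] compl_conjugate[OF assms, of d]] by simp
  then show ?thesis using cfix_tconj[of d H] d by simp
next
  fix d assume d: "tconj d ` H = K2"
  then have "conjugate ASL32 K2 H"
    using conjugate_sym[OF group_ASL32 compl_subset[OF assms] compl_conjugate[OF assms, of d]] by simp
  then show ?thesis using cfix_tconj[of d H] d by simp
qed

lemma class_reps_GL3_K2: "class_reps ASL32 (complements ASL32 translation_subgroup) [GL3, K2]"
proof -
  have "\<exists>!i. i < length [GL3, K2] \<and> conjugate ASL32 ([GL3, K2] ! i) K" if K: "compl K" for K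
  proof -
    have "\<not> (conjugate ASL32 GL3 K \<and> conjugate ASL32 K2 K)"
      using GL3_K2_not_conjugate conjugate_trans[OF group_ASL32 compl_subset[OF compl_GL3]]
        conjugate_sym[OF group_ASL32 compl_subset[OF compl_K2]] by blast
    then show ?thesis using compl_conjugate_GL3_or_K2[OF K] by (auto simp: less_Suc_eq)
  qed
  then show ?thesis by (simp add: class_reps_def complements_eq compl_GL3 compl_K2)
qed

text \<open>If both representatives belonged to one of the two classes, the other class would be
  represented by neither. As \<open>cfix\<close> is constant on the classes, the codes can be
  computed with \<open>GL3\<close> and \<open>K2\<close>.\<close>

lemma class_reps_complements_cfix:
  assumes r: "class_reps ASL32 (complements ASL32 translation_subgroup) [H, K]"
  shows "compl H" "compl K" "(\<forall>t. cfix H t = cfix GL3 t \<and> cfix K t = cfix K2 t) \<or>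
    (\<forall>t. cfix H t = cfix K2 t \<and> cfix K t = cfix GL3 t)"
proof -
  show H: "compl H" and K: "compl K" using r by (auto simp: class_reps_def complements_eq)
  have ex: "conjugate ASL32 H L \<or> conjugate ASL32 K L" if "compl L" for L
    using r that by (auto simp: class_reps_def complements_eq less_Suc_eq)
  have "\<not> (conjugate ASL32 M H \<and> conjugate ASL32 M K)" if M: "compl M" "{M, N} = {GL3, K2}" for M N
  proof
    assume *: "conjugate ASL32 M H \<and> conjugate ASL32 M K"
    have N: "compl N" using M(2) compl_GL3 compl_K2 by (auto simp: doubleton_eq_iff)
    have "conjugate ASL32 M N"
      using ex[OF N] * conjugate_trans[OF group_ASL32 compl_subset[OF M(1)]] by blast
    then show False
      using M(2) GL3_K2_not_conjugate conjugate_sym[OF group_ASL32 compl_subset[OF M(1)]]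
      by (auto simp: doubleton_eq_iff)
  qed
  note n = this
  have "\<not> (conjugate ASL32 GL3 H \<and> conjugate ASL32 GL3 K)"
    by (rule n[OF compl_GL3, of K2]) simp
  moreover have "\<not> (conjugate ASL32 K2 H \<and> conjugate ASL32 K2 K)"
    by (rule n[OF compl_K2, of GL3]) (rule insert_commute)
  ultimately show "(\<forall>t. cfix H t = cfix GL3 t \<and> cfix K t = cfix K2 t) \<or>
    (\<forall>t. cfix H t = cfix K2 t \<and> cfix K t = cfix GL3 t)"
    using compl_conjugate_GL3_or_K2[OF H] compl_conjugate_GL3_or_K2[OF K] by blast
qed

text \<open>A single action leaves at most four of eight points fixed, which gives 2 times 4 for the
  repetition codes. In the twisted code at most four of sixteen points stay fixed, and the linear
  transvection, with counts four and zero, attains this.\<close>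

lemma ASL32_codes:
  assumes r: "class_reps ASL32 (complements ASL32 translation_subgroup) [H, K]"
    and l: "labelling ASL32 H 8 l" and m: "labelling ASL32 K 8 m"
  shows "delta_rep ASL32 8 [coset_rep ASL32 8 l, coset_rep ASL32 8 m] = 8"
    and "delta_tw ASL32 8 [coset_rep ASL32 8 l, coset_rep ASL32 8 m] = 12"
proof -
  note c = class_reps_complements_cfix[OF r]
  let ?l = "coset_rep ASL32 8 l" and ?m = "coset_rep ASL32 8 m"
  have sg: "subgroup L ASL32" if "compl L" for L
    using that complements_eq by (auto simp: complements_def)
  have hom: "?l \<in> hom ASL32 (Sym 8)" "?m \<in> hom ASL32 (Sym 8)"
    using coset_rep_hom[OF group_ASL32 sg[OF c(1)] l] coset_rep_hom[OF group_ASL32 sg[OF c(2)] m] .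
  have mv: "moved 8 (?l t) = 8 - cfix H t" "moved 8 (?m t) = 8 - cfix K t" if "t \<in> affs" for t
    using fixed_coset_rep_compl[OF c(1) l that] fixed_coset_rep_compl[OF c(2) m that]
    by (simp_all add: moved_eq)
  have rep: "delta_tw ASL32 8 (replicate 2 \<rho>) = 8"
    if \<rho>: "\<rho> \<in> hom ASL32 (Sym 8)" "\<And>t. t \<in> affs \<Longrightarrow> moved 8 (\<rho> t) = 8 - cfix L t"
      and L: "compl L" "cfix L = cfix GL3 \<or> cfix L = cfix K2" for \<rho> L
  proof -
    obtain t where t: "t \<in> affs" "cfix L t = 4"
      using L(2) cfix_GL3_transv cfix_K2_transv' transv12_affs transv'_affs by auto
    have s: "set (replicate 2 \<rho>) \<subseteq> hom ASL32 (Sym 8)" using \<rho>(1) by auto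
    show ?thesis
    proof (rule delta_tw_eqI[OF group_ASL32 s])
      show "t \<in> carrier ASL32" using t by (simp add: carrier_ASL32)
      show "weight 8 (replicate 2 \<rho>) t = 8" using t \<rho>(2) by (simp add: weight_replicate)
      fix u assume "u \<in> carrier ASL32"
      then have u: "u \<in> affs" by (simp add: carrier_ASL32)
      show "weight 8 (replicate 2 \<rho>) u = 0 \<or> 8 \<le> weight 8 (replicate 2 \<rho>) u"
      proof (cases "u = id")
        case True
        then show ?thesis using weight_one[OF group_ASL32 s] by (simp add: one_ASL32)
      next
        case False
        then show ?thesis using cfix_le[OF L(1) u] \<rho>(2)[OF u] by (simp add: weight_replicate)
      qed
    qed simp
  qed
  have ext: "cfix H = cfix GL3 \<and> cfix K = cfix K2 \<or> cfix H = cfix K2 \<and> cfix K = cfix GL3"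
    using c(3) by (auto simp: fun_eq_iff)
  then have "delta_tw ASL32 8 (replicate 2 ?l) = 8" "delta_tw ASL32 8 (replicate 2 ?m) = 8"
    using rep[OF hom(1) mv(1) c(1)] rep[OF hom(2) mv(2) c(2)] by blast+
  then show "delta_rep ASL32 8 [?l, ?m] = 8" by (simp add: delta_rep_eq numeral_2_eq_2)
  have s: "set [?l, ?m] \<subseteq> hom ASL32 (Sym 8)" using hom by simp
  have w: "weight 8 [?l, ?m] t = (8 - cfix GL3 t) + (8 - cfix K2 t)" if "t \<in> affs" for t
    using mv[OF that] ext by (auto simp: weight_def)
  show "delta_tw ASL32 8 [?l, ?m] = 12"
  proof (rule delta_tw_eqI[OF group_ASL32 s])
    show "transv 1 2 \<in> carrier ASL32" using transv12_affs by (simp add: carrier_ASL32)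
    have "transv 1 2 \<noteq> id" using card_fix_transv card_UNIV_bit3 by auto
    then show "weight 8 [?l, ?m] (transv 1 2) = 12"
      using w[OF transv12_affs] cfix_GL3_K2[OF transv12_affs] cfix_GL3_transv by simp
    fix u assume "u \<in> carrier ASL32"
    then have u: "u \<in> affs" by (simp add: carrier_ASL32)
    show "weight 8 [?l, ?m] u = 0 \<or> 12 \<le> weight 8 [?l, ?m] u"
    proof (cases "u = id")
      case True
      then show ?thesis using weight_one[OF group_ASL32 s] by (simp add: one_ASL32)
    next
      case False
      then show ?thesis using cfix_GL3_K2[OF u False] w[OF u] by simp
    qed
  qed simp
qed

section \<open>Cycle shapes on six points, and pairs of three-cycles with involutory product\<close>

section \<open>Permutations of six points\<close>

abbreviation tr :: "nat \<Rightarrow> nat \<Rightarrow> nat \<Rightarrow> nat"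
  where "tr \<equiv> Transposition.transpose"

definition cyc :: "nat \<Rightarrow> nat \<Rightarrow> nat \<Rightarrow> nat \<Rightarrow> nat"
  where "cyc a b c i = (if i = a then b else if i = b then c else if i = c then a else i)"

lemma permutes_inv_apply: "p permutes S \<Longrightarrow> p (inv' p x) = x" "p permutes S \<Longrightarrow> inv' p (p x) = x"
  by (simp_all add: permutes_inverses)

lemma permutes_inject: "p permutes S \<Longrightarrow> p x = p y \<longleftrightarrow> x = y"
  by (simp add: permutes_inj inj_eq)

lemma fixed_id: "fixed q id = q"
proof -
  have "{i \<in> {1..q}. id i = i} = {1..q}" by auto
  then show ?thesis unfolding fixed_def by simp
qed

lemma moved_in: "p permutes S \<Longrightarrow> p x \<noteq> x \<Longrightarrow> x \<in> S"
  by (auto simp: permutes_def)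

lemma permutes_extend:
  assumes p: "p permutes (S :: nat set)" and "a \<in> S" "b \<in> S" "a \<notin> F" "b \<notin> p ` F"
  obtains p' where "p' permutes S" "p' a = b" "\<And>x. x \<in> F \<Longrightarrow> p' x = p x"
proof
  show "tr (p a) b \<circ> p permutes S"
    using assms by (intro permutes_compose permutes_swap_id) (simp_all add: permutes_in_image)
  show "(tr (p a) b \<circ> p) x = p x" if "x \<in> F" for x
    using that assms permutes_inject[OF p] by (auto simp: Transposition.transpose_def)
qed simp

lemma evenperm_transpose: "evenperm (tr a b) \<longleftrightarrow> a = b"
  by (rule evenperm_swap)

text \<open>A6 is triply transitive: a permutation with the wanted values can be made even by
  precomposing with the swap of 4 and 5, which leaves the images of 1, 2, 3 alone.\<close>

lemma even_perm_ex:
  assumes "distinct [a, b, c]" "{a, b, c} \<subseteq> {1..6::nat}"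
  obtains h where "h permutes {1..6}" "evenperm h" "h 1 = a" "h 2 = b" "h 3 = c"
proof -
  obtain h1 where h1: "h1 permutes {1..6}" "h1 1 = a"
    by (rule permutes_extend[OF permutes_id, of 1 "{1..6}" a "{}"]) (use assms in auto)
  obtain h2 where h2: "h2 permutes {1..6}" "h2 2 = b" "\<And>x. x \<in> {1} \<Longrightarrow> h2 x = h1 x"
    by (rule permutes_extend[OF h1(1), of 2 b "{1}"]) (use assms h1 in auto)
  obtain h where h: "h permutes {1..6}" "h 3 = c" "\<And>x. x \<in> {1, 2} \<Longrightarrow> h x = h2 x"
    by (rule permutes_extend[OF h2(1), of 3 c "{1, 2}"]) (use assms h1 h2 in auto)
  have v: "h 1 = a" "h 2 = b" using h h1 h2 by simp_all
  show ?thesis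
  proof (cases "evenperm h")
    case True
    then show ?thesis using that h v by blast
  next
    case False
    have t: "tr 4 5 permutes {1..6::nat}" by (rule permutes_swap_id) auto
    show ?thesis
    proof (rule that[of "h \<circ> tr 4 5"])
      show "h \<circ> tr 4 5 permutes {1..6}" by (rule permutes_compose[OF t h(1)])
      show "evenperm (h \<circ> tr 4 5)"
        using evenperm_compose_permutes[OF h(1) t] False by (simp add: evenperm_transpose)
    qed (use h(2) v in \<open>simp_all add: Transposition.transpose_def\<close>)
  qed
qed

lemma cyc_eq: "distinct [a, b, c] \<Longrightarrow> cyc a b c = tr a b \<circ> tr b c"
  by (auto simp: fun_eq_iff cyc_def Transposition.transpose_def)

lemma cyc_permutes:
  assumes "distinct [a, b, c]" "{a, b, c} \<subseteq> S"
  shows "cyc a b c permutes S"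
  unfolding cyc_eq[OF assms(1)] using assms(2) by (intro permutes_compose permutes_swap_id) auto

lemma evenperm_cyc:
  assumes "distinct [a, b, c]" shows "evenperm (cyc a b c)"
  unfolding cyc_eq[OF assms] using assms
  by (subst evenperm_comp) (simp_all add: permutation_swap_id evenperm_transpose)

lemma cyc_rotate: "distinct [a, b, c] \<Longrightarrow> cyc a b c = cyc b c a"
  by (auto simp: fun_eq_iff cyc_def)

lemma cyc_cyc_cyc: "distinct [a, b, c] \<Longrightarrow> cyc a b c (cyc a b c (cyc a b c i)) = i"
  by (auto simp: cyc_def)

lemma cyc_conj:
  assumes "h permutes S" shows "h \<circ> cyc a b c \<circ> inv' h = cyc (h a) (h b) (h c)"
proof
  fix i
  show "(h \<circ> cyc a b c \<circ> inv' h) i = cyc (h a) (h b) (h c) i"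
    using permutes_inv_eq[OF assms] permutes_inv_apply(1)[OF assms] by (auto simp: cyc_def)
qed

lemma fixed_conj:
  assumes "h permutes {1..q}"
  shows "fixed q (h \<circ> p \<circ> inv' h) = fixed q p"
proof -
  have "{i \<in> {1..q}. (h \<circ> p \<circ> inv' h) i = i} = h ` {i \<in> {1..q}. p i = i}"
  proof (intro equalityI subsetI)
    fix i assume i: "i \<in> {i \<in> {1..q}. (h \<circ> p \<circ> inv' h) i = i}"
    then have "h (p (inv' h i)) = h (inv' h i)" by (simp add: permutes_inv_apply(1)[OF assms])
    then have "p (inv' h i) = inv' h i" by (simp only: permutes_inject[OF assms])
    moreover have "inv' h i \<in> {1..q}" using i permutes_in_image[OF permutes_inv[OF assms], of i] by simp
    ultimately show "i \<in> h ` {i \<in> {1..q}. p i = i}"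
      by (intro image_eqI[of _ _ "inv' h i"]) (simp_all add: permutes_inv_apply(1)[OF assms])
  qed (use permutes_in_image[OF assms] permutes_inv_apply(2)[OF assms] in auto)
  then show ?thesis
    by (simp add: fixed_def card_image inj_on_subset[OF permutes_inj[OF assms] subset_UNIV])
qed

lemma fixed_inv_conj:
  assumes "h permutes {1..q}"
  shows "fixed q (inv' h \<circ> p \<circ> h) = fixed q p"
  using fixed_conj[OF permutes_inv[OF assms], of p] by (simp add: permutes_inv_inv[OF assms])

lemma permutes_moved: "p permutes S \<Longrightarrow> p x \<noteq> x \<Longrightarrow> p (p x) \<noteq> p x"
  by (simp add: permutes_inject)

lemma fixed_cyc:
  assumes "distinct [a, b, c]" "{a, b, c} \<subseteq> {1..6}"
  shows "fixed 6 (cyc a b c) = 3"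
proof -
  have "{i \<in> {1..6}. cyc a b c i \<noteq> i} = {a, b, c}" using assms by (auto simp: cyc_def)
  then have "moved 6 (cyc a b c) = 3" using assms unfolding moved_def by simp
  then show ?thesis using fixed_add_moved[of 6 "cyc a b c"] by simp
qed

lemma fixed_3_cyc:
  assumes p: "p permutes {1..6}" and "fixed 6 p = 3"
  obtains a b c where "distinct [a, b, c]" "{a, b, c} \<subseteq> {1..6}" "p = cyc a b c"
proof -
  have "card {i \<in> {1..6}. p i \<noteq> i} = 3"
    using fixed_add_moved[of 6 p] assms(2) by (simp add: moved_def)
  then obtain x y z where M: "{i \<in> {1..6}. p i \<noteq> i} = {x, y, z}" and d: "x \<noteq> y" "y \<noteq> z" "x \<noteq> z"
    unfolding card_3_iff by blast
  have mv: "p i \<noteq> i \<longleftrightarrow> i \<in> {x, y, z}" for i using M moved_in[OF p, of i] by blast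
  have "p i \<in> {x, y, z}" if "i \<in> {x, y, z}" for i
    using that mv[of i] mv[of "p i"] permutes_moved[OF p, of i] by blast
  then have im: "p x \<in> {x, y, z}" "p y \<in> {x, y, z}" "p z \<in> {x, y, z}" by blast+
  have ne: "p x \<noteq> x" "p y \<noteq> y" "p z \<noteq> z" "p x \<noteq> p y" "p y \<noteq> p z" "p x \<noteq> p z"
    using mv d by (simp_all add: permutes_inject[OF p])
  have S: "{x, y, z} \<subseteq> {1..6}" using M by blast
  have fx: "p i = i" if "i \<notin> {x, y, z}" for i using mv that by blast
  consider "p x = y" "p y = z" "p z = x" | "p x = z" "p z = y" "p y = x" using im ne by auto
  then show ?thesis
  proof cases
    case 1
    then have "p = cyc x y z" using fx by (auto simp: fun_eq_iff cyc_def)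
    then show ?thesis using that[of x y z] d S by simp
  next
    case 2
    then have "p = cyc x z y" using fx by (auto simp: fun_eq_iff cyc_def)
    then show ?thesis using that[of x z y] d S by auto
  qed
qed

lemma fixed_le_4:
  assumes p: "p permutes {1..6}" and "p \<noteq> id"
  shows "fixed 6 p \<le> 4"
proof -
  obtain a where a: "p a \<noteq> a" using assms(2) by (auto simp: fun_eq_iff)
  have "{a, p a} \<subseteq> {i \<in> {1..6}. p i \<noteq> i}"
    using a permutes_moved[OF p a] moved_in[OF p] by auto
  then have "card {a, p a} \<le> moved 6 p" unfolding moved_def by (intro card_mono) auto
  then show ?thesis using a fixed_add_moved[of 6 p] by simp
qed

lemma fixed_4_transpose:
  assumes p: "p permutes {1..6}" and "fixed 6 p = 4"
  obtains a b where "a \<noteq> b" "a \<in> {1..6}" "b \<in> {1..6}" "p = tr a b"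
proof -
  have "card {i \<in> {1..6}. p i \<noteq> i} = 2"
    using fixed_add_moved[of 6 p] assms(2) by (simp add: moved_def)
  then obtain x y where M: "{i \<in> {1..6}. p i \<noteq> i} = {x, y}" and d: "x \<noteq> y"
    unfolding card_2_iff by blast
  have mv: "p i \<noteq> i \<longleftrightarrow> i \<in> {x, y}" for i using M moved_in[OF p, of i] by blast
  have im: "p i \<in> {x, y}" if "i \<in> {x, y}" for i
    using that mv[of i] mv[of "p i"] permutes_moved[OF p, of i] by blast
  have "p x = y" "p y = x" using im[of x] im[of y] mv[of x] mv[of y] by auto
  then have "p = tr x y" using mv by (auto simp: fun_eq_iff Transposition.transpose_def)
  then show ?thesis using that[of x y] d M by blast
qed

text \<open>Nontrivial orbits have three points, so either three or all six points are
  moved.\<close>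

lemma fixed_order_3:
  assumes p: "p permutes {1..6}" and "p \<noteq> id" and p3: "\<And>i. p (p (p i)) = i"
  shows "fixed 6 p = 3 \<or> fixed 6 p = 0"
proof -
  let ?M = "{i \<in> {1..6}. p i \<noteq> i}"
  obtain a where a: "p a \<noteq> a" using assms(2) by (auto simp: fun_eq_iff)
  have orb: "{a, p a, p (p a)} \<subseteq> ?M \<and> card {a, p a, p (p a)} = 3" if "p a \<noteq> a" for a
  proof -
    have "p (p a) \<noteq> p a" "p (p a) \<noteq> a"
      using that p3[of a] permutes_inject[OF p, of "p a" a] by auto
    then show ?thesis using that p3[of a] moved_in[OF p] by auto
  qed
  show ?thesis
  proof (cases "?M = {a, p a, p (p a)}")
    case True
    then have "moved 6 p = 3" using orb[OF a] by (simp add: moved_def)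
    then show ?thesis using fixed_add_moved[of 6 p] by simp
  next
    case False
    then obtain b where b: "p b \<noteq> b" "b \<notin> {a, p a, p (p a)}" using orb[OF a] by blast
    have "{a, p a, p (p a)} \<inter> {b, p b, p (p b)} = {}"
      using b(2) p3 by (auto simp: permutes_inject[OF p])
    then have "card ({a, p a, p (p a)} \<union> {b, p b, p (p b)}) = 6"
      using orb[OF a] orb[OF b(1)] by (subst card_Un_disjoint) auto
    moreover have "{a, p a, p (p a)} \<union> {b, p b, p (p b)} \<subseteq> ?M" using orb[OF a] orb[OF b(1)] by blast
    then have "card ({a, p a, p (p a)} \<union> {b, p b, p (p b)}) \<le> card ?M" by (intro card_mono) auto
    ultimately have "6 \<le> moved 6 p" by (simp add: moved_def)
    then show ?thesis using fixed_add_moved[of 6 p] by simp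
  qed
qed

text \<open>Cancels one two-cycle of \<open>p\<close>, which flips the parity; repeated use counts
  the two-cycles.\<close>

lemma involution_transpose:
  assumes p: "p permutes {1..6}" and "p \<noteq> id" and pp: "p \<circ> p = id"
  obtains r where "r permutes {1..6}" "r \<circ> r = id" "fixed 6 r = fixed 6 p + 2"
    "evenperm r \<longleftrightarrow> \<not> evenperm p"
proof -
  have p2: "p (p i) = i" for i using fun_cong[OF pp, of i] by simp
  obtain a where a: "p a \<noteq> a" using assms(2) by (auto simp: fun_eq_iff)
  define r where "r = tr a (p a) \<circ> p"
  have S: "a \<in> {1..6}" "p a \<in> {1..6}" using a p2[of a] moved_in[OF p] by auto
  have t: "tr a (p a) permutes {1..6}" using S by (rule permutes_swap_id)
  have r: "r i = (if i = a \<or> i = p a then i else p i)" for i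
    using p2[of i] p2[of a] permutes_inject[OF p, of i a]
    by (auto simp: r_def Transposition.transpose_def)
  have U: "{i \<in> {1..6}. r i = i} = {i \<in> {1..6}. p i = i} \<union> {a, p a}" using S by (auto simp: r)
  have D: "{i \<in> {1..6}. p i = i} \<inter> {a, p a} = {}" using a p2[of a] by auto
  have "fixed 6 r = fixed 6 p + card {a, p a}"
    unfolding fixed_def U by (rule card_Un_disjoint[OF _ _ D]) auto
  then have "fixed 6 r = fixed 6 p + 2" using a by simp
  moreover have "r \<circ> r = id"
    using p2 permutes_inject[OF p] by (auto simp: fun_eq_iff r)
  moreover have "evenperm r \<longleftrightarrow> \<not> evenperm p"
    unfolding r_def using evenperm_compose_permutes[OF t p] a by (simp add: evenperm_transpose)
  moreover have "r permutes {1..6}" unfolding r_def by (rule permutes_compose[OF p t])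
  ultimately show ?thesis using that by blast
qed

text \<open>Strip two-cycles until the identity is reached. Three are the most that fit on six
  points and each changes the parity, so an even involution consists of exactly two.\<close>

lemma fixed_even_involution:
  assumes p: "p permutes {1..6}" and "p \<noteq> id" and p2: "p \<circ> p = id" and "evenperm p"
  shows "fixed 6 p = 2"
proof -
  have id6: "r = id" if "r permutes {1..6}" "fixed 6 r \<ge> 6" for r
    using that moved_eq_0_iff[OF that(1)] by (simp add: moved_eq)
  obtain r where r: "r permutes {1..6}" "r \<circ> r = id" "fixed 6 r = fixed 6 p + 2"
    "evenperm r \<longleftrightarrow> \<not> evenperm p" using involution_transpose[OF p assms(2) p2] .
  then have "r \<noteq> id" using assms(4) evenperm_id by auto
  then obtain s where s: "s permutes {1..6}" "s \<circ> s = id" "fixed 6 s = fixed 6 r + 2"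
    "evenperm s \<longleftrightarrow> \<not> evenperm r" using involution_transpose[OF r(1) _ r(2)] by blast
  show ?thesis
  proof (cases "s = id")
    case True
    then have "fixed 6 s = 6" by (simp only: fixed_id)
    then show ?thesis using s(3) r(3) by simp
  next
    case False
    then obtain u where u: "u permutes {1..6}" "u \<circ> u = id" "fixed 6 u = fixed 6 s + 2"
      "evenperm u \<longleftrightarrow> \<not> evenperm s" using involution_transpose[OF s(1) _ s(2)] by blast
    then have "u = id" using id6[OF u(1)] s(3) r(3) by simp
    then show ?thesis using u(4) s(4) r(4) assms(4) evenperm_id by auto
  qed
qed

lemma cyc_fixed_iff: "distinct [a, b, c] \<Longrightarrow> cyc a b c i = i \<longleftrightarrow> i \<notin> {a, b, c}"
  by (auto simp: cyc_def)

lemma cyc_orbit: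
  assumes "distinct [a, b, c]" "cyc a b c u = v" "v \<noteq> u"
  shows "cyc a b c = cyc u v (cyc a b c v) \<and> distinct [u, v, cyc a b c v]"
proof -
  have "u \<in> {a, b, c}" using assms cyc_fixed_iff[OF assms(1), of u] by auto
  then show ?thesis using assms by (auto simp: fun_eq_iff cyc_def)
qed

text \<open>If \<open>u\<close> is moved by \<open>c\<close> but not by \<open>c'\<close>, then \<open>(c c')\<^sup>2 u = u\<close> says that \<open>c\<close> and \<open>c'\<close> agree
  at \<open>c u\<close>: the two cycles share a directed edge.\<close>

lemma cyc_common_edge:
  assumes d: "distinct [a, b, c]" "distinct [d, e, f]"
    and sq: "\<And>i. cyc a b c (cyc d e f (cyc a b c (cyc d e f i))) = i"
    and ne: "cyc a b c \<noteq> cyc d e f" "cyc a b c \<circ> cyc d e f \<noteq> id"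
  obtains v where "cyc a b c v = cyc d e f v" "cyc a b c v \<noteq> v"
proof (cases "{a, b, c} \<subseteq> {d, e, f}")
  case True
  \<comment> \<open>With equal supports the second cycle is the first one or its inverse, and
    \<open>ne\<close> excludes both.\<close>
  define v w where "v = cyc d e f a" and "w = cyc d e f v"
  have mv: "i \<in> {a, b, c} \<Longrightarrow> cyc d e f i \<noteq> i" for i using True cyc_fixed_iff[OF d(2), of i] by blast
  have e: "cyc d e f = cyc a v w" "distinct [a, v, w]"
    using cyc_orbit[OF d(2), of a v] mv[of a] by (auto simp: v_def w_def)
  have "b \<in> {a, v, w}" "c \<in> {a, v, w}"
    using mv[of b] mv[of c] unfolding e(1) cyc_fixed_iff[OF e(2)] by auto
  then consider "b = v" "c = w" | "b = w" "c = v" using d(1) by auto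
  then show ?thesis
  proof cases
    case 1
    then show ?thesis using ne(1) e(1) by simp
  next
    case 2
    have "cyc a b c \<circ> cyc a c b = id" using d(1) by (auto simp: fun_eq_iff cyc_def)
    then show ?thesis using ne(2) e(1) 2 by simp
  qed
next
  case False
  then obtain u where u: "u \<in> {a, b, c}" "u \<notin> {d, e, f}" by blast
  let ?c = "cyc a b c" and ?d = "cyc d e f"
  have mv: "?c u \<noteq> u" "?d u = u" using u cyc_fixed_iff[OF d(1)] cyc_fixed_iff[OF d(2)] by simp_all
  have inj: "?c x = ?c y \<longleftrightarrow> x = y" for x y
    using permutes_inject[OF cyc_permutes[OF d(1) order_refl], of x y] .
  have "?c (?d (?c u)) = ?c (?c (?c u))" using sq[of u] mv(2) cyc_cyc_cyc[OF d(1), of u] by simp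
  then have "?d (?c u) = ?c (?c u)" by (simp only: inj)
  moreover have "?c (?c u) \<noteq> ?c u" using mv(1) by (simp add: inj)
  ultimately show ?thesis using that[of "?c u"] by simp
qed

text \<open>Without the edge from \<open>a\<close> to \<open>b\<close>, the cycle would take one of
  the edges b-x, x-a and one of b-y, y-a. Two such edges either share their start or their end,
  which contradicts injectivity, or involve the four points \<open>a\<close>, \<open>b\<close>,
  \<open>x\<close>, \<open>y\<close>, too many for a three-cycle.\<close>

lemma cyc_third_edge:
  assumes d: "distinct [a, b, x]" "distinct [a, b, y]" "x \<noteq> y" and d': "distinct [p, q, r]"
    and v: "cyc a b x v = cyc p q r v" "cyc a b x v \<noteq> v"
    and w: "cyc a b y w = cyc p q r w" "cyc a b y w \<noteq> w"
  shows "cyc p q r a = b"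
proof -
  let ?c = "cyc p q r"
  have inj: "?c i = ?c j \<longleftrightarrow> i = j" for i j
    using permutes_inject[OF cyc_permutes[OF d' order_refl], of i j] .
  have orb: "i = j \<or> ?c i = i \<or> i = k \<or> (i = ?c j \<and> ?c i = k)" if "?c k = j" "j \<noteq> k" for i j k
    using cyc_orbit[OF d' that] cyc_cyc_cyc[OF d', of k] that cyc_fixed_iff[of k j "?c j" i] by auto
  have ex: "cyc a b x a = b" "cyc a b x b = x" "cyc a b x x = a"
    and ey: "cyc a b y a = b" "cyc a b y b = y" "cyc a b y y = a"
    using d(1,2) by (auto simp: cyc_def)
  have "v \<in> {a, b, x}" using v(2) cyc_fixed_iff[OF d(1), of v] by blast
  then have V: "v = a \<and> ?c a = b \<or> v = b \<and> ?c b = x \<or> v = x \<and> ?c x = a"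
    using v(1)[symmetric] ex by (elim insertE emptyE) simp_all
  have "w \<in> {a, b, y}" using w(2) cyc_fixed_iff[OF d(2), of w] by blast
  then have W: "w = a \<and> ?c a = b \<or> w = b \<and> ?c b = y \<or> w = y \<and> ?c y = a"
    using w(1)[symmetric] ey by (elim insertE emptyE) simp_all
  show ?thesis
    using V W
  proof (elim disjE)
    assume "v = b \<and> ?c b = x" "w = y \<and> ?c y = a"
    then show ?thesis using orb[of b x y] inj[of x b] inj[of x y] d by auto
  next
    assume "v = x \<and> ?c x = a" "w = b \<and> ?c b = y"
    then show ?thesis using orb[of b y x] inj[of x b] inj[of x y] d by auto
  next
    assume "v = x \<and> ?c x = a" "w = y \<and> ?c y = a"
    then show ?thesis using inj[of x y] d by auto
  qed (use d in auto)
qed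

section \<open>Injective homomorphisms: conjugation, or three-cycles lose all fixed points\<close>

section \<open>Homomorphisms of the alternating and symmetric group of degree six\<close>

lemma cyc_cyc_involution:
  "distinct [a, b, i, j] \<Longrightarrow> (cyc a b i \<circ> cyc a b j) \<circ> (cyc a b i \<circ> cyc a b j) = id"
  by (auto simp: fun_eq_iff cyc_def)

declare One_nat_def [simp del]

text \<open>Treats S6 and A6 together, through groups that contain all even permutations, with
  products written as plain composition.\<close>

locale six_hom =
  fixes G :: "(nat \<Rightarrow> nat) set" and \<phi> :: "(nat \<Rightarrow> nat) \<Rightarrow> nat \<Rightarrow> nat"
  assumes G_even: "p permutes {1..6} \<Longrightarrow> evenperm p \<Longrightarrow> p \<in> G"
    and G_perm: "p \<in> G \<Longrightarrow> p permutes {1..6}"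
    and G_comp: "p \<in> G \<Longrightarrow> r \<in> G \<Longrightarrow> p \<circ> r \<in> G"
    and G_inv: "p \<in> G \<Longrightarrow> inv' p \<in> G"
    and \<phi>_perm: "p \<in> G \<Longrightarrow> \<phi> p permutes {1..6}"
    and \<phi>_comp: "p \<in> G \<Longrightarrow> r \<in> G \<Longrightarrow> \<phi> (p \<circ> r) = \<phi> p \<circ> \<phi> r"
    and \<phi>_inj: "p \<in> G \<Longrightarrow> r \<in> G \<Longrightarrow> \<phi> p = \<phi> r \<Longrightarrow> p = r"
begin

lemma id_G: "id \<in> G"
  by (rule G_even) (simp_all add: permutes_id evenperm_id)

lemma \<phi>_id: "\<phi> id = id"
proof -
  have "\<phi> id (\<phi> id x) = \<phi> id x" for x using fun_cong[OF \<phi>_comp[OF id_G id_G], of x] by simp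
  then show ?thesis using permutes_inject[OF \<phi>_perm[OF id_G]] by (simp add: fun_eq_iff)
qed

lemma \<phi>_inv:
  assumes "p \<in> G" shows "\<phi> (inv' p) = inv' (\<phi> p)"
proof -
  have "\<phi> p \<circ> \<phi> (inv' p) = id" "\<phi> (inv' p) \<circ> \<phi> p = id"
    using \<phi>_comp[OF assms G_inv[OF assms]] \<phi>_comp[OF G_inv[OF assms] assms] \<phi>_id
      permutes_inv_o[OF G_perm[OF assms]] by simp_all
  then show ?thesis by (intro inv_unique_comp[symmetric])
qed

lemma \<phi>_eq_id: "p \<in> G \<Longrightarrow> \<phi> p = id \<Longrightarrow> p = id"
  using \<phi>_inj[OF _ id_G] \<phi>_id by simp

lemma cyc_G: "distinct [a, b, c] \<Longrightarrow> {a, b, c} \<subseteq> {1..6} \<Longrightarrow> cyc a b c \<in> G"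
  by (intro G_even cyc_permutes evenperm_cyc)

text \<open>Three-cycles are conjugate under even permutations, which lie in \<open>G\<close>, so
  their images are conjugate.\<close>

lemma fixed_\<phi>_cyc:
  assumes "distinct [a, b, c]" "{a, b, c} \<subseteq> {1..6}"
  shows "fixed 6 (\<phi> (cyc a b c)) = fixed 6 (\<phi> (cyc 1 2 3))"
proof -
  obtain h where h: "h permutes {1..6}" "evenperm h" "h 1 = a" "h 2 = b" "h 3 = c"
    using even_perm_ex[OF assms] .
  have hG: "h \<in> G" by (rule G_even[OF h(1,2)])
  have "cyc a b c = h \<circ> cyc 1 2 3 \<circ> inv' h" using cyc_conj[OF h(1), of 1 2 3] h by simp
  then have "\<phi> (cyc a b c) = \<phi> h \<circ> \<phi> (cyc 1 2 3) \<circ> inv' (\<phi> h)"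
    using \<phi>_comp G_comp hG G_inv[OF hG] cyc_G[of 1 2 3] \<phi>_inv[OF hG] by simp
  then show ?thesis using fixed_conj[OF \<phi>_perm[OF hG]] by simp
qed

context
  assumes F3: "fixed 6 (\<phi> (cyc 1 2 3)) = 3"
begin

text \<open>The product of (1 2 i) and (1 2 j) is a nontrivial involution, and this passes to the
  images; \<open>cyc_common_edge\<close> then supplies the shared edge.\<close>

lemma \<phi>_cyc_edge:
  assumes i: "i \<in> {3..6}" "j \<in> {3..6}" "i \<noteq> j"
    and d: "\<phi> (cyc 1 2 i) = cyc a b c" "distinct [a, b, c]"
    and d': "\<phi> (cyc 1 2 j) = cyc a' b' c'" "distinct [a', b', c']"
  obtains v where "cyc a b c v = cyc a' b' c' v" "cyc a b c v \<noteq> v"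
proof -
  have G: "cyc 1 2 i \<in> G" "cyc 1 2 j \<in> G" using i by (auto intro!: cyc_G)
  have e: "cyc 1 2 i i = 1" "cyc 1 2 j i = i" "cyc 1 2 i 2 = i" "cyc 1 2 j 1 = 2" "cyc 1 2 i 1 = 2"
    using i by (auto simp: cyc_def)
  have e1: "cyc 1 2 i (cyc 1 2 j i) \<noteq> i" "cyc 1 2 i i \<noteq> cyc 1 2 j i" using e i by auto
  have "cyc 1 2 i \<circ> cyc 1 2 j \<noteq> id" using e1(1) by (metis comp_apply id_apply)
  then have "\<phi> (cyc 1 2 i) \<circ> \<phi> (cyc 1 2 j) \<noteq> id"
    using \<phi>_eq_id[OF G_comp[OF G]] \<phi>_comp[OF G] by metis
  moreover have "cyc 1 2 i \<noteq> cyc 1 2 j" using e1(2) by metis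
  then have "\<phi> (cyc 1 2 i) \<noteq> \<phi> (cyc 1 2 j)" using \<phi>_inj[OF G] by blast
  moreover have "(cyc 1 2 i \<circ> cyc 1 2 j) \<circ> (cyc 1 2 i \<circ> cyc 1 2 j) = id"
    using i by (intro cyc_cyc_involution) auto
  then have "(\<phi> (cyc 1 2 i) \<circ> \<phi> (cyc 1 2 j)) \<circ> (\<phi> (cyc 1 2 i) \<circ> \<phi> (cyc 1 2 j)) = id"
    using \<phi>_comp[OF G] \<phi>_comp[OF G_comp[OF G] G_comp[OF G]] \<phi>_id by simp
  ultimately have A: "cyc a b c \<circ> cyc a' b' c' \<noteq> id" "cyc a b c \<noteq> cyc a' b' c'"
    "(cyc a b c \<circ> cyc a' b' c') \<circ> (cyc a b c \<circ> cyc a' b' c') = id"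
    unfolding d(1) d'(1) by blast+
  have "cyc a b c (cyc a' b' c' (cyc a b c (cyc a' b' c' i))) = i" for i
    using fun_cong[OF A(3), of i] by simp
  from cyc_common_edge[OF d(2) d'(2) this A(2,1) that] show ?thesis .
qed

lemma \<phi>_cyc_ex:
  assumes "i \<in> {3..6}"
  obtains a b c where "\<phi> (cyc 1 2 i) = cyc a b c" "distinct [a, b, c]" "{a, b, c} \<subseteq> {1..6}"
proof -
  have i: "distinct [1, 2, i]" "{1, 2, i} \<subseteq> {1..6}" using assms by auto
  show ?thesis
    using fixed_3_cyc[OF \<phi>_perm[OF cyc_G[OF i]]] fixed_\<phi>_cyc[OF i] F3 that by metis
qed

text \<open>The images for 3 and 4 share an edge from \<open>a\<close> to \<open>b\<close>. The
  images for 5 and 6 share an edge with each of these two, so by \<open>cyc_third_edge\<close> they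
  contain the same edge.\<close>

lemma \<phi>_cyc_common:
  obtains a b x where "\<forall>i\<in>{3..6}. \<phi> (cyc 1 2 i) = cyc a b (x i) \<and> distinct [a, b, x i] \<and> {a, b, x i} \<subseteq> {1..6}"
proof -
  have i3: "3 \<in> {3..6::nat}" "4 \<in> {3..6::nat}" "3 \<noteq> (4::nat)" by auto
  obtain p q r where 3: "\<phi> (cyc 1 2 3) = cyc p q r" "distinct [p, q, r]" "{p, q, r} \<subseteq> {1..6}"
    using \<phi>_cyc_ex[OF i3(1)] .
  obtain p' q' r' where 4: "\<phi> (cyc 1 2 4) = cyc p' q' r'" "distinct [p', q', r']" "{p', q', r'} \<subseteq> {1..6}"
    using \<phi>_cyc_ex[OF i3(2)] .
  obtain a where a: "cyc p q r a = cyc p' q' r' a" "cyc p q r a \<noteq> a"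
    using \<phi>_cyc_edge[OF i3 3(1,2) 4(1,2)] .
  define b where "b = cyc p q r a"
  define x where "x i = \<phi> (cyc 1 2 i) b" for i
  have three: "\<phi> (cyc 1 2 3) = cyc a b (x 3) \<and> distinct [a, b, x 3]"
    using cyc_orbit[OF 3(2), of a b] a by (simp add: x_def 3(1) b_def)
  have four: "\<phi> (cyc 1 2 4) = cyc a b (x 4) \<and> distinct [a, b, x 4]"
    using cyc_orbit[OF 4(2), of a b] a by (simp add: x_def 4(1) b_def)
  have G: "cyc 1 2 3 \<in> G" "cyc 1 2 4 \<in> G" by (auto intro!: cyc_G)
  have "x 3 \<noteq> x 4"
  proof
    assume "x 3 = x 4"
    then have "cyc 1 2 3 = cyc 1 2 4" using \<phi>_inj[OF G] three four by simp
    then have "cyc 1 2 3 3 = cyc 1 2 4 3" by simp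
    then show False by (simp add: cyc_def)
  qed
  have "\<phi> (cyc 1 2 i) = cyc a b (x i) \<and> distinct [a, b, x i] \<and> {a, b, x i} \<subseteq> {1..6}" if i: "i \<in> {3..6}" for i
  proof -
    obtain u v w where u: "\<phi> (cyc 1 2 i) = cyc u v w" "distinct [u, v, w]" "{u, v, w} \<subseteq> {1..6}"
      using \<phi>_cyc_ex[OF i] .
    have main: "\<phi> (cyc 1 2 i) = cyc a b (x i) \<and> distinct [a, b, x i]"
    proof (cases "i = 3 \<or> i = 4")
      case True
      then show ?thesis using three four by auto
    next
      case False
      have i': "3 \<noteq> i" "4 \<noteq> i" using False by auto
      obtain s where s: "cyc a b (x 3) s = cyc u v w s" "cyc a b (x 3) s \<noteq> s"
        using \<phi>_cyc_edge[OF i3(1) i i'(1) three[THEN conjunct1] three[THEN conjunct2] u(1,2)] .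
      obtain t where t: "cyc a b (x 4) t = cyc u v w t" "cyc a b (x 4) t \<noteq> t"
        using \<phi>_cyc_edge[OF i3(2) i i'(2) four[THEN conjunct1] four[THEN conjunct2] u(1,2)] .
      have "cyc u v w a = b"
        by (rule cyc_third_edge[OF three[THEN conjunct2] four[THEN conjunct2] \<open>x 3 \<noteq> x 4\<close> u(2) s t])
      then show ?thesis using cyc_orbit[OF u(2), of a b] three by (simp add: x_def u(1))
    qed
    have "z \<in> {1..6}" if "z \<in> {a, b, x i}" for z
    proof (rule moved_in)
      show "\<phi> (cyc 1 2 i) permutes {1..6}" using i by (intro \<phi>_perm cyc_G) auto
      show "\<phi> (cyc 1 2 i) z \<noteq> z" using that main cyc_fixed_iff[of a b "x i" z] by auto
    qed
    then show ?thesis using main by blast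
  qed
  then show ?thesis using that by blast
qed

text \<open>The common edge and the third points of the image cycles spell out \<open>s\<close>: it
  sends 1 to \<open>a\<close>, 2 to \<open>b\<close> and \<open>i\<close> to
  \<open>x i\<close>.\<close>

lemma conj_on_cyc12:
  obtains s where "s permutes {1..6}" "\<forall>i\<in>{3..6}. \<phi> (cyc 1 2 i) = s \<circ> cyc 1 2 i \<circ> inv' s"
proof -
  obtain a b x where A: "\<forall>i\<in>{3..6}. \<phi> (cyc 1 2 i) = cyc a b (x i) \<and>
      distinct [a, b, x i] \<and> {a, b, x i} \<subseteq> {1..6}"
    using \<phi>_cyc_common .
  then have abx: "\<phi> (cyc 1 2 i) = cyc a b (x i) \<and> distinct [a, b, x i] \<and> {a, b, x i} \<subseteq> {1..6}"
    if "i \<in> {3..6}" for i using that by blast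
  have xinj: "x i \<noteq> x j" if i: "i \<in> {3..6}" "j \<in> {3..6}" "i \<noteq> j" for i j
  proof
    assume "x i = x j"
    then have "\<phi> (cyc 1 2 i) = \<phi> (cyc 1 2 j)" using abx[OF i(1)] abx[OF i(2)] by simp
    moreover have d: "distinct [1, 2, i]" "distinct [1, 2, j]" "{1, 2, i} \<subseteq> {1..6}" "{1, 2, j} \<subseteq> {1..6}"
      using i by auto
    ultimately have "cyc 1 2 i = cyc 1 2 j" using \<phi>_inj[OF cyc_G[OF d(1,3)] cyc_G[OF d(2,4)]] by blast
    then have "cyc 1 2 j i \<noteq> i" using cyc_fixed_iff[OF d(1), of i] by simp
    then show False using cyc_fixed_iff[OF d(2), of i] d(1) i(3) by simp
  qed
  define s where "s i = (if i = 1 then a else if i = 2 then b else if i \<in> {3..6} then x i else i)" for i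
  have sv: "s 1 = a" "s 2 = b" "s 3 = x 3" "s 4 = x 4" "s 5 = x 5" "s 6 = x 6" by (simp_all add: s_def)
  have six: "{1..6} = {1, 2, 3, 4, 5, 6::nat}" by auto
  have mem: "3 \<in> {3..6::nat}" "4 \<in> {3..6::nat}" "5 \<in> {3..6::nat}" "6 \<in> {3..6::nat}" by simp_all
  note ab = abx[OF mem(1)] abx[OF mem(2)] abx[OF mem(3)] abx[OF mem(4)]
  have ne: "x 3 \<noteq> x 4" "x 3 \<noteq> x 5" "x 3 \<noteq> x 6" "x 4 \<noteq> x 5" "x 4 \<noteq> x 6" "x 5 \<noteq> x 6"
    using xinj mem by simp_all
  have "inj_on s {1..6}" unfolding six using ab ne by (simp add: sv)
  moreover have "s ` {1..6} \<subseteq> {1..6}"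
  proof -
    have "s ` {1..6} = {a, b, x 3, x 4, x 5, x 6}" unfolding six by (simp add: sv)
    then show ?thesis using ab by (simp only: insert_subset empty_subsetI simp_thms)
  qed
  ultimately have "bij_betw s {1..6} {1..6}"
    using endo_inj_surj[of "{1..6}" s] by (auto simp: bij_betw_def)
  then have s: "s permutes {1..6}" by (rule bij_imp_permutes) (auto simp: s_def)
  moreover have "\<phi> (cyc 1 2 i) = s \<circ> cyc 1 2 i \<circ> inv' s" if "i \<in> {3..6}" for i
    using abx[OF that] that unfolding cyc_conj[OF s] by (simp add: s_def)
  ultimately show ?thesis using that by blast
qed

end

end

lemma cyc_eq_cases:
  assumes "distinct [a, b, c]" "distinct [d, e, f]" "cyc a b c = cyc d e f"
  shows "a = d \<and> b = e \<and> c = f \<or> a = e \<and> b = f \<and> c = d \<or> a = f \<and> b = d \<and> c = e"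
proof -
  have ev: "cyc a b c a = b" "cyc a b c b = c" "cyc d e f d = e" "cyc d e f e = f" "cyc d e f f = d"
    using assms(1,2) by (auto simp: cyc_def)
  have "a \<in> {d, e, f}" using cyc_fixed_iff[OF assms(2), of a] ev(1) assms(1) unfolding assms(3) by auto
  then show ?thesis using ev unfolding assms(3) by auto
qed

context six_hom
begin

text \<open>The set \<open>F\<close> where \<open>\<phi>\<close> agrees with conjugation by
  \<open>s\<close> is closed under products and inverses, and contains the cycles (1 2 i);
  conjugating these by one another yields all three-cycles. For arbitrary \<open>g\<close>, the
  permutations \<open>s \<circ> g\<close> and \<open>\<phi> g \<circ> s\<close> carry each (1 2 i)
  to the same cycle and therefore coincide.\<close>

lemma conj_if_fixed_3:
  assumes "fixed 6 (\<phi> (cyc 1 2 3)) = 3"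
  obtains s where "s permutes {1..6}" "\<forall>g\<in>G. \<phi> g = s \<circ> g \<circ> inv' s"
proof -
  obtain s where s: "s permutes {1..6}"
    and s12: "\<forall>i\<in>{3..6}. \<phi> (cyc 1 2 i) = s \<circ> cyc 1 2 i \<circ> inv' s"
    using conj_on_cyc12[OF assms] .
  define F where "F = {g \<in> G. \<phi> g = s \<circ> g \<circ> inv' s}"
  have ss: "inv' s \<circ> s = id" by (rule permutes_inv_o(2)[OF s])
  have comp: "g \<circ> h \<in> F" if "g \<in> F" "h \<in> F" for g h
  proof -
    have "s \<circ> g \<circ> inv' s \<circ> (s \<circ> h \<circ> inv' s) = s \<circ> g \<circ> (inv' s \<circ> s) \<circ> h \<circ> inv' s" by (simp only: o_assoc)
    also have "\<dots> = s \<circ> (g \<circ> h) \<circ> inv' s" by (simp only: ss comp_id o_assoc)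
    finally show ?thesis using that \<phi>_comp[of g h] G_comp[of g h] by (simp add: F_def)
  qed
  have inv: "inv' g \<in> F" if "g \<in> F" for g
  proof -
    have g: "g \<in> G" "\<phi> g = s \<circ> g \<circ> inv' s" using that by (auto simp: F_def)
    have b: "bij s" "bij g" "bij (inv' s)"
      using permutes_bij[OF s] permutes_bij[OF G_perm[OF g(1)]] permutes_bij[OF permutes_inv[OF s]] by simp_all
    have "inv' (s \<circ> g \<circ> inv' s) = s \<circ> inv' g \<circ> inv' s"
      using b by (simp add: o_inv_distrib bij_comp permutes_inv_inv[OF s] o_assoc)
    then show ?thesis using g \<phi>_inv[OF g(1)] G_inv[OF g(1)] by (simp add: F_def)
  qed
  have conj: "cyc (h a) (h b) (h c) \<in> F" if "h \<in> F" "cyc a b c \<in> F" for h a b c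
  proof -
    have "h permutes {1..6}" using that(1) by (auto simp: F_def intro: G_perm)
    from cyc_conj[OF this, of a b c] show ?thesis using comp[OF comp[OF that] inv[OF that(1)]] by simp
  qed
  have ge3: "1 \<noteq> i" "2 \<noteq> i" "i \<noteq> 1" "i \<noteq> 2" if "i \<in> {3..6}" for i :: nat using that by auto
  have ev: "cyc 1 2 i 1 = 2" "cyc 1 2 i 2 = i" "cyc 1 2 i i = 1" "j \<noteq> i \<Longrightarrow> j \<in> {3..6} \<Longrightarrow> cyc 1 2 i j = j"
    if "i \<in> {3..6}" for i j
    using ge3[OF that] ge3[of j] by (simp_all add: cyc_def)
  have f1: "cyc 1 2 i \<in> F" if "i \<in> {3..6}" for i
  proof -
    have "cyc 1 2 i \<in> G" using that by (intro cyc_G) auto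
    then show ?thesis using s12 that by (simp add: F_def)
  qed
  have f2: "cyc 2 1 i \<in> F" if i: "i \<in> {3..6}" for i
  proof -
    have "cyc 2 1 i = cyc 1 2 i \<circ> cyc 1 2 i" using ge3[OF i] by (auto simp: fun_eq_iff cyc_def)
    then show ?thesis using comp[OF f1[OF i] f1[OF i]] by simp
  qed
  have f3: "cyc 2 i j \<in> F" "cyc i 1 j \<in> F" if "i \<in> {3..6}" "j \<in> {3..6}" "j \<noteq> i" for i j
  proof -
    show a: "cyc 2 i j \<in> F" using conj[OF f1[OF that(1)] f1[OF that(2)]] ev[OF that(1)] that by simp
    show "cyc i 1 j \<in> F" using conj[OF f1[OF that(1)] a] ev[OF that(1)] that by simp
  qed
  have f4: "cyc i k j \<in> F"
    if "i \<in> {3..6}" "j \<in> {3..6}" "k \<in> {3..6}" "j \<noteq> i" "i \<noteq> k" "j \<noteq> k" for i j k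
  proof -
    have "cyc i 2 j \<in> F" using conj[OF f1[OF that(3)] f3(2)[OF that(1,2,4)]] ev[OF that(3)] that by simp
    from conj[OF f1[OF that(3)] this] show ?thesis using ev[OF that(3)] that by simp
  qed
  have all: "cyc a b c \<in> F" if d: "distinct [a, b, c]" and S: "{a, b, c} \<subseteq> {1..6}" for a b c
  proof -
    have x: "x = 1 \<or> x = 2 \<or> x \<in> {3..6}" if "x \<in> {1..6}" for x :: nat using that by auto
    have abc: "a = 1 \<or> a = 2 \<or> a \<in> {3..6}" "b = 1 \<or> b = 2 \<or> b \<in> {3..6}" "c = 1 \<or> c = 2 \<or> c \<in> {3..6}"
      using S x by blast+
    have ne: "a \<noteq> b" "b \<noteq> a" "b \<noteq> c" "c \<noteq> b" "a \<noteq> c" "c \<noteq> a" using d by auto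
    have rot: "cyc 2 i 1 = cyc 1 2 i" "cyc i 1 2 = cyc 1 2 i" "cyc 1 i 2 = cyc 2 1 i" "cyc i 2 1 = cyc 2 1 i"
      if "i \<in> {3..6}" for i
      using ge3[OF that] by (auto simp: fun_eq_iff cyc_def)
    have rot': "cyc 1 j i = cyc i 1 j" "cyc j i 1 = cyc i 1 j" "cyc i j 2 = cyc 2 i j" "cyc j 2 i = cyc 2 i j"
      if "i \<in> {3..6}" "j \<in> {3..6}" "j \<noteq> i" for i j
      using ge3[OF that(1)] ge3[OF that(2)] that(3) by (auto simp: fun_eq_iff cyc_def)
    define J where "J = {3..6::nat}"
    have P: "cyc 1 2 i \<in> F \<and> cyc 2 i 1 \<in> F \<and> cyc i 1 2 \<in> F \<and> cyc 2 1 i \<in> F \<and> cyc 1 i 2 \<in> F \<and> cyc i 2 1 \<in> F"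
      if "i \<in> J" for i
      using that unfolding J_def by (simp only: rot f1 f2 simp_thms)
    have Q: "cyc i 1 j \<in> F \<and> cyc 1 j i \<in> F \<and> cyc j i 1 \<in> F \<and> cyc 2 i j \<in> F \<and> cyc i j 2 \<in> F \<and> cyc j 2 i \<in> F"
      if "i \<in> J" "j \<in> J" "j \<noteq> i" for i j
      using that unfolding J_def by (simp only: rot' f3 simp_thms not_False_eq_True)
    have R: "cyc i k j \<in> F" if "i \<in> J" "j \<in> J" "k \<in> J" "j \<noteq> i" "i \<noteq> k" "j \<noteq> k" for i j k
      using that unfolding J_def by (rule f4)
    show ?thesis
      using abc ne unfolding J_def[symmetric] by (elim disjE) (simp_all add: P Q R)
  qed
  have "\<phi> g = s \<circ> g \<circ> inv' s" if g: "g \<in> G" for g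
  proof -
    define A where "A = s \<circ> g"
    define B where "B = \<phi> g \<circ> s"
    note gp = G_perm[OF g]
    have A: "A permutes {1..6}" unfolding A_def by (rule permutes_compose[OF gp s])
    have B: "B permutes {1..6}" unfolding B_def by (rule permutes_compose[OF s \<phi>_perm[OF g]])
    have eq: "cyc (A 1) (A 2) (A i) = cyc (B 1) (B 2) (B i)" if i: "i \<in> {3..6}" for i
    proof -
      have d: "distinct [1, 2, i]" "{1, 2, i} \<subseteq> {1..6}" using i by auto
      have tG: "cyc 1 2 i \<in> G" by (rule cyc_G[OF d])
      have d': "distinct [g 1, g 2, g i]" "{g 1, g 2, g i} \<subseteq> {1..6}"
        using d permutes_inject[OF gp] permutes_in_image[OF gp] by (simp_all del: atLeastAtMost_iff)
      have "cyc (A 1) (A 2) (A i) = s \<circ> cyc (g 1) (g 2) (g i) \<circ> inv' s"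
        using cyc_conj[OF s, of "g 1" "g 2" "g i"] by (simp add: A_def)
      also have "\<dots> = \<phi> (cyc (g 1) (g 2) (g i))" using all[OF d'] by (simp add: F_def)
      also have "\<dots> = \<phi> (g \<circ> cyc 1 2 i \<circ> inv' g)" using cyc_conj[OF gp, of 1 2 i] by simp
      also have "\<dots> = \<phi> g \<circ> \<phi> (cyc 1 2 i) \<circ> inv' (\<phi> g)"
        using \<phi>_comp[OF G_comp[OF g tG] G_inv[OF g]] \<phi>_comp[OF g tG] \<phi>_inv[OF g] by simp
      also have "\<phi> (cyc 1 2 i) = cyc (s 1) (s 2) (s i)"
        using s12 i cyc_conj[OF s, of 1 2 i] by simp
      also have "\<phi> g \<circ> cyc (s 1) (s 2) (s i) \<circ> inv' (\<phi> g) = cyc (B 1) (B 2) (B i)"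
        using cyc_conj[OF \<phi>_perm[OF g], of "s 1" "s 2" "s i"] by (simp add: B_def)
      finally show ?thesis .
    qed
    have cases: "A 1 = B 1 \<and> A 2 = B 2 \<and> A i = B i \<or> A 1 = B 2 \<and> A 2 = B i \<or> A 1 = B i \<and> A 2 = B 1"
      if i: "i \<in> {3..6}" for i
    proof -
      have "distinct [A 1, A 2, A i]" "distinct [B 1, B 2, B i]"
        using ge3[OF i] permutes_inject[OF A] permutes_inject[OF B] by simp_all
      from cyc_eq_cases[OF this eq[OF i]] show ?thesis by blast
    qed
    have Bne: "B 3 \<noteq> B 4" "B 2 \<noteq> B 3" "B 2 \<noteq> B 4" "B 1 \<noteq> B 2" "B 1 \<noteq> B 3" "B 1 \<noteq> B 4"
      using permutes_inject[OF B] by simp_all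
    have m: "3 \<in> {3..6::nat}" "4 \<in> {3..6::nat}" by simp_all
    \<comment> \<open>A single equality of three-cycles determines the entries only up to rotation;
      a rotation is incompatible with having both \<open>i = 3\<close> and
      \<open>i = 4\<close>.\<close>
    have A12: "A 1 = B 1 \<and> A 2 = B 2"
      using cases[OF m(1)] cases[OF m(2)] Bne by (elim disjE conjE) simp_all
    have "A i = B i" if i: "i \<in> {3..6}" for i
      using cases[OF i] A12 Bne(4) ge3[OF i] permutes_inject[OF B] by (elim disjE conjE) simp_all
    moreover have x: "x = 1 \<or> x = 2 \<or> x \<in> {3..6} \<or> x \<notin> {1..6}" for x :: nat by auto
    ultimately have "A x = B x" for x
      using A12 permutes_not_in[OF A, of x] permutes_not_in[OF B, of x] x[of x] by (elim disjE) simp_all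
    then have "A = B" ..
    then have "s \<circ> g \<circ> inv' s = \<phi> g \<circ> (s \<circ> inv' s)" by (simp add: A_def B_def o_assoc)
    then show ?thesis by (simp add: permutes_inv_o[OF s])
  qed
  then show ?thesis using that s by blast
qed

text \<open>The image has order three, so by \<open>fixed_order_3\<close> it fixes three points or
  none, and the choice is the same for all three-cycles.\<close>

lemma fixed_\<phi>_three_cycle:
  assumes ne: "fixed 6 (\<phi> (cyc 1 2 3)) \<noteq> 3" and d: "distinct [a, b, c]" "{a, b, c} \<subseteq> {1..6}"
  shows "fixed 6 (\<phi> (cyc a b c)) = 0"
proof -
  have cG: "cyc a b c \<in> G" by (rule cyc_G[OF d])
  have "cyc a b c \<noteq> id" using cyc_fixed_iff[OF d(1), of a] by (auto simp: fun_eq_iff)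
  then have n: "\<phi> (cyc a b c) \<noteq> id" using \<phi>_eq_id[OF cG] by blast
  have "cyc a b c \<circ> (cyc a b c \<circ> cyc a b c) = id" by (simp add: fun_eq_iff cyc_cyc_cyc[OF d(1)])
  then have "\<phi> (cyc a b c) \<circ> (\<phi> (cyc a b c) \<circ> \<phi> (cyc a b c)) = id"
    using \<phi>_comp[OF cG G_comp[OF cG cG]] \<phi>_comp[OF cG cG] \<phi>_id by simp
  then have "\<phi> (cyc a b c) (\<phi> (cyc a b c) (\<phi> (cyc a b c) i)) = i" for i
    by (simp add: fun_eq_iff)
  from fixed_order_3[OF \<phi>_perm[OF cG] n this] show ?thesis using fixed_\<phi>_cyc[OF d] ne by simp
qed

text \<open>A three-cycle disjoint from the transposition commutes with it, and its image
  \<open>?d\<close> has two orbits of length three. If the involution \<open>?t\<close> fixed a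
  point, it would fix that orbit pointwise and act on the other one as a nontrivial power of
  \<open>?d\<close>, which has order three.\<close>

lemma fixed_\<phi>_transpose:
  assumes ne: "fixed 6 (\<phi> (cyc 1 2 3)) \<noteq> 3"
    and G: "tr a b \<in> G" and ab: "a \<noteq> b" "a \<in> {1..6}" "b \<in> {1..6}"
  shows "fixed 6 (\<phi> (tr a b)) = 0"
proof (rule ccontr)
  let ?t = "\<phi> (tr a b)"
  assume "fixed 6 ?t \<noteq> 0"
  then obtain x where x: "x \<in> {1..6}" "?t x = x" unfolding fixed_def by (auto simp: card_eq_0_iff)
  have "card ({1..6} - {a, b}) = 4" using ab by (subst card_Diff_subset) auto
  then have "3 \<le> card ({1..6} - {a, b})" by simp
  then obtain S where S: "S \<subseteq> {1..6} - {a, b}" "card S = 3" by (rule obtain_subset_with_card_n)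
  obtain u v w where uvw: "S = {u, v, w}" "u \<noteq> v" "v \<noteq> w" "u \<noteq> w" using S(2) unfolding card_3_iff by blast
  have d: "distinct [u, v, w]" "{u, v, w} \<subseteq> {1..6}" and abS: "a \<notin> {u, v, w}" "b \<notin> {u, v, w}"
    using S(1) uvw by auto
  have cG: "cyc u v w \<in> G" by (rule cyc_G[OF d])
  let ?d = "\<phi> (cyc u v w)"
  have tp: "?t permutes {1..6}" and dp: "?d permutes {1..6}" by (rule \<phi>_perm, fact)+
  have fd: "?d i \<noteq> i" if "i \<in> {1..6}" for i
  proof -
    have "card {i \<in> {1..6}. ?d i = i} = 0" using fixed_\<phi>_three_cycle[OF ne d] by (simp add: fixed_def)
    then have "{i \<in> {1..6}. ?d i = i} = {}" by simp
    then show ?thesis using that by blast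
  qed
  have "cyc u v w \<circ> (cyc u v w \<circ> cyc u v w) = id" by (simp add: fun_eq_iff cyc_cyc_cyc[OF d(1)])
  then have "?d \<circ> (?d \<circ> ?d) = id"
    using \<phi>_comp[OF cG G_comp[OF cG cG]] \<phi>_comp[OF cG cG] \<phi>_id by simp
  then have d3: "?d (?d (?d i)) = i" for i by (simp add: fun_eq_iff)
  have "tr a b \<circ> tr a b = id" by simp
  then have "?t \<circ> ?t = id" using \<phi>_comp[OF G G] \<phi>_id by simp
  then have t2: "?t (?t i) = i" for i by (simp add: fun_eq_iff)
  have "tr a b \<circ> cyc u v w = cyc u v w \<circ> tr a b"
    using abS by (auto simp: fun_eq_iff cyc_def Transposition.transpose_def)
  then have "?t \<circ> ?d = ?d \<circ> ?t" using \<phi>_comp[OF G cG] \<phi>_comp[OF cG G] by simp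
  then have td: "?t (?d i) = ?d (?t i)" for i by (simp add: fun_eq_iff)
  have "tr a b \<noteq> id" using ab(1) by (metis id_apply transpose_apply_first)
  then have "?t \<noteq> id" using \<phi>_eq_id[OF G] by blast
  then obtain y where y: "?t y \<noteq> y" by (auto simp: fun_eq_iff)
  have y6: "y \<in> {1..6}" by (rule moved_in[OF tp y])
  have tX: "?t z = z" if "z \<in> {x, ?d x, ?d (?d x)}" for z using that x(2) td by auto
  have tY: "?t z \<noteq> z" if "z \<in> {y, ?d y, ?d (?d y)}" for z
    using that y td permutes_inject[OF dp] by auto
  have "{x, ?d x, ?d (?d x)} \<inter> {y, ?d y, ?d (?d y)} = {}" using tX tY by blast
  moreover have c3: "card {z, ?d z, ?d (?d z)} = 3" if "z \<in> {1..6}" for z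
  proof -
    have "?d z \<noteq> z" using fd[OF that] .
    moreover have "?d (?d z) \<noteq> ?d z" using fd[OF that] permutes_inject[OF dp] by simp
    moreover have "?d (?d z) \<noteq> z" using d3[of z] fd[OF that] by auto
    ultimately show ?thesis by auto
  qed
  ultimately have "card ({x, ?d x, ?d (?d x)} \<union> {y, ?d y, ?d (?d y)}) = 6"
    using c3[OF x(1)] c3[OF y6] by (subst card_Un_disjoint) auto
  moreover have in6: "?d z \<in> {1..6} \<longleftrightarrow> z \<in> {1..6}" for z by (rule permutes_in_image[OF dp])
  have sub: "{x, ?d x, ?d (?d x)} \<union> {y, ?d y, ?d (?d y)} \<subseteq> {1..6}"
    using x(1) y6 in6 by (simp del: atLeastAtMost_iff)
  ultimately have "{x, ?d x, ?d (?d x)} \<union> {y, ?d y, ?d (?d y)} = {1..6}"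
    by (intro card_subset_eq) simp_all
  moreover have "?t y \<in> {1..6}" using y6 permutes_in_image[OF tp] by blast
  moreover have "?t y \<notin> {x, ?d x, ?d (?d x)}" using tX[of "?t y"] t2[of y] y by auto
  ultimately have "?t y \<in> {y, ?d y, ?d (?d y)}" by blast
  \<comment> \<open>Either way \<open>?t\<close> acts on this orbit as a rotation of order three,
    contradicting that its square is the identity.\<close>
  then consider "?t y = ?d y" | "?t y = ?d (?d y)" using y by blast
  then show False
  proof cases
    case 1
    have "y = ?d (?d y)" using t2[of y] td[of y] unfolding 1 by simp
    then show False using d3[of y] fd[OF y6] by simp
  next
    case 2
    have "y = ?d (?d (?d (?d y)))" using t2[of y] td[of "?d y"] td[of y] unfolding 2 by simp
    then show False using d3[of "?d y"] fd[OF y6] by simp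
  qed
qed

text \<open>A nonidentity element with three or more fixed points is a three-cycle or a
  transposition, and its image has none. Since \<open>\<phi>\<close> is an involution, the same
  holds with the roles of \<open>g\<close> and \<open>\<phi> g\<close> exchanged; if neither has
  three, the sum is at most 2 + 2.\<close>

lemma fixed_add_fixed_\<phi>_le:
  assumes ne: "fixed 6 (\<phi> (cyc 1 2 3)) \<noteq> 3"
    and inv: "\<And>g. g \<in> G \<Longrightarrow> \<phi> g \<in> G \<and> \<phi> (\<phi> g) = g" and g: "g \<in> G" "g \<noteq> id"
  shows "fixed 6 g + fixed 6 (\<phi> g) \<le> 4"
proof -
  have big: "fixed 6 (\<phi> g) = 0" if h: "g \<in> G" "g \<noteq> id" "fixed 6 g \<ge> 3" for g
  proof -
    have "fixed 6 g = 3 \<or> fixed 6 g = 4" using fixed_le_4[OF G_perm[OF h(1)] h(2)] h(3) by auto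
    then show ?thesis
    proof
      assume "fixed 6 g = 3"
      then obtain a b c where "distinct [a, b, c]" "{a, b, c} \<subseteq> {1..6}" "g = cyc a b c"
        using fixed_3_cyc[OF G_perm[OF h(1)]] by blast
      then show ?thesis using fixed_\<phi>_three_cycle[OF ne] by simp
    next
      assume "fixed 6 g = 4"
      then obtain a b where "a \<noteq> b" "a \<in> {1..6}" "b \<in> {1..6}" "g = tr a b"
        using fixed_4_transpose[OF G_perm[OF h(1)]] by blast
      then show ?thesis using fixed_\<phi>_transpose[OF ne, of a b] h(1) by simp
    qed
  qed
  have n: "\<phi> g \<noteq> id" using \<phi>_eq_id[OF g(1)] g(2) by blast
  have i: "\<phi> g \<in> G" "\<phi> (\<phi> g) = g" using inv[OF g(1)] by auto
  show ?thesis
    using big[OF g] big[OF i(1) n] i(2) fixed_le_4[OF G_perm[OF g(1)] g(2)] fixed_le_4[OF \<phi>_perm[OF g(1)] n]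
    by (cases "fixed 6 g \<ge> 3"; cases "fixed 6 (\<phi> g) \<ge> 3") simp_all
qed

end

section \<open>An involutory outer automorphism from synthemes and totals\<close>

section \<open>An outer automorphism\<close>

text \<open>For \<open>a \<noteq> b\<close> the involution \<open>syn a b\<close> is the syntheme common to the totals \<open>a\<close> and \<open>b\<close>.
  The six totals are labelled such that \<open>syn a b i = j\<close> iff \<open>syn i j a = b\<close>; this polarity makes
  the resulting outer automorphism an involution.\<close>

definition syn :: "nat \<Rightarrow> nat \<Rightarrow> nat \<Rightarrow> nat"
  where "syn a b i = (if {a, b, i} \<subseteq> {1..6} then
    [[[1, 2, 3, 4, 5, 6], [2, 1, 4, 3, 6, 5], [4, 6, 5, 1, 3, 2], [3, 5, 1, 6, 2, 4], [6, 3, 2, 5, 4, 1], [5, 4, 6, 2, 1, 3]],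
     [[2, 1, 4, 3, 6, 5], [1, 2, 3, 4, 5, 6], [5, 3, 2, 6, 1, 4], [6, 4, 5, 2, 3, 1], [4, 5, 6, 1, 2, 3], [3, 6, 1, 5, 4, 2]],
     [[4, 6, 5, 1, 3, 2], [5, 3, 2, 6, 1, 4], [1, 2, 3, 4, 5, 6], [2, 1, 6, 5, 4, 3], [3, 4, 1, 2, 6, 5], [6, 5, 4, 3, 2, 1]],
     [[3, 5, 1, 6, 2, 4], [6, 4, 5, 2, 3, 1], [2, 1, 6, 5, 4, 3], [1, 2, 3, 4, 5, 6], [5, 6, 4, 3, 1, 2], [4, 3, 2, 1, 6, 5]],
     [[6, 3, 2, 5, 4, 1], [4, 5, 6, 1, 2, 3], [3, 4, 1, 2, 6, 5], [5, 6, 4, 3, 1, 2], [1, 2, 3, 4, 5, 6], [2, 1, 5, 6, 3, 4]],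
     [[5, 4, 6, 2, 1, 3], [3, 6, 1, 5, 4, 2], [6, 5, 4, 3, 2, 1], [4, 3, 2, 1, 6, 5], [2, 1, 5, 6, 3, 4], [1, 2, 3, 4, 5, 6]]] ! (a - 1) ! (b - 1) ! (i - 1) else i)"

lemma all6: "(\<forall>i\<in>{1..6::nat}. P i) \<longleftrightarrow> P 1 \<and> P 2 \<and> P 3 \<and> P 4 \<and> P 5 \<and> P 6"
proof -
  have "{1..6::nat} = {1, 2, 3, 4, 5, 6}" by auto
  then show ?thesis by simp
qed

lemma syn_eqs:
  "syn 1 1 1 = 1" "syn 1 1 2 = 2" "syn 1 1 3 = 3" "syn 1 1 4 = 4" "syn 1 1 5 = 5" "syn 1 1 6 = 6"
  "syn 1 2 1 = 2" "syn 1 2 2 = 1" "syn 1 2 3 = 4" "syn 1 2 4 = 3" "syn 1 2 5 = 6" "syn 1 2 6 = 5"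
  "syn 1 3 1 = 4" "syn 1 3 2 = 6" "syn 1 3 3 = 5" "syn 1 3 4 = 1" "syn 1 3 5 = 3" "syn 1 3 6 = 2"
  "syn 1 4 1 = 3" "syn 1 4 2 = 5" "syn 1 4 3 = 1" "syn 1 4 4 = 6" "syn 1 4 5 = 2" "syn 1 4 6 = 4"
  "syn 1 5 1 = 6" "syn 1 5 2 = 3" "syn 1 5 3 = 2" "syn 1 5 4 = 5" "syn 1 5 5 = 4" "syn 1 5 6 = 1"
  "syn 1 6 1 = 5" "syn 1 6 2 = 4" "syn 1 6 3 = 6" "syn 1 6 4 = 2" "syn 1 6 5 = 1" "syn 1 6 6 = 3"
  "syn 2 1 1 = 2" "syn 2 1 2 = 1" "syn 2 1 3 = 4" "syn 2 1 4 = 3" "syn 2 1 5 = 6" "syn 2 1 6 = 5"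
  "syn 2 2 1 = 1" "syn 2 2 2 = 2" "syn 2 2 3 = 3" "syn 2 2 4 = 4" "syn 2 2 5 = 5" "syn 2 2 6 = 6"
  "syn 2 3 1 = 5" "syn 2 3 2 = 3" "syn 2 3 3 = 2" "syn 2 3 4 = 6" "syn 2 3 5 = 1" "syn 2 3 6 = 4"
  "syn 2 4 1 = 6" "syn 2 4 2 = 4" "syn 2 4 3 = 5" "syn 2 4 4 = 2" "syn 2 4 5 = 3" "syn 2 4 6 = 1"
  "syn 2 5 1 = 4" "syn 2 5 2 = 5" "syn 2 5 3 = 6" "syn 2 5 4 = 1" "syn 2 5 5 = 2" "syn 2 5 6 = 3"
  "syn 2 6 1 = 3" "syn 2 6 2 = 6" "syn 2 6 3 = 1" "syn 2 6 4 = 5" "syn 2 6 5 = 4" "syn 2 6 6 = 2"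
  "syn 3 1 1 = 4" "syn 3 1 2 = 6" "syn 3 1 3 = 5" "syn 3 1 4 = 1" "syn 3 1 5 = 3" "syn 3 1 6 = 2"
  "syn 3 2 1 = 5" "syn 3 2 2 = 3" "syn 3 2 3 = 2" "syn 3 2 4 = 6" "syn 3 2 5 = 1" "syn 3 2 6 = 4"
  "syn 3 3 1 = 1" "syn 3 3 2 = 2" "syn 3 3 3 = 3" "syn 3 3 4 = 4" "syn 3 3 5 = 5" "syn 3 3 6 = 6"
  "syn 3 4 1 = 2" "syn 3 4 2 = 1" "syn 3 4 3 = 6" "syn 3 4 4 = 5" "syn 3 4 5 = 4" "syn 3 4 6 = 3"
  "syn 3 5 1 = 3" "syn 3 5 2 = 4" "syn 3 5 3 = 1" "syn 3 5 4 = 2" "syn 3 5 5 = 6" "syn 3 5 6 = 5"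
  "syn 3 6 1 = 6" "syn 3 6 2 = 5" "syn 3 6 3 = 4" "syn 3 6 4 = 3" "syn 3 6 5 = 2" "syn 3 6 6 = 1"
  "syn 4 1 1 = 3" "syn 4 1 2 = 5" "syn 4 1 3 = 1" "syn 4 1 4 = 6" "syn 4 1 5 = 2" "syn 4 1 6 = 4"
  "syn 4 2 1 = 6" "syn 4 2 2 = 4" "syn 4 2 3 = 5" "syn 4 2 4 = 2" "syn 4 2 5 = 3" "syn 4 2 6 = 1"
  "syn 4 3 1 = 2" "syn 4 3 2 = 1" "syn 4 3 3 = 6" "syn 4 3 4 = 5" "syn 4 3 5 = 4" "syn 4 3 6 = 3"
  "syn 4 4 1 = 1" "syn 4 4 2 = 2" "syn 4 4 3 = 3" "syn 4 4 4 = 4" "syn 4 4 5 = 5" "syn 4 4 6 = 6"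
  "syn 4 5 1 = 5" "syn 4 5 2 = 6" "syn 4 5 3 = 4" "syn 4 5 4 = 3" "syn 4 5 5 = 1" "syn 4 5 6 = 2"
  "syn 4 6 1 = 4" "syn 4 6 2 = 3" "syn 4 6 3 = 2" "syn 4 6 4 = 1" "syn 4 6 5 = 6" "syn 4 6 6 = 5"
  "syn 5 1 1 = 6" "syn 5 1 2 = 3" "syn 5 1 3 = 2" "syn 5 1 4 = 5" "syn 5 1 5 = 4" "syn 5 1 6 = 1"
  "syn 5 2 1 = 4" "syn 5 2 2 = 5" "syn 5 2 3 = 6" "syn 5 2 4 = 1" "syn 5 2 5 = 2" "syn 5 2 6 = 3"
  "syn 5 3 1 = 3" "syn 5 3 2 = 4" "syn 5 3 3 = 1" "syn 5 3 4 = 2" "syn 5 3 5 = 6" "syn 5 3 6 = 5"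
  "syn 5 4 1 = 5" "syn 5 4 2 = 6" "syn 5 4 3 = 4" "syn 5 4 4 = 3" "syn 5 4 5 = 1" "syn 5 4 6 = 2"
  "syn 5 5 1 = 1" "syn 5 5 2 = 2" "syn 5 5 3 = 3" "syn 5 5 4 = 4" "syn 5 5 5 = 5" "syn 5 5 6 = 6"
  "syn 5 6 1 = 2" "syn 5 6 2 = 1" "syn 5 6 3 = 5" "syn 5 6 4 = 6" "syn 5 6 5 = 3" "syn 5 6 6 = 4"
  "syn 6 1 1 = 5" "syn 6 1 2 = 4" "syn 6 1 3 = 6" "syn 6 1 4 = 2" "syn 6 1 5 = 1" "syn 6 1 6 = 3"
  "syn 6 2 1 = 3" "syn 6 2 2 = 6" "syn 6 2 3 = 1" "syn 6 2 4 = 5" "syn 6 2 5 = 4" "syn 6 2 6 = 2"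
  "syn 6 3 1 = 6" "syn 6 3 2 = 5" "syn 6 3 3 = 4" "syn 6 3 4 = 3" "syn 6 3 5 = 2" "syn 6 3 6 = 1"
  "syn 6 4 1 = 4" "syn 6 4 2 = 3" "syn 6 4 3 = 2" "syn 6 4 4 = 1" "syn 6 4 5 = 6" "syn 6 4 6 = 5"
  "syn 6 5 1 = 2" "syn 6 5 2 = 1" "syn 6 5 3 = 5" "syn 6 5 4 = 6" "syn 6 5 5 = 3" "syn 6 5 6 = 4"
  "syn 6 6 1 = 1" "syn 6 6 2 = 2" "syn 6 6 3 = 3" "syn 6 6 4 = 4" "syn 6 6 5 = 5" "syn 6 6 6 = 6"
  by (simp_all add: syn_def)

lemma syn_outside: "\<not> {a, b, i} \<subseteq> {1..6} \<Longrightarrow> syn a b i = i"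
  unfolding syn_def by (rule if_not_P)

lemma syn_polarity:
  assumes "a \<in> {1..6}" "b \<in> {1..6}" "i \<in> {1..6}" "j \<in> {1..6}" "a \<noteq> b" "i \<noteq> j" "syn a b i = j"
  shows "syn i j a = b"
proof -
  have "\<forall>a\<in>{1..6}. \<forall>b\<in>{1..6}. \<forall>i\<in>{1..6}. a \<noteq> b \<longrightarrow> syn i (syn a b i) a = b"
    unfolding all6 by (simp add: syn_eqs)
  then show ?thesis using assms by blast
qed

lemma syn_syn:
  assumes "a \<in> {1..6}" "b \<in> {1..6}" shows "syn a b (syn a b i) = i"
proof (cases "i \<in> {1..6}")
  case True
  have "\<forall>a\<in>{1..6}. \<forall>b\<in>{1..6}. \<forall>i\<in>{1..6}. syn a b (syn a b i) = i"
    unfolding all6 by (simp add: syn_eqs)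
  then show ?thesis using assms True by blast
next
  case False
  then show ?thesis by (simp add: syn_outside)
qed

lemma syn_fixfree:
  assumes "a \<in> {1..6}" "b \<in> {1..6}" "i \<in> {1..6}" "a \<noteq> b"
  shows "syn a b i \<noteq> i" "syn a b i \<in> {1..6}"
proof -
  have "\<forall>a\<in>{1..6}. \<forall>b\<in>{1..6}. \<forall>i\<in>{1..6}. a \<noteq> b \<longrightarrow> syn a b i \<noteq> i \<and> syn a b i \<in> {1..6}"
    unfolding all6 by (simp add: syn_eqs)
  then show "syn a b i \<noteq> i" "syn a b i \<in> {1..6}" using assms by blast+
qed

lemma syn_permutes:
  assumes "a \<in> {1..6}" "b \<in> {1..6}" "a \<noteq> b" shows "syn a b permutes {1..6}"
proof (rule bij_imp_permutes)
  show "bij_betw (syn a b) {1..6} {1..6}"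
    using assms syn_fixfree(2) syn_syn by (intro bij_betwI[where g = "syn a b"]) auto
qed (simp add: syn_outside)

text \<open>Says that the permutation \<open>r\<close> of the points induces the permutation
  \<open>p\<close> on the totals. Keeping this as a relation makes symmetry, products and inverses
  easy before uniqueness turns it into the function \<open>outer6\<close>.\<close>

definition syn_rel :: "(nat \<Rightarrow> nat) \<Rightarrow> (nat \<Rightarrow> nat) \<Rightarrow> bool"
  where "syn_rel p r \<longleftrightarrow> p permutes {1..6} \<and> r permutes {1..6} \<and>
    (\<forall>a\<in>{1..6}. \<forall>b\<in>{1..6}. \<forall>i\<in>{1..6}. a \<noteq> b \<longrightarrow> r (syn a b i) = syn (p a) (p b) (r i))"

lemma syn_relD:
  assumes "syn_rel p r"
  shows "p permutes {1..6}" "r permutes {1..6}"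
    and "a \<in> {1..6} \<Longrightarrow> b \<in> {1..6} \<Longrightarrow> i \<in> {1..6} \<Longrightarrow> a \<noteq> b \<Longrightarrow> r (syn a b i) = syn (p a) (p b) (r i)"
  using assms unfolding syn_rel_def by blast+

text \<open>By the polarity \<open>syn_polarity\<close>, points and totals can be exchanged. This is
  why \<open>outer6\<close> has square one.\<close>

lemma syn_rel_sym:
  assumes R: "syn_rel p r" shows "syn_rel r p"
  unfolding syn_rel_def
proof (intro conjI ballI impI)
  note p = syn_relD(1)[OF R] and r = syn_relD(2)[OF R]
  show "r permutes {1..6}" "p permutes {1..6}" by (fact r, fact p)
  fix i j a :: nat
  assume i: "i \<in> {1..6}" and j: "j \<in> {1..6}" and a: "a \<in> {1..6}" and ij: "i \<noteq> j"
  let ?b = "syn i j a"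
  have b: "?b \<in> {1..6}" "a \<noteq> ?b" using syn_fixfree[OF i j a ij] by auto
  have "syn a ?b i = j" using syn_polarity[OF i j a b(1) ij b(2)] by simp
  then have "syn (p a) (p ?b) (r i) = r j" using syn_relD(3)[OF R a b(1) i b(2)] by simp
  then show "p ?b = syn (r i) (r j) (p a)"
    using syn_polarity[of "p a" "p ?b" "r i" "r j"] a b i j ij
      permutes_in_image[OF p] permutes_in_image[OF r] permutes_inject[OF p] permutes_inject[OF r]
    by (simp del: atLeastAtMost_iff)
qed

lemma syn_rel_comp:
  assumes R: "syn_rel p r" and R': "syn_rel p' r'" shows "syn_rel (p \<circ> p') (r \<circ> r')"
  unfolding syn_rel_def
proof (intro conjI ballI impI)
  note p = syn_relD(1,2)[OF R] and p' = syn_relD(1,2)[OF R']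
  show "p \<circ> p' permutes {1..6}" "r \<circ> r' permutes {1..6}"
    using p p' by (simp_all add: permutes_compose)
  fix a b i :: nat assume "a \<in> {1..6}" "b \<in> {1..6}" "i \<in> {1..6}" "a \<noteq> b"
  then show "(r \<circ> r') (syn a b i) = syn ((p \<circ> p') a) ((p \<circ> p') b) ((r \<circ> r') i)"
    using syn_relD(3)[OF R'] syn_relD(3)[OF R, of "p' a" "p' b" "r' i"]
      permutes_in_image[OF p'(1)] permutes_in_image[OF p'(2)] permutes_inject[OF p'(1)]
    by (simp del: atLeastAtMost_iff)
qed

lemma syn_rel_inv:
  assumes R: "syn_rel p r" shows "syn_rel (inv' p) (inv' r)"
  unfolding syn_rel_def
proof (intro conjI ballI impI)
  note p = syn_relD(1)[OF R] and r = syn_relD(2)[OF R]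
  note ip = permutes_inv[OF p] and ir = permutes_inv[OF r]
  show "inv' p permutes {1..6}" "inv' r permutes {1..6}" by (fact ip, fact ir)
  fix a b i :: nat assume ab: "a \<in> {1..6}" "b \<in> {1..6}" "i \<in> {1..6}" "a \<noteq> b"
  have "r (syn (inv' p a) (inv' p b) (inv' r i)) = syn a b i"
    using syn_relD(3)[OF R, of "inv' p a" "inv' p b" "inv' r i"] ab
      permutes_in_image[OF ip] permutes_in_image[OF ir] permutes_inject[OF ip]
      permutes_inv_apply(1)[OF p] permutes_inv_apply(1)[OF r]
    by (simp del: atLeastAtMost_iff)
  then have "inv' r (r (syn (inv' p a) (inv' p b) (inv' r i))) = inv' r (syn a b i)" by simp
  then show "inv' r (syn a b i) = syn (inv' p a) (inv' p b) (inv' r i)"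
    by (simp add: permutes_inv_apply(2)[OF r])
qed

lemma syn_rel_id: "syn_rel id id"
  by (simp add: syn_rel_def permutes_id)

lemma syn_rel_id_unique:
  assumes R: "syn_rel id r" shows "r = id"
proof -
  note r = syn_relD(2)[OF R]
  have e: "syn a b (r i) = r (syn a b i)" if "a \<in> {1..6}" "b \<in> {1..6}" "a \<noteq> b" "i \<in> {1..6}" for a b i
    using syn_relD(3)[OF R] that by simp
  have "r 1 \<in> {1..6}" using permutes_in_image[OF r, of 1] by simp
  \<comment> \<open>Since \<open>r\<close> commutes with the synthemes, two of them that agree at 1
    must agree at \<open>r 1\<close>. For each excluded value the chosen two agree at 1 but not
    there.\<close>
  moreover have "r 1 \<noteq> 2" using e[of 1 4 1] e[of 2 6 1] by (auto simp: syn_eqs)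
  moreover have "r 1 \<noteq> 3" using e[of 1 2 1] e[of 3 4 1] by (auto simp: syn_eqs)
  moreover have "r 1 \<noteq> 4" using e[of 1 2 1] e[of 3 4 1] by (auto simp: syn_eqs)
  moreover have "r 1 \<noteq> 5" using e[of 1 2 1] e[of 3 4 1] by (auto simp: syn_eqs)
  moreover have "r 1 \<noteq> 6" using e[of 1 2 1] e[of 3 4 1] by (auto simp: syn_eqs)
  moreover have "\<forall>x\<in>{1..6::nat}. x = 1 \<or> x = 2 \<or> x = 3 \<or> x = 4 \<or> x = 5 \<or> x = 6" unfolding all6 by simp
  ultimately have r1: "r 1 = 1" by blast
  have r': "r 2 = 2" "r 3 = 3" "r 4 = 4" "r 5 = 5" "r 6 = 6"
    using e[of 1 2 1] e[of 1 4 1] e[of 1 3 1] e[of 1 6 1] e[of 1 5 1] r1 by (simp_all add: syn_eqs)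
  have "\<forall>i\<in>{1..6}. r i = i" unfolding all6 using r1 r' by simp
  then show ?thesis using permutes_not_in[OF r] by (auto simp: fun_eq_iff simp del: atLeastAtMost_iff)
qed

lemma syn_rel_unique:
  assumes R: "syn_rel p r" and R': "syn_rel p r'" shows "r = r'"
proof -
  have "inv' p \<circ> p = id" by (rule permutes_inv_o(2)[OF syn_relD(1)[OF R]])
  then have "inv' r \<circ> r' = id"
    using syn_rel_id_unique syn_rel_comp[OF syn_rel_inv[OF R] R'] by simp
  then have "r (inv' r (r' x)) = r x" for x by (simp add: fun_eq_iff)
  then show ?thesis using permutes_inv_apply(1)[OF syn_relD(2)[OF R]] by (simp add: fun_eq_iff)
qed

text \<open>Verified on the table; transpositions through 1 suffice, because the others are
  conjugates of them.\<close>

lemma syn_rel_tr1: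
  assumes "k \<in> {1..6}" "k \<noteq> 1" shows "syn_rel (tr 1 k) (syn 1 k)"
  unfolding syn_rel_def
proof (intro conjI)
  show "tr 1 k permutes {1..6}" using assms by (intro permutes_swap_id) auto
  show "syn 1 k permutes {1..6}" using assms by (intro syn_permutes) auto
  have "\<forall>k\<in>{1..6}. k \<noteq> 1 \<longrightarrow> (\<forall>a\<in>{1..6}. \<forall>b\<in>{1..6}. \<forall>i\<in>{1..6}. a \<noteq> b \<longrightarrow>
      syn 1 k (syn a b i) = syn (tr 1 k a) (tr 1 k b) (syn 1 k i))"
    unfolding all6 by (simp add: syn_eqs Transposition.transpose_def)
  then show "\<forall>a\<in>{1..6}. \<forall>b\<in>{1..6}. \<forall>i\<in>{1..6}. a \<noteq> b \<longrightarrow>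
      syn 1 k (syn a b i) = syn (tr 1 k a) (tr 1 k b) (syn 1 k i)" using assms by blast
qed

text \<open>A syntheme is an involution without fixed points, hence odd, since an even one would fix
  two points. The general case conjugates (1 b) by (1 a).\<close>

lemma syn_rel_tr:
  assumes "a \<in> {1..6}" "b \<in> {1..6}" "a \<noteq> b"
  obtains r where "syn_rel (tr a b) r" "\<not> evenperm r" "fixed 6 r = 0"
proof -
  have odd: "\<not> evenperm (syn 1 k) \<and> fixed 6 (syn 1 k) = 0" if k: "k \<in> {1..6}" "k \<noteq> 1" for k
  proof -
    have one: "1 \<in> {1..6::nat}" by simp
    have "{i \<in> {1..6}. syn 1 k i = i} = {}" using syn_fixfree(1)[OF one k(1) _ k(2)[symmetric]] by blast
    then have f: "fixed 6 (syn 1 k) = 0" by (simp add: fixed_def)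
    moreover have "syn 1 k \<noteq> id" using syn_fixfree(1)[OF one k(1) one k(2)[symmetric]] by (auto simp: fun_eq_iff)
    moreover have "syn 1 k \<circ> syn 1 k = id" using syn_syn[OF one k(1)] by (simp add: fun_eq_iff)
    ultimately show ?thesis using fixed_even_involution[OF syn_permutes[OF one k(1) k(2)[symmetric]]] by auto
  qed
  consider "a = 1" | "b = 1" | "a \<noteq> 1" "b \<noteq> 1" by blast
  then show ?thesis
  proof cases
    case 1
    then show ?thesis using that[of "syn 1 b"] syn_rel_tr1[of b] odd[of b] assms by simp
  next
    case 2
    have "tr a b = tr b a" by (rule transpose_commute)
    then show ?thesis using 2 that[of "syn 1 a"] syn_rel_tr1[of a] odd[of a] assms by simp
  next
    case 3
    have eq: "tr 1 a \<circ> tr 1 b \<circ> inv' (tr 1 a) = tr a b"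
      using 3 assms(3) by (auto simp: fun_eq_iff Transposition.transpose_def)
    have ra: "syn_rel (tr 1 a) (syn 1 a)" and rb: "syn_rel (tr 1 b) (syn 1 b)"
      using syn_rel_tr1 assms 3 by blast+
    note pa = syn_relD(2)[OF ra] and pb = syn_relD(2)[OF rb]
    have "syn_rel (tr a b) (syn 1 a \<circ> syn 1 b \<circ> inv' (syn 1 a))"
      using syn_rel_comp[OF syn_rel_comp[OF ra rb] syn_rel_inv[OF ra]] unfolding eq .
    moreover have "\<not> evenperm (syn 1 a \<circ> syn 1 b \<circ> inv' (syn 1 a))"
      using odd[of a] odd[of b] assms 3 evenperm_compose_permutes[OF permutes_compose[OF pb pa] permutes_inv[OF pa]]
        evenperm_compose_permutes[OF pa pb] evenperm_inv_permutes[OF pa] by simp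
    moreover have "fixed 6 (syn 1 a \<circ> syn 1 b \<circ> inv' (syn 1 a)) = 0"
      using fixed_conj[OF pa, of "syn 1 b"] odd[of b] assms 3 by simp
    ultimately show ?thesis by (rule that)
  qed
qed

text \<open>Induction over products of transpositions. Parity is carried along so that
  \<open>outer6\<close> restricts to A6.\<close>

lemma syn_rel_ex:
  assumes "p permutes {1..6}"
  shows "\<exists>r. syn_rel p r \<and> (evenperm r \<longleftrightarrow> evenperm p)"
  using assms finite_atLeastAtMost
proof (induction rule: permutes_induct)
  case id
  show ?case using syn_rel_id by blast
next
  case (swap a b p)
  obtain r where r: "syn_rel p r" "evenperm r \<longleftrightarrow> evenperm p" using swap.IH by blast
  obtain t where t: "syn_rel (tr a b) t" "\<not> evenperm t" using syn_rel_tr[OF swap.hyps(1-3)] by blast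
  have "syn_rel (tr a b \<circ> p) (t \<circ> r)" by (rule syn_rel_comp[OF t(1) r(1)])
  moreover have "evenperm (t \<circ> r) \<longleftrightarrow> evenperm (tr a b \<circ> p)"
    using evenperm_compose_permutes[OF syn_relD(2)[OF t(1)] syn_relD(2)[OF r(1)]]
      evenperm_compose_permutes[OF syn_relD(1)[OF t(1)] syn_relD(1)[OF r(1)]] t(2) r(2) swap.hyps(3)
    by (simp add: evenperm_transpose)
  ultimately show ?case by blast
qed

definition outer6 :: "(nat \<Rightarrow> nat) \<Rightarrow> nat \<Rightarrow> nat"
  where "outer6 p = (THE r. syn_rel p r)"

lemma outer6_eq: "syn_rel p r \<Longrightarrow> outer6 p = r"
  unfolding outer6_def by (rule the_equality) (auto intro: syn_rel_unique)

lemma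
  assumes "p permutes {1..6}"
  shows syn_rel_outer6: "syn_rel p (outer6 p)"
    and evenperm_outer6: "evenperm (outer6 p) \<longleftrightarrow> evenperm p"
proof -
  obtain r where r: "syn_rel p r" "evenperm r \<longleftrightarrow> evenperm p" using syn_rel_ex[OF assms] by blast
  then show "syn_rel p (outer6 p)" "evenperm (outer6 p) \<longleftrightarrow> evenperm p" using outer6_eq[OF r(1)] by simp_all
qed

lemma outer6_permutes: "p permutes {1..6} \<Longrightarrow> outer6 p permutes {1..6}"
  by (rule syn_relD(2)[OF syn_rel_outer6])

lemma outer6_comp: "p permutes {1..6} \<Longrightarrow> r permutes {1..6} \<Longrightarrow> outer6 (p \<circ> r) = outer6 p \<circ> outer6 r"
  by (intro outer6_eq syn_rel_comp syn_rel_outer6)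

lemma outer6_outer6: "p permutes {1..6} \<Longrightarrow> outer6 (outer6 p) = p"
  by (rule outer6_eq[OF syn_rel_sym[OF syn_rel_outer6]])

text \<open>Shows that \<open>outer6\<close> is not a conjugation, as conjugation would preserve the
  three fixed points.\<close>

lemma fixed_outer6_cyc: "fixed 6 (outer6 (cyc 1 2 3)) = 0"
proof -
  have "cyc 1 2 3 = tr 1 3 \<circ> tr 1 2" by (auto simp: fun_eq_iff cyc_def Transposition.transpose_def)
  moreover have "syn_rel (tr 1 3 \<circ> tr 1 2) (syn 1 3 \<circ> syn 1 2)"
    by (intro syn_rel_comp syn_rel_tr1) auto
  ultimately have "outer6 (cyc 1 2 3) = syn 1 3 \<circ> syn 1 2" by (simp only: outer6_eq)
  moreover have "\<forall>i\<in>{1..6}. syn 1 3 (syn 1 2 i) \<noteq> i" unfolding all6 by (simp add: syn_eqs)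
  then have "{i \<in> {1..6}. (syn 1 3 \<circ> syn 1 2) i = i} = {}" by auto
  ultimately show ?thesis by (simp add: fixed_def)
qed

section \<open>The twisted codes of S6 and A6 on six points\<close>

section \<open>The codes of the symmetric and alternating group of degree six\<close>

lemma outer_involution_iff:
  assumes T: "T = Sym 6 \<or> T = Alt 6"
  shows "outer_involution (Sym 6) T \<phi> \<longleftrightarrow> \<phi> \<in> iso T T \<and>
    \<not> (\<exists>s. s permutes {1..6} \<and> (\<forall>g\<in>carrier T. \<phi> g = s \<circ> g \<circ> inv' s)) \<and> (\<forall>g\<in>carrier T. \<phi> (\<phi> g) = g)"
proof -
  have "(\<forall>g\<in>carrier T. \<phi> g = inv\<^bsub>Sym 6\<^esub> s \<otimes>\<^bsub>Sym 6\<^esub> g \<otimes>\<^bsub>Sym 6\<^esub> s) \<longleftrightarrow> (\<forall>g\<in>carrier T. \<phi> g = s \<circ> g \<circ> inv' s)"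
    if "s permutes {1..6}" for s
    using that by (simp add: inv_Sym mult_Sym comp_assoc)
  then show ?thesis unfolding outer_involution_def by (auto simp: carrier_Sym)
qed

lemma six_hom_iso:
  assumes T: "T = Sym 6 \<or> T = Alt 6" and \<phi>: "\<phi> \<in> iso T T"
  shows "six_hom (carrier T) \<phi>"
proof
  have hom: "\<phi> \<in> hom T T" and bij: "bij_betw \<phi> (carrier T) (carrier T)" using \<phi> by (auto simp: iso_def)
  have mult: "x \<otimes>\<^bsub>T\<^esub> y = y \<circ> x" for x y using T mult_Sym mult_Alt by metis
  have perm: "p permutes {1..6}" if "p \<in> carrier T" for p using T that by (auto simp: carrier_Sym carrier_Alt)
  show "p \<in> carrier T" if "p permutes {1..6}" "evenperm p" for p
    using T that by (auto simp: carrier_Sym carrier_Alt)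
  show "p permutes {1..6}" if "p \<in> carrier T" for p by (rule perm[OF that])
  show "p \<circ> r \<in> carrier T" if "p \<in> carrier T" "r \<in> carrier T" for p r
    using T that by (auto simp: carrier_Sym carrier_Alt permutes_compose evenperm_compose_permutes)
  show "inv' p \<in> carrier T" if "p \<in> carrier T" for p
    using T that by (auto simp: carrier_Sym carrier_Alt permutes_inv evenperm_inv_permutes)
  show "\<phi> p permutes {1..6}" if "p \<in> carrier T" for p
    using bij that perm by (auto simp: bij_betw_def)
  show "\<phi> (p \<circ> r) = \<phi> p \<circ> \<phi> r" if "p \<in> carrier T" "r \<in> carrier T" for p r
    using hom_mult[OF hom that(2,1)] unfolding mult .
  show "p = r" if "p \<in> carrier T" "r \<in> carrier T" "\<phi> p = \<phi> r" for p r
    using bij that by (auto simp: bij_betw_def inj_on_def)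
qed

text \<open>Here \<open>m\<close> is the largest number of points fixed by a nonidentity element. It
  governs both repetition codes, because \<open>\<phi>\<close> permutes \<open>T\<close>. The
  element \<open>u\<close> attains the bound four of \<open>fixed_add_fixed_\<phi>_le\<close>, so
  that 12 - 4 = 8.\<close>

lemma outer_involution_codes:
  assumes T: "T = Sym 6 \<or> T = Alt 6" and o: "outer_involution (Sym 6) T \<phi>"
    and m: "t \<in> carrier T" "fixed 6 t = m" "m < 6"
      "\<And>g. g \<in> carrier T \<Longrightarrow> g \<noteq> id \<Longrightarrow> fixed 6 g \<le> m"
    and u: "u \<in> carrier T" "u \<noteq> id" "fixed 6 u + fixed 6 (\<phi> u) \<ge> 4"
  shows "delta_rep T 6 [id, \<phi>] = 2 * (6 - m)" "delta_tw T 6 [id, \<phi>] = 8"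
proof -
  have o': "\<phi> \<in> iso T T" "\<not> (\<exists>s. s permutes {1..6} \<and> (\<forall>g\<in>carrier T. \<phi> g = s \<circ> g \<circ> inv' s))"
    "\<And>g. g \<in> carrier T \<Longrightarrow> \<phi> (\<phi> g) = g" using o outer_involution_iff[OF T] by blast+
  interpret six_hom "carrier T" \<phi> by (rule six_hom_iso[OF T o'(1)])
  have ne: "fixed 6 (\<phi> (cyc 1 2 3)) \<noteq> 3" using conj_if_fixed_3 o'(2) by blast
  have cl: "\<phi> g \<in> carrier T" if "g \<in> carrier T" for g
    using o'(1) that by (auto simp: iso_def bij_betw_def)
  have le4: "fixed 6 g + fixed 6 (\<phi> g) \<le> 4" if "g \<in> carrier T" "g \<noteq> id" for g
    using fixed_add_fixed_\<phi>_le[OF ne _ that] cl o'(3) by blast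
  have G: "group T" using T group_Sym group_Alt by blast
  have mult: "x \<otimes>\<^bsub>T\<^esub> y = y \<circ> x" for x y using T mult_Sym mult_Alt by metis
  have hom: "id \<in> hom T (Sym 6)" "\<phi> \<in> hom T (Sym 6)"
    using G_perm \<phi>_perm \<phi>_comp by (auto simp: hom_def carrier_Sym mult mult_Sym)
  have rep: "delta_tw T 6 (replicate 2 \<rho>) = 2 * (6 - m)"
    if \<rho>: "\<rho> \<in> hom T (Sym 6)" and t': "t' \<in> carrier T" "\<rho> t' = t"
      and cl': "\<And>g. g \<in> carrier T \<Longrightarrow> \<rho> g \<in> carrier T" for \<rho> t'
  proof (rule delta_tw_eqI[OF G _ t'(1)])
    show "set (replicate 2 \<rho>) \<subseteq> hom T (Sym 6)" using \<rho> by auto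
    show "weight 6 (replicate 2 \<rho>) t' = 2 * (6 - m)"
      using m(2) t'(2) by (simp add: weight_replicate moved_eq)
    show "0 < 2 * (6 - m)" using m(3) by simp
    fix g assume "g \<in> carrier T"
    then have g: "\<rho> g \<in> carrier T" by (rule cl')
    show "weight 6 (replicate 2 \<rho>) g = 0 \<or> 2 * (6 - m) \<le> weight 6 (replicate 2 \<rho>) g"
    proof (cases "\<rho> g = id")
      case True
      then show ?thesis by (simp add: weight_replicate moved_eq fixed_id)
    next
      case False
      then have "6 - m \<le> 6 - fixed 6 (\<rho> g)" using m(4)[OF g] by (intro diff_le_mono2)
      then show ?thesis by (simp add: weight_replicate moved_eq)
    qed
  qed
  have "delta_tw T 6 (replicate 2 id) = 2 * (6 - m)" by (rule rep[OF hom(1) m(1)]) simp_all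
  moreover have "delta_tw T 6 (replicate 2 \<phi>) = 2 * (6 - m)"
  proof (rule rep[OF hom(2) cl[OF m(1)]])
    show "\<phi> (\<phi> t) = t" by (rule o'(3)[OF m(1)])
    show "\<phi> g \<in> carrier T" if "g \<in> carrier T" for g by (rule cl[OF that])
  qed
  ultimately show "delta_rep T 6 [id, \<phi>] = 2 * (6 - m)"
    unfolding delta_rep_eq by (simp add: numeral_2_eq_2)
  show "delta_tw T 6 [id, \<phi>] = 8"
  proof (rule delta_tw_eqI[OF G _ u(1)])
    show "set [id, \<phi>] \<subseteq> hom T (Sym 6)" using hom by simp
    show "weight 6 [id, \<phi>] u = 8"
      using u(3) le4[OF u(1,2)] fixed_le[of 6 u] fixed_le[of 6 "\<phi> u"] by (simp add: weight_def moved_eq)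
    fix g assume g: "g \<in> carrier T"
    show "weight 6 [id, \<phi>] g = 0 \<or> 8 \<le> weight 6 [id, \<phi>] g"
    proof (cases "g = id")
      case True
      then show ?thesis by (simp add: weight_def moved_eq fixed_id \<phi>_id)
    next
      case False
      then show ?thesis using le4[OF g] by (simp add: weight_def moved_eq)
    qed
  qed simp
qed

lemma fixed_tr:
  assumes "a \<in> {1..6}" "b \<in> {1..6}" "a \<noteq> b" shows "fixed 6 (tr a b) = 4"
proof -
  have "{i \<in> {1..6}. tr a b i \<noteq> i} = {a, b}" using assms by (auto simp: Transposition.transpose_def)
  then have "moved 6 (tr a b) = 2" using assms(3) by (simp add: moved_def)
  then show ?thesis using fixed_add_moved[of 6 "tr a b"] by simp
qed

lemma tr12_permutes: "tr 1 2 permutes {1..6}"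
  by (rule permutes_swap_id) auto

text \<open>A transposition is extremal for both distances: four fixed points of its own, none for
  its image.\<close>

lemma Sym6_codes:
  assumes "outer_involution (Sym 6) (Sym 6) \<phi>"
  shows "delta_rep (Sym 6) 6 [id, \<phi>] = 4 \<and> delta_tw (Sym 6) 6 [id, \<phi>] = 8"
proof -
  have c: "tr 1 2 \<in> carrier (Sym 6)" using tr12_permutes by (simp add: carrier_Sym)
  have f: "fixed 6 (tr 1 2) = 4" by (rule fixed_tr) auto
  then have n: "tr 1 2 \<noteq> id" using fixed_id[of 6] by auto
  have "fixed 6 g \<le> 4" if "g \<in> carrier (Sym 6)" "g \<noteq> id" for g
    using fixed_le_4[of g] that by (simp add: carrier_Sym)
  from outer_involution_codes[OF disjI1[OF refl] assms c f _ this c n] f show ?thesis by simp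
qed

lemma Alt6_codes:
  assumes o: "outer_involution (Sym 6) (Alt 6) \<phi>"
  shows "delta_rep (Alt 6) 6 [id, \<phi>] = 6 \<and> delta_tw (Alt 6) 6 [id, \<phi>] = 8"
proof -
  have T: "Alt 6 = Sym 6 \<or> Alt 6 = Alt 6" by simp
  have o': "\<phi> \<in> iso (Alt 6) (Alt 6)" using o outer_involution_iff[OF T] by blast
  interpret six_hom "carrier (Alt 6)" \<phi> by (rule six_hom_iso[OF T o'])
  have d: "distinct [1, 2, 3::nat]" "{1, 2, 3} \<subseteq> {1..6::nat}" by auto
  have c: "cyc 1 2 3 \<in> carrier (Alt 6)" by (rule cyc_G[OF d])
  have f: "fixed 6 (cyc 1 2 3) = 3" by (rule fixed_cyc[OF d])
  have m: "fixed 6 g \<le> 3" if g: "g \<in> carrier (Alt 6)" "g \<noteq> id" for g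
  proof -
    have p: "g permutes {1..6}" "evenperm g" using g(1) by (auto simp: carrier_Alt)
    have "fixed 6 g \<noteq> 4"
    proof
      assume "fixed 6 g = 4"
      then obtain a b where "a \<noteq> b" "g = tr a b" using fixed_4_transpose[OF p(1)] by blast
      then show False using p(2) by (simp add: evenperm_transpose)
    qed
    then show ?thesis using fixed_le_4[OF p(1) g(2)] by simp
  qed
  \<comment> \<open>Three-cycles are extremal for the repetition codes but give only 3 + 0 fixed
    points in the twisted code. A product of two disjoint transpositions gives 2 + 2, its image
    being an even involution as well.\<close>
  let ?u = "tr 1 2 \<circ> tr 3 4"
  have t34: "tr 3 4 permutes {1..6}" by (rule permutes_swap_id) auto
  have up: "?u permutes {1..6}" by (rule permutes_compose[OF t34 tr12_permutes])
  have ev: "evenperm ?u" using evenperm_compose_permutes[OF tr12_permutes t34] by (simp add: evenperm_transpose)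
  have u: "?u \<in> carrier (Alt 6)" using up ev by (simp add: carrier_Alt)
  have n: "?u \<noteq> id"
  proof
    assume "?u = id"
    then have "?u 1 = 1" by simp
    then show False by (simp add: Transposition.transpose_def)
  qed
  have uu: "?u \<circ> ?u = id" by (auto simp: fun_eq_iff Transposition.transpose_def)
  have "fixed 6 ?u = 2" by (rule fixed_even_involution[OF up n uu ev])
  moreover have "fixed 6 (\<phi> ?u) = 2"
  proof (rule fixed_even_involution[OF \<phi>_perm[OF u]])
    show "\<phi> ?u \<noteq> id" using \<phi>_eq_id[OF u] n by blast
    show "\<phi> ?u \<circ> \<phi> ?u = id" using \<phi>_comp[OF u u] uu \<phi>_id by simp
    have "\<phi> ?u \<in> carrier (Alt 6)" using o' u by (auto simp: iso_def hom_def)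
    then show "evenperm (\<phi> ?u)" by (simp add: carrier_Alt)
  qed
  ultimately have "4 \<le> fixed 6 ?u + fixed 6 (\<phi> ?u)" by simp
  from outer_involution_codes[OF T o c f _ m u n this] show ?thesis by simp
qed

lemma outer6_outer_involution:
  assumes T: "T = Sym 6 \<or> T = Alt 6"
  shows "outer_involution (Sym 6) T outer6"
  unfolding outer_involution_iff[OF T]
proof (intro conjI ballI notI)
  have p: "g permutes {1..6}" if "g \<in> carrier T" for g using T that by (auto simp: carrier_Sym carrier_Alt)
  have cl: "outer6 g \<in> carrier T" if "g \<in> carrier T" for g
    using T that by (auto simp: carrier_Sym carrier_Alt outer6_permutes evenperm_outer6)
  show inv: "outer6 (outer6 g) = g" if "g \<in> carrier T" for g by (rule outer6_outer6[OF p[OF that]])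
  have "x \<otimes>\<^bsub>T\<^esub> y = y \<circ> x" for x y using T mult_Sym mult_Alt by metis
  then have "outer6 \<in> hom T T" using cl p by (intro homI) (simp_all add: outer6_comp)
  moreover have "bij_betw outer6 (carrier T) (carrier T)"
    using cl inv by (intro bij_betwI[where g = outer6]) auto
  ultimately show "outer6 \<in> iso T T" by (simp add: iso_def)
  assume "\<exists>s. s permutes {1..6} \<and> (\<forall>g\<in>carrier T. outer6 g = s \<circ> g \<circ> inv' s)"
  then obtain s where s: "s permutes {1..6}" "\<forall>g\<in>carrier T. outer6 g = s \<circ> g \<circ> inv' s" by blast
  have d: "distinct [1, 2, 3::nat]" "{1, 2, 3} \<subseteq> {1..6::nat}" by auto
  have "cyc 1 2 3 \<in> carrier T"
    using T cyc_permutes[OF d] evenperm_cyc[OF d(1)] by (auto simp: carrier_Sym carrier_Alt)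
  then have "fixed 6 (outer6 (cyc 1 2 3)) = fixed 6 (cyc 1 2 3)" using fixed_conj[OF s(1)] s(2) by simp
  then show False using fixed_outer6_cyc fixed_cyc[OF d] by simp
qed

declare One_nat_def [simp del]

section \<open>Concrete models for the cosets of two subgroups of order twelve and of their outer
  images\<close>

section \<open>Fixed points on the cosets of the subgroups of order twelve\<close>

definition A4 :: "(nat \<Rightarrow> nat) set"
  where "A4 = {p. p permutes {1..6} \<and> p 5 = 5 \<and> p 6 = 6 \<and> evenperm p}"

text \<open>The product of the symmetric groups on {1, 2, 3} and {4, 5}, a dihedral group of order
  twelve.\<close>

definition D12 :: "(nat \<Rightarrow> nat) set"
  where "D12 = {p. p permutes {1..6} \<and> p 6 = 6 \<and> p ` {4, 5} = {4, 5}}"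

text \<open>A coset of \<open>A4\<close> amounts to the images of 5 and 6 together with a sign. An
  even permutation fixes the ordered pairs of distinct fixed points, each with either sign; an odd
  one changes every sign.\<close>

definition fixA :: "(nat \<Rightarrow> nat) \<Rightarrow> nat"
  where "fixA t = (if evenperm t then 2 * (fixed 6 t * (fixed 6 t - 1)) else 0)"

definition swapped :: "(nat \<Rightarrow> nat) \<Rightarrow> nat set set"
  where "swapped t = {S. S \<subseteq> {1..6} \<and> card S = 2 \<and> t ` S = S \<and> (\<forall>x\<in>S. t x \<noteq> x)}"

text \<open>A coset of \<open>D12\<close> amounts to a point and a pair avoiding it. If both are
  invariant, the point is fixed and the pair consists of two other fixed points or is
  interchanged.\<close>

definition fixD :: "(nat \<Rightarrow> nat) \<Rightarrow> nat"
  where "fixD t = fixed 6 t * (((fixed 6 t - 1) choose 2) + card (swapped t))"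

text \<open>\<open>coset_map H f m\<close>: the map \<open>f\<close> identifies the cosets of \<open>H\<close> with a set on which \<open>t\<close> acts
  by \<open>m t\<close>.\<close>

definition coset_map :: "(nat \<Rightarrow> nat) set \<Rightarrow> ((nat \<Rightarrow> nat) \<Rightarrow> 'c) \<Rightarrow> ((nat \<Rightarrow> nat) \<Rightarrow> 'c \<Rightarrow> 'c) \<Rightarrow> bool"
  where "coset_map H f m \<longleftrightarrow>
    (\<forall>g g'. g permutes {1..6} \<longrightarrow> g' permutes {1..6} \<longrightarrow> (f g = f g' \<longleftrightarrow> inv' g \<circ> g' \<in> H)) \<and>
    (\<forall>g t. g permutes {1..6} \<longrightarrow> t permutes {1..6} \<longrightarrow> f (t \<circ> g) = m t (f g))"

lemma coset_mapD:
  assumes "coset_map H f m"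
  shows "g permutes {1..6} \<Longrightarrow> g' permutes {1..6} \<Longrightarrow> f g = f g' \<longleftrightarrow> inv' g \<circ> g' \<in> H"
    and "g permutes {1..6} \<Longrightarrow> t permutes {1..6} \<Longrightarrow> f (t \<circ> g) = m t (f g)"
  using assms unfolding coset_map_def by blast+

lemma Sym_conjugate_iff:
  assumes "H \<subseteq> carrier (Sym q)"
  shows "conjugate (Sym q) H K \<longleftrightarrow> (\<exists>g. g permutes {1..q} \<and> K = (\<lambda>h. g \<circ> h \<circ> inv' g) ` H)"
proof -
  have "(\<lambda>h. inv\<^bsub>Sym q\<^esub> g \<otimes>\<^bsub>Sym q\<^esub> h \<otimes>\<^bsub>Sym q\<^esub> g) ` H = (\<lambda>h. g \<circ> h \<circ> inv' g) ` H" if "g permutes {1..q}" for g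
    using that by (simp add: inv_Sym mult_Sym comp_assoc)
  then show ?thesis
    using conjugate_iff[OF group_Sym assms, of K] by (auto simp: carrier_Sym)
qed

text \<open>If \<open>K\<close> is the conjugate of \<open>H\<close> by \<open>k\<close>, then
  \<open>g \<mapsto> f (g \<circ> k)\<close> separates the cosets of \<open>K\<close> and has the
  same image and action as \<open>f\<close>; counts therefore depend only on the class.\<close>

lemma fixed_coset_map:
  assumes c: "coset_map H f m" and H: "H \<subseteq> carrier (Sym 6)"
    and K: "conjugate (Sym 6) H K" "subgroup K (Sym 6)" and l: "labelling (Sym 6) K q l"
    and t: "t permutes {1..6}"
  shows "fixed q (coset_rep (Sym 6) q l t) = card {y \<in> f ` {g. g permutes {1..6}}. m t y = y}"
proof -
  obtain k where k: "k permutes {1..6}" "K = (\<lambda>h. k \<circ> h \<circ> inv' k) ` H"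
    using K(1) Sym_conjugate_iff[OF H] by blast
  note kb = permutes_bij[OF k(1)]
  have memK: "p \<in> K \<longleftrightarrow> inv' k \<circ> p \<circ> k \<in> H" for p
  proof
    assume "p \<in> K"
    then obtain h where h: "h \<in> H" "p = k \<circ> h \<circ> inv' k" using k(2) by blast
    have "inv' k \<circ> p \<circ> k = h" by (simp add: h(2) fun_eq_iff permutes_inverses[OF k(1)])
    then show "inv' k \<circ> p \<circ> k \<in> H" using h(1) by simp
  next
    assume "inv' k \<circ> p \<circ> k \<in> H"
    moreover have "p = k \<circ> (inv' k \<circ> p \<circ> k) \<circ> inv' k" by (simp add: fun_eq_iff permutes_inverses[OF k(1)])
    ultimately show "p \<in> K" unfolding k(2) by blast
  qed
  have "fixed q (coset_rep (Sym 6) q l t) = card {y \<in> (\<lambda>g. f (g \<circ> k)) ` carrier (Sym 6). m t y = y}"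
  proof (rule fixed_coset_rep[OF group_Sym K(2) l])
    show "t \<in> carrier (Sym 6)" using t by (simp add: carrier_Sym)
  next
    fix g g' assume "g \<in> carrier (Sym 6)" "g' \<in> carrier (Sym 6)"
    then have g: "g permutes {1..6}" "g' permutes {1..6}" by (simp_all add: carrier_Sym)
    have "f (g \<circ> k) = f (g' \<circ> k) \<longleftrightarrow> inv' (g \<circ> k) \<circ> (g' \<circ> k) \<in> H"
      using g k(1) by (intro coset_mapD(1)[OF c] permutes_compose)
    also have "inv' (g \<circ> k) \<circ> (g' \<circ> k) = inv' k \<circ> (inv' g \<circ> g') \<circ> k"
      using permutes_bij[OF g(1)] kb by (simp add: o_inv_distrib o_assoc)
    finally have "f (g \<circ> k) = f (g' \<circ> k) \<longleftrightarrow> inv' k \<circ> (inv' g \<circ> g') \<circ> k \<in> H" .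
    moreover have "g' \<otimes>\<^bsub>Sym 6\<^esub> inv\<^bsub>Sym 6\<^esub> g = inv' g \<circ> g'" by (simp only: mult_Sym inv_Sym[OF g(1)])
    ultimately show "f (g \<circ> k) = f (g' \<circ> k) \<longleftrightarrow> g' \<otimes>\<^bsub>Sym 6\<^esub> inv\<^bsub>Sym 6\<^esub> g \<in> K"
      by (simp only: memK)
  next
    fix g assume "g \<in> carrier (Sym 6)"
    then show "f ((g \<otimes>\<^bsub>Sym 6\<^esub> t) \<circ> k) = m t (f (g \<circ> k))"
      using coset_mapD(2)[OF c permutes_compose[OF k(1)] t] by (simp add: carrier_Sym mult_Sym comp_assoc)
  qed
  also have "(\<lambda>g. f (g \<circ> k)) ` carrier (Sym 6) = f ` {g. g permutes {1..6}}"
  proof (intro equalityI subsetI)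
    fix y assume "y \<in> f ` {g. g permutes {1..6}}"
    then obtain g where g: "g permutes {1..6}" "y = f g" by blast
    have "y = f ((g \<circ> inv' k) \<circ> k)" using g(2) by (simp add: comp_assoc permutes_inv_o(2)[OF k(1)])
    moreover have "g \<circ> inv' k \<in> carrier (Sym 6)"
      using permutes_compose[OF permutes_inv[OF k(1)] g(1)] by (simp add: carrier_Sym)
    ultimately show "y \<in> (\<lambda>g. f (g \<circ> k)) ` carrier (Sym 6)" by blast
  qed (use permutes_compose[OF k(1)] in \<open>auto simp: carrier_Sym\<close>)
  finally show ?thesis .
qed

text \<open>Transport along the automorphism: the models for \<open>A4\<close> and
  \<open>D12\<close>, read through \<open>outer6\<close>, serve the other two classes.\<close>

lemma coset_map_outer6:
  assumes c: "coset_map H f m" and H: "H \<subseteq> {p. p permutes {1..6}}"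
  shows "coset_map (outer6 ` H) (\<lambda>g. f (outer6 g)) (\<lambda>t. m (outer6 t))"
  unfolding coset_map_def
proof (intro conjI allI impI)
  fix g g' :: "nat \<Rightarrow> nat" assume g: "g permutes {1..6}" "g' permutes {1..6}"
  have i: "outer6 (inv' g) = inv' (outer6 g)"
    by (rule outer6_eq[OF syn_rel_inv[OF syn_rel_outer6[OF g(1)]]])
  have p: "inv' g \<circ> g' permutes {1..6}" by (rule permutes_compose[OF g(2) permutes_inv[OF g(1)]])
  have "f (outer6 g) = f (outer6 g') \<longleftrightarrow> outer6 (inv' g \<circ> g') \<in> H"
    using coset_mapD(1)[OF c outer6_permutes[OF g(1)] outer6_permutes[OF g(2)]]
      outer6_comp[OF permutes_inv[OF g(1)] g(2)] i by simp
  also have "\<dots> \<longleftrightarrow> inv' g \<circ> g' \<in> outer6 ` H"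
  proof
    assume "outer6 (inv' g \<circ> g') \<in> H"
    then show "inv' g \<circ> g' \<in> outer6 ` H" using outer6_outer6[OF p] by (metis imageI)
  next
    assume "inv' g \<circ> g' \<in> outer6 ` H"
    then obtain h where "h \<in> H" "inv' g \<circ> g' = outer6 h" by blast
    then show "outer6 (inv' g \<circ> g') \<in> H" using outer6_outer6[of h] H by auto
  qed
  finally show "f (outer6 g) = f (outer6 g') \<longleftrightarrow> inv' g \<circ> g' \<in> outer6 ` H" .
next
  fix g t :: "nat \<Rightarrow> nat" assume "g permutes {1..6}" "t permutes {1..6}"
  then show "f (outer6 (t \<circ> g)) = m (outer6 t) (f (outer6 g))"
    using coset_mapD(2)[OF c outer6_permutes outer6_permutes] by (simp add: outer6_comp)
qed

lemma image_outer6: "(\<lambda>g. f (outer6 g)) ` {g. g permutes {1..6}} = f ` {g. g permutes {1..6}}"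
proof (intro equalityI subsetI)
  fix y assume "y \<in> f ` {g. g permutes {1..6}}"
  then obtain g where g: "g permutes {1..6}" "y = f g" by blast
  then show "y \<in> (\<lambda>g. f (outer6 g)) ` {g. g permutes {1..6}}"
    using outer6_outer6[OF g(1)] outer6_permutes[OF g(1)] by (intro image_eqI[of _ _ "outer6 g"]) simp_all
qed (use outer6_permutes in auto)

lemma inv_comp_apply_iff:
  assumes "g permutes S" shows "(inv' g \<circ> g') x = x \<longleftrightarrow> g x = g' x"
  using permutes_inv_eq[OF assms, of "g' x" x] by auto

lemma coset_map_A4:
  "coset_map A4 (\<lambda>g. (g 5, g 6, evenperm g)) (\<lambda>t (a, b, e). (t a, t b, evenperm t = e))"
  unfolding coset_map_def
proof (intro conjI allI impI)
  fix g g' :: "nat \<Rightarrow> nat" assume g: "g permutes {1..6}" "g' permutes {1..6}"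
  show "(g 5, g 6, evenperm g) = (g' 5, g' 6, evenperm g') \<longleftrightarrow> inv' g \<circ> g' \<in> A4"
    unfolding A4_def mem_Collect_eq inv_comp_apply_iff[OF g(1)]
    using permutes_compose[OF g(2) permutes_inv[OF g(1)]]
      evenperm_compose_permutes[OF permutes_inv[OF g(1)] g(2)] evenperm_inv_permutes[OF g(1)] by auto
qed (simp add: evenperm_compose_permutes)

lemma image_comp_inv_iff:
  assumes "p permutes S" shows "image (inv' p \<circ> r) V = V \<longleftrightarrow> image p V = image r V"
proof
  assume "image (inv' p \<circ> r) V = V"
  then have "image p (image (inv' p \<circ> r) V) = image p V" by simp
  then show "image p V = image r V" by (simp add: image_image permutes_inverses[OF assms])
next
  assume "image p V = image r V"
  then have "image (inv' p) (image r V) = image (inv' p) (image p V)" by simp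
  then show "image (inv' p \<circ> r) V = V" by (simp add: image_image image_comp[symmetric] permutes_inverses[OF assms])
qed

lemma coset_map_D12:
  "coset_map D12 (\<lambda>g. (g 6, g ` {4, 5})) (\<lambda>t (x, S). (t x, t ` S))"
  unfolding coset_map_def
proof (intro conjI allI impI)
  fix g g' :: "nat \<Rightarrow> nat" assume g: "g permutes {1..6}" "g' permutes {1..6}"
  show "(g 6, g ` {4, 5}) = (g' 6, g' ` {4, 5}) \<longleftrightarrow> inv' g \<circ> g' \<in> D12"
    unfolding D12_def mem_Collect_eq inv_comp_apply_iff[OF g(1)] image_comp_inv_iff[OF g(1)]
    using permutes_compose[OF g(2) permutes_inv[OF g(1)]] by simp
qed (simp add: image_image)

lemma perm_ex:
  assumes "distinct [a, b, c]" "{a, b, c} \<subseteq> {1..6::nat}" "distinct [x, y, z]" "{x, y, z} \<subseteq> {1..6::nat}"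
  obtains h where "h permutes {1..6}" "h x = a" "h y = b" "h z = c"
proof -
  obtain h where h: "h permutes {1..6}" "h 1 = a" "h 2 = b" "h 3 = c" using even_perm_ex[OF assms(1,2)] by blast
  obtain k where k: "k permutes {1..6}" "k 1 = x" "k 2 = y" "k 3 = z" using even_perm_ex[OF assms(3,4)] by blast
  have i: "inv' k x = 1" "inv' k y = 2" "inv' k z = 3"
    using k(2-4) permutes_inv_eq[OF k(1)] by auto
  show ?thesis
    by (rule that[of "h \<circ> inv' k"]) (use permutes_compose[OF permutes_inv[OF k(1)] h(1)] h i in simp_all)
qed

lemma card_off_diagonal:
  assumes "finite V" shows "card {(a, b). a \<in> V \<and> b \<in> V \<and> a \<noteq> b} = card V * (card V - 1)"
proof -
  have "{(a, b). a \<in> V \<and> b \<in> V \<and> a \<noteq> b} = (SIGMA a:V. V - {a})" by auto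
  then show ?thesis using assms by simp
qed

lemma image_A4:
  "(\<lambda>g. (g 5, g 6, evenperm g)) ` {g. g permutes {1..6}} = {(a, b, e). a \<in> {1..6} \<and> b \<in> {1..6::nat} \<and> a \<noteq> b}"
proof (intro equalityI subsetI)
  fix y :: "nat \<times> nat \<times> bool" assume "y \<in> {(a, b, e). a \<in> {1..6} \<and> b \<in> {1..6::nat} \<and> a \<noteq> b}"
  then obtain a b e where y: "y = (a, b, e)" "a \<in> {1..6}" "b \<in> {1..6}" "a \<noteq> b" by auto
  have "\<not> {1..6::nat} \<subseteq> {a, b}" 
  proof
    assume "{1..6::nat} \<subseteq> {a, b}"
    then have "card {1..6::nat} \<le> card {a, b}" by (intro card_mono) auto
    also have "\<dots> \<le> 2" by (simp add: card_insert_le_m1)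
    finally show False by simp
  qed
  then obtain c where c: "c \<in> {1..6}" "c \<notin> {a, b}" by blast
  obtain h where h: "h permutes {1..6}" "h 5 = a" "h 6 = b"
    using perm_ex[of a b c 5 6 1] y c by auto
  have t: "tr 1 2 permutes {1..6}" by (rule tr12_permutes)
  show "y \<in> (\<lambda>g. (g 5, g 6, evenperm g)) ` {g. g permutes {1..6}}"
  proof (cases "evenperm h = e")
    case True
    then show ?thesis using h y(1) by blast
  next
    case False
    \<comment> \<open>Precomposing with (1 2) changes the sign and keeps the images of 5 and
      6.\<close>
    then show ?thesis
      using h y(1) permutes_compose[OF t h(1)] evenperm_compose_permutes[OF h(1) t]
      by (intro image_eqI[of _ _ "h \<circ> tr 1 2"]) (auto simp: evenperm_transpose Transposition.transpose_def)
  qed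
next
  fix y :: "nat \<times> nat \<times> bool" assume "y \<in> (\<lambda>g. (g 5, g 6, evenperm g)) ` {g. g permutes {1..6}}"
  then obtain g where g: "g permutes {1..6}" "y = (g 5, g 6, evenperm g)" by blast
  have "g 5 \<noteq> g 6" using permutes_inject[OF g(1)] by simp
  moreover have "g 5 \<in> {1..6}" "g 6 \<in> {1..6}"
    using permutes_in_image[OF g(1), of 5] permutes_in_image[OF g(1), of 6] by simp_all
  ultimately show "y \<in> {(a, b, e). a \<in> {1..6} \<and> b \<in> {1..6::nat} \<and> a \<noteq> b}" unfolding g(2) by simp
qed

lemma card_fix_A4:
  assumes t: "t permutes {1..6}"
  shows "card {y \<in> (\<lambda>g. (g 5, g 6, evenperm g)) ` {g. g permutes {1..6}}.
    (\<lambda>(a, b, e). (t a, t b, evenperm t = e)) y = y} = fixA t"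
proof -
  let ?V = "{i \<in> {1..6}. t i = i}"
  have "{y \<in> {(a, b, e). a \<in> {1..6} \<and> b \<in> {1..6} \<and> a \<noteq> b}. (\<lambda>(a, b, e). (t a, t b, evenperm t = e)) y = y} =
      (if evenperm t then (\<lambda>((a, b), e). (a, b, e)) ` ({(a, b). a \<in> ?V \<and> b \<in> ?V \<and> a \<noteq> b} \<times> UNIV) else {})"
    by (auto simp: image_iff)
  moreover have "inj (\<lambda>((a :: nat, b :: nat), e :: bool). (a, b, e))" by (auto simp: inj_def)
  then have "card ((\<lambda>((a, b), e :: bool). (a, b, e)) ` ({(a, b). a \<in> ?V \<and> b \<in> ?V \<and> a \<noteq> b} \<times> UNIV)) =
      2 * (fixed 6 t * (fixed 6 t - 1))"
    using card_off_diagonal[of ?V]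
    by (subst card_image) (auto intro: inj_on_subset simp: card_cartesian_product fixed_def)
  ultimately show ?thesis unfolding image_A4 fixA_def by simp
qed

lemma image_D12:
  "(\<lambda>g. (g 6, g ` {4, 5})) ` {g. g permutes {1..6}} = {(x, S). x \<in> {1..6} \<and> S \<subseteq> {1..6::nat} \<and> card S = 2 \<and> x \<notin> S}"
proof (intro equalityI subsetI)
  fix y assume "y \<in> {(x, S). x \<in> {1..6} \<and> S \<subseteq> {1..6::nat} \<and> card S = 2 \<and> x \<notin> S}"
  then obtain x S where S: "y = (x, S)" "x \<in> {1..6}" "S \<subseteq> {1..6}" "card S = 2" "x \<notin> S" by blast
  obtain a b where "S = {a, b}" "a \<noteq> b" using S(4) unfolding card_2_iff by blast
  then have y: "y = (x, {a, b})" "x \<in> {1..6}" "a \<in> {1..6}" "b \<in> {1..6}" "a \<noteq> b" "x \<notin> {a, b}"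
    using S by blast+
  obtain h where "h permutes {1..6}" "h 6 = x" "h 4 = a" "h 5 = b"
    using perm_ex[of x a b 6 4 5] y by auto
  then show "y \<in> (\<lambda>g. (g 6, g ` {4, 5})) ` {g. g permutes {1..6}}"
    unfolding y(1) by (intro image_eqI[of _ _ h]) simp_all
next
  fix y :: "nat \<times> nat set" assume "y \<in> (\<lambda>g. (g 6, g ` {4, 5})) ` {g. g permutes {1..6}}"
  then obtain g where g: "g permutes {1..6}" "y = (g 6, {g 4, g 5})" by auto
  have "g 4 \<noteq> g 5" "g 6 \<noteq> g 4" "g 6 \<noteq> g 5" using permutes_inject[OF g(1)] by simp_all
  moreover have "g 4 \<in> {1..6}" "g 5 \<in> {1..6}" "g 6 \<in> {1..6}"
    using permutes_in_image[OF g(1), of 4] permutes_in_image[OF g(1), of 5] permutes_in_image[OF g(1), of 6]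
    by simp_all
  ultimately show "y \<in> {(x, S). x \<in> {1..6} \<and> S \<subseteq> {1..6} \<and> card S = 2 \<and> x \<notin> S}"
    unfolding g(2) by simp
qed

lemma card_fix_D12:
  assumes t: "t permutes {1..6}"
  shows "card {y \<in> (\<lambda>g. (g 6, g ` {4, 5})) ` {g. g permutes {1..6}}.
    (\<lambda>(x, S). (t x, t ` S)) y = y} = fixD t"
proof -
  let ?V = "{i \<in> {1..6}. t i = i}"
  let ?P = "\<lambda>x. {S. S \<subseteq> ?V - {x} \<and> card S = 2} \<union> swapped t"
  have pair: "S \<in> ?P x" if x: "x \<in> ?V" "x \<notin> S" and S: "S \<subseteq> {1..6}" "card S = 2" "t ` S = S" for x S
  proof -
    obtain a b where ab: "S = {a, b}" "a \<noteq> b" using S(2) unfolding card_2_iff by blast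
    have "{t a, t b} = {a, b}" using S(3) ab by simp
    then consider "t a = a" "t b = b" | "t a = b" "t b = a" by (auto simp: doubleton_eq_iff)
    then show ?thesis
      using ab S x by cases (auto simp: swapped_def)
  qed
  have "{y \<in> {(x, S). x \<in> {1..6} \<and> S \<subseteq> {1..6} \<and> card S = 2 \<and> x \<notin> S}. (\<lambda>(x, S). (t x, t ` S)) y = y} = Sigma ?V ?P"
  proof (intro equalityI subsetI)
    fix y assume "y \<in> {y \<in> {(x, S). x \<in> {1..6} \<and> S \<subseteq> {1..6} \<and> card S = 2 \<and> x \<notin> S}. (\<lambda>(x, S). (t x, t ` S)) y = y}"
    then show "y \<in> Sigma ?V ?P" using pair by (cases y) (simp del: Un_iff)
  next
    fix y assume "y \<in> Sigma ?V ?P"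
    then obtain x S where y: "y = (x, S)" "x \<in> ?V" "S \<in> ?P x" by blast
    have "S \<subseteq> {1..6} \<and> card S = 2 \<and> x \<notin> S \<and> t ` S = S"
    proof (cases "S \<in> swapped t")
      case True
      then show ?thesis using y(2) by (auto simp: swapped_def)
    next
      case False
      then have "S \<subseteq> ?V - {x}" "card S = 2" using y(3) by auto
      moreover from this have "t ` S = (\<lambda>i. i) ` S" by (intro image_cong) auto
      ultimately show ?thesis by auto
    qed
    then show "y \<in> {y \<in> {(x, S). x \<in> {1..6} \<and> S \<subseteq> {1..6} \<and> card S = 2 \<and> x \<notin> S}. (\<lambda>(x, S). (t x, t ` S)) y = y}"
      using y(1,2) by simp
  qed
  moreover have fin: "finite (swapped t)" unfolding swapped_def
    by (rule finite_subset[of _ "Pow {1..6}"]) auto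
  have "card (?P x) = ((fixed 6 t - 1) choose 2) + card (swapped t)" if "x \<in> ?V" for x
  proof -
    have "{S. S \<subseteq> ?V - {x} \<and> card S = 2} \<inter> swapped t = {}"
      by (auto simp: swapped_def card_2_iff)
    then have "card (?P x) = card {S. S \<subseteq> ?V - {x} \<and> card S = 2} + card (swapped t)"
      by (intro card_Un_disjoint fin) auto
    also have "card {S. S \<subseteq> ?V - {x} \<and> card S = 2} = (fixed 6 t - 1) choose 2"
      using that by (subst n_subsets) (simp_all add: fixed_def)
    finally show ?thesis .
  qed
  moreover have "finite (?P x)" for x using fin by auto
  ultimately show ?thesis unfolding image_D12 fixD_def by (simp add: fixed_def del: Un_iff)
qed

section \<open>Classification of the subgroups of order twelve of S6\<close>

section \<open>Subgroups of order twelve\<close>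

lemma subgroup_SymI:
  assumes "\<And>p. p \<in> H \<Longrightarrow> p permutes {1..q}" "id \<in> H"
    and "\<And>p r. p \<in> H \<Longrightarrow> r \<in> H \<Longrightarrow> p \<circ> r \<in> H" "\<And>p. p \<in> H \<Longrightarrow> inv' p \<in> H"
  shows "subgroup H (Sym q)"
  using assms by (intro group.subgroupI[OF group_Sym]) (auto simp: carrier_Sym mult_Sym inv_Sym)

lemma
  assumes "subgroup H (Sym q)"
  shows Sym_subgroup_perm: "p \<in> H \<Longrightarrow> p permutes {1..q}"
    and Sym_subgroup_comp: "p \<in> H \<Longrightarrow> r \<in> H \<Longrightarrow> p \<circ> r \<in> H"
    and Sym_subgroup_inv: "p \<in> H \<Longrightarrow> inv' p \<in> H"
    and Sym_subgroup_id: "id \<in> H"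
proof -
  show perm: "p permutes {1..q}" if "p \<in> H" for p
    using subgroup.subset[OF assms] that by (auto simp: carrier_Sym)
  show "p \<circ> r \<in> H" if "p \<in> H" "r \<in> H" for p r
    using subgroup.m_closed[OF assms that(2,1)] by (simp add: mult_Sym)
  show "inv' p \<in> H" if "p \<in> H" for p
    using subgroup.m_inv_closed[OF assms that] inv_Sym[OF perm[OF that]] by simp
  show "id \<in> H" using subgroup.one_closed[OF assms] by (simp add: one_Sym)
qed

lemma Sym_subgroup_finite: "subgroup H (Sym q) \<Longrightarrow> finite H"
  by (rule finite_subset[OF subgroup.subset]) (auto simp: carrier_Sym finite_permutations)

lemma Sym_subgroup_card_dvd:
  assumes H: "subgroup H (Sym q)" and K: "subgroup K (Sym q)" and "H \<subseteq> K"
  shows "card H dvd card K"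
proof -
  have G: "group (Sym q\<lparr>carrier := K\<rparr>)" by (rule group.subgroup_imp_group[OF group_Sym K])
  have "subgroup H (Sym q\<lparr>carrier := K\<rparr>)" by (rule group.subgroup_incl[OF group_Sym H K assms(3)])
  from group.lagrange[OF G this] have "card (rcosets\<^bsub>Sym q\<lparr>carrier := K\<rparr>\<^esub> H) * card H = card K" by (simp add: order_def)
  then show ?thesis by (metis dvd_triv_right)
qed

lemma Sym_subgroup_funpow_card:
  assumes H: "subgroup H (Sym q)" and p: "p \<in> H"
  shows "p ^^ card H = id"
proof -
  let ?G = "Sym q\<lparr>carrier := H\<rparr>"
  have G: "group ?G" by (rule group.subgroup_imp_group[OF group_Sym H])
  have "p [^]\<^bsub>?G\<^esub> n = p ^^ n" for n :: nat
  proof (induction n)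
    case 0
    then show ?case by (simp add: nat_pow_def one_Sym)
  next
    case (Suc n)
    have "p [^]\<^bsub>?G\<^esub> Suc n = p [^]\<^bsub>?G\<^esub> n \<otimes>\<^bsub>?G\<^esub> p" by (simp add: nat_pow_def)
    then show ?case using Suc by (simp add: mult_Sym)
  qed
  then show ?thesis using group.pow_order_eq_1[OF G, of p] p by (simp add: order_def one_Sym)
qed

definition pconj :: "(nat \<Rightarrow> nat) \<Rightarrow> (nat \<Rightarrow> nat) set \<Rightarrow> (nat \<Rightarrow> nat) set"
  where "pconj h K = (\<lambda>p. h \<circ> p \<circ> inv' h) ` K"

lemma pconj_mem:
  assumes "h permutes {1..6::nat}" shows "p \<in> pconj h K \<longleftrightarrow> inv' h \<circ> p \<circ> h \<in> K"
proof
  assume "p \<in> pconj h K"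
  then obtain r where r: "r \<in> K" "p = h \<circ> r \<circ> inv' h" unfolding pconj_def by blast
  have "inv' h \<circ> p \<circ> h = r" by (simp add: r(2) fun_eq_iff permutes_inverses[OF assms])
  then show "inv' h \<circ> p \<circ> h \<in> K" using r(1) by simp
next
  assume "inv' h \<circ> p \<circ> h \<in> K"
  moreover have "p = h \<circ> (inv' h \<circ> p \<circ> h) \<circ> inv' h" by (simp add: fun_eq_iff permutes_inverses[OF assms])
  ultimately show "p \<in> pconj h K" unfolding pconj_def by blast
qed

lemma pconj_subgroup:
  assumes h: "h permutes {1..6}" and K: "subgroup K (Sym 6)"
  shows "subgroup (pconj h K) (Sym 6)" "card (pconj h K) = card K"
proof -
  note ih = permutes_inv[OF h]
  show "subgroup (pconj h K) (Sym 6)"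
  proof (rule subgroup_SymI)
    show "p permutes {1..6}" if "p \<in> pconj h K" for p
      using that Sym_subgroup_perm[OF K] unfolding pconj_def
      by (auto intro!: permutes_compose[OF ih] permutes_compose[OF _ h])
    show "id \<in> pconj h K" using Sym_subgroup_id[OF K] by (simp add: pconj_mem[OF h] permutes_inv_o[OF h])
    show "p \<circ> r \<in> pconj h K" if "p \<in> pconj h K" "r \<in> pconj h K" for p r
    proof -
      have "inv' h \<circ> (p \<circ> r) \<circ> h = (inv' h \<circ> p \<circ> h) \<circ> (inv' h \<circ> r \<circ> h)"
        by (simp add: fun_eq_iff permutes_inverses[OF h])
      then show ?thesis using that Sym_subgroup_comp[OF K] by (simp add: pconj_mem[OF h])
    qed
    show "inv' p \<in> pconj h K" if pK: "p \<in> pconj h K" for p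
    proof -
      obtain r where r: "r \<in> K" "p = h \<circ> r \<circ> inv' h" using pK unfolding pconj_def by blast
      have "inv' p = h \<circ> inv' r \<circ> inv' h"
        unfolding r(2)
        using permutes_bij[OF h] permutes_bij[OF Sym_subgroup_perm[OF K r(1)]] permutes_bij[OF ih]
        by (simp add: o_inv_distrib bij_comp permutes_inv_inv[OF h] o_assoc)
      then show ?thesis using Sym_subgroup_inv[OF K r(1)] unfolding pconj_def by blast
    qed
  qed
  have "inj_on (\<lambda>p. h \<circ> p \<circ> inv' h) K"
  proof (rule inj_onI)
    fix p r assume "h \<circ> p \<circ> inv' h = h \<circ> r \<circ> inv' h"
    then have "inv' h \<circ> (h \<circ> p \<circ> inv' h) \<circ> h = inv' h \<circ> (h \<circ> r \<circ> inv' h) \<circ> h" by simp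
    then show "p = r" by (simp add: fun_eq_iff permutes_inverses[OF h])
  qed
  then show "card (pconj h K) = card K" unfolding pconj_def by (rule card_image)
qed

lemma conjugate_pconj: "h permutes {1..6} \<Longrightarrow> K \<subseteq> carrier (Sym 6) \<Longrightarrow> conjugate (Sym 6) K (pconj h K)"
  unfolding pconj_def Sym_conjugate_iff by blast

lemma subgroup_A4: "subgroup A4 (Sym 6)"
proof (rule subgroup_SymI)
  show "p \<circ> r \<in> A4" if "p \<in> A4" "r \<in> A4" for p r
    using that permutes_compose[of r "{1..6}" p] evenperm_compose_permutes[of p 6 r] by (simp add: A4_def)
  show "inv' p \<in> A4" if "p \<in> A4" for p
    using that evenperm_inv_permutes[of p 6] permutes_inv_eq[of p "{1..6}"] by (simp add: A4_def permutes_inv)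
qed (simp_all add: A4_def permutes_id evenperm_id)

lemma subgroup_D12: "subgroup D12 (Sym 6)"
proof (rule subgroup_SymI)
  show "p \<circ> r \<in> D12" if "p \<in> D12" "r \<in> D12" for p r
  proof -
    have pr: "p permutes {1..6}" "p 6 = 6" "p ` {4, 5} = {4, 5}" "r permutes {1..6}" "r 6 = 6" "r ` {4, 5} = {4, 5}"
      using that unfolding D12_def by blast+
    have "(p \<circ> r) ` {4, 5} = p ` (r ` {4, 5})" by (rule image_comp[symmetric])
    then have "(p \<circ> r) ` {4, 5} = {4, 5}" by (simp only: pr)
    moreover have "(p \<circ> r) 6 = 6" using pr by simp
    ultimately show ?thesis using permutes_compose[OF pr(4,1)] unfolding D12_def by blast
  qed
  show "inv' p \<in> D12" if "p \<in> D12" for p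
  proof -
    have p: "p permutes {1..6}" "p 6 = 6" "p ` {4, 5} = {4, 5}" using that by (auto simp: D12_def)
    have "inv' p ` {4, 5} = inv' p ` p ` {4, 5}" using p(3) by simp
    also have "\<dots> = {4, 5}" by (simp add: image_image permutes_inverses[OF p(1)])
    finally show ?thesis using p by (simp add: D12_def permutes_inv permutes_inv_eq[OF p(1)])
  qed
qed (simp_all add: D12_def permutes_id)

lemma card_A4: "card A4 = 12"
proof -
  have "A4 = carrier (alt_group 4)"
  proof (intro equalityI subsetI)
    fix p assume "p \<in> A4"
    then have p: "p permutes {1..6}" "p 5 = 5" "p 6 = 6" "evenperm p" by (simp_all add: A4_def)
    have "x \<in> {1..6} - {1..4} \<Longrightarrow> x = 5 \<or> x = 6" for x :: nat by auto
    then have "p permutes {1..4}" using p(2,3) by (intro permutes_superset[OF p(1)]) auto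
    then show "p \<in> carrier (alt_group 4)" using p(4) by (simp add: alt_group_carrier)
  next
    fix p assume "p \<in> carrier (alt_group 4)"
    then have p: "p permutes {1..4}" "evenperm p" by (auto simp: alt_group_carrier)
    have "p permutes {1..6}" by (rule permutes_subset[OF p(1)]) auto
    then show "p \<in> A4" using p permutes_not_in[OF p(1)] by (simp add: A4_def)
  qed
  then show ?thesis using alt_group_card_carrier[of 4] by (simp add: fact_numeral)
qed

text \<open>Splitting off the swap of 4 and 5 leaves a permutation of {1, 2, 3}, so the order is 6
  times 2.\<close>

lemma card_D12: "card D12 = 12"
proof -
  let ?f = "\<lambda>(p, q). p \<circ> q" and ?V = "{p. p permutes {1, 2, 3::nat}} \<times> {id, tr 4 5}"
  have t45: "tr 4 5 permutes {1..6}" by (rule permutes_swap_id) auto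
  have "?f ` ?V = D12"
  proof (intro equalityI subsetI)
    fix d assume "d \<in> ?f ` ?V"
    then obtain p q where d: "d = p \<circ> q" and p: "p permutes {1, 2, 3}" and q: "q = id \<or> q = tr 4 5" by auto
    have p6: "p permutes {1..6}" by (rule permutes_subset[OF p]) auto
    have "p 4 = 4" "p 5 = 5" "p 6 = 6" using permutes_not_in[OF p] by simp_all
    then show "d \<in> D12"
      using q permutes_compose[OF t45 p6] p6 unfolding D12_def d
      by (auto simp: Transposition.transpose_def)
  next
    fix d assume "d \<in> D12"
    then have d: "d permutes {1..6}" "d 6 = 6" "d ` {4, 5} = {4, 5}" by (auto simp: D12_def)
    then consider "d 4 = 4" "d 5 = 5" | "d 4 = 5" "d 5 = 4" by (auto simp: doubleton_eq_iff)
    then have "\<exists>q. (q = id \<or> q = tr 4 5) \<and> d (q 4) = 4 \<and> d (q 5) = 5"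
    proof cases
      case 1
      then show ?thesis by (intro exI[of _ id]) simp
    next
      case 2
      then show ?thesis by (intro exI[of _ "tr 4 5"]) simp
    qed
    then obtain q where q: "q = id \<or> q = tr 4 5" "d (q 4) = 4" "d (q 5) = 5" by blast
    have q6: "q permutes {1..6}" "q 6 = 6" "q \<circ> q = id"
      using q(1) t45 permutes_id by (elim disjE; simp add: Transposition.transpose_def)+
    have x: "x \<in> {1..6} - {1, 2, 3} \<Longrightarrow> x = 4 \<or> x = 5 \<or> x = 6" for x :: nat by auto
    have "d \<circ> q permutes {1, 2, 3}"
    proof (rule permutes_superset[OF permutes_compose[OF q6(1) d(1)]])
      fix y :: nat assume "y \<in> {1..6} - {1, 2, 3}"
      then show "(d \<circ> q) y = y" using x[of y] q q6 d by auto
    qed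
    moreover have "d = (d \<circ> q) \<circ> q" by (simp add: comp_assoc q6(3))
    ultimately show "d \<in> ?f ` ?V" using q(1) by (intro image_eqI[of _ _ "(d \<circ> q, q)"]) auto
  qed
  moreover have "inj_on ?f ?V"
  proof (rule inj_onI)
    fix u v assume "u \<in> ?V" "v \<in> ?V" "?f u = ?f v"
    then obtain p q p' q' where uv: "u = (p, q)" "v = (p', q')" and p: "p permutes {1, 2, 3}" "p' permutes {1, 2, 3}"
      and q: "q = id \<or> q = tr 4 5" "q' = id \<or> q' = tr 4 5" and eq: "p \<circ> q = p' \<circ> q'" by auto
    have "p 4 = 4" "p 5 = 5" "p' 4 = 4" "p' 5 = 5" using permutes_not_in[OF p(1)] permutes_not_in[OF p(2)] by simp_all
    then have "q = q'" using q fun_cong[OF eq, of 4] by (auto simp: Transposition.transpose_def)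
    moreover have "q \<circ> q = id" using q(1) by auto
    then have "p = (p \<circ> q) \<circ> q" "p' = (p' \<circ> q) \<circ> q" by (simp_all add: comp_assoc)
    ultimately show "u = v" using eq uv by simp
  qed
  moreover have "tr 4 5 \<noteq> id"
  proof
    assume "tr 4 5 = id"
    then have "tr 4 5 4 = 4" by simp
    then show False by (simp add: Transposition.transpose_def)
  qed
  then have "card ?V = 12"
    using card_permutations[of "{1, 2, 3::nat}" 3] by (simp add: card_cartesian_product fact_numeral)
  ultimately show ?thesis using card_image by metis
qed

text \<open>The two disjoint cycles commute, so their products form a subgroup of order nine, and
  Lagrange applies. This excludes disjoint three-cycles from a subgroup of order twelve.\<close>

lemma nine_dvd_card:
  assumes K: "subgroup K (Sym 6)" and x: "cyc 1 2 3 \<in> K" and u: "cyc 4 5 6 \<in> K"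
  shows "9 dvd card K"
proof -
  let ?x = "cyc 1 2 3" and ?u = "cyc 4 5 6"
  define f where "f = (\<lambda>(i, j). (?x ^^ i) \<circ> (?u ^^ j))"
  let ?I = "{..<3::nat} \<times> {..<3::nat}"
  have d: "distinct [1, 2, 3::nat]" "distinct [4, 5, 6::nat]" by auto
  have p3: "p ^^ 3 = p \<circ> (p \<circ> p)" and p2: "p ^^ 2 = p \<circ> p" for p :: "nat \<Rightarrow> nat"
    by (simp_all add: numeral_3_eq_3 numeral_2_eq_2 comp_assoc)
  have p1: "p ^^ 1 = p" for p :: "nat \<Rightarrow> nat" by (simp add: One_nat_def)
  have x3: "?x ^^ 3 = id" and u3: "?u ^^ 3 = id"
    unfolding p3 by (simp_all add: fun_eq_iff cyc_cyc_cyc[OF d(1)] cyc_cyc_cyc[OF d(2)])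
  have xm: "?x ^^ i = ?x ^^ (i mod 3)" and um: "?u ^^ i = ?u ^^ (i mod 3)" for i
    using funpow_mod_eq[of 3 ?x _ i] funpow_mod_eq[of 3 ?u _ i] x3 u3 by (simp_all add: fun_eq_iff)
  have "?u \<circ> ?x = ?x \<circ> ?u" by (auto simp: fun_eq_iff cyc_def)
  then have ux: "?u (?x z) = ?x (?u z)" for z by (simp add: fun_eq_iff)
  have "?u ((?x ^^ k) z) = (?x ^^ k) (?u z)" for k z by (induction k) (simp_all add: ux)
  then have "(?u ^^ j) ((?x ^^ k) z) = (?x ^^ k) ((?u ^^ j) z)" for j k z by (induction j) simp_all
  then have "f (i, j) \<circ> f (k, l) = (?x ^^ (i + k)) \<circ> (?u ^^ (j + l))" for i j k l
    by (simp add: f_def fun_eq_iff funpow_add)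
  then have ff: "f (i, j) \<circ> f (k, l) = f ((i + k) mod 3, (j + l) mod 3)" for i j k l
    using xm um by (simp add: f_def)
  have f0: "f (0, 0) = id" by (simp add: f_def)
  have fK: "f ij \<in> K" for ij
  proof -
    have "p ^^ n \<in> K" if "p \<in> K" for p n
      using that by (induction n) (simp_all add: Sym_subgroup_id[OF K] Sym_subgroup_comp[OF K])
    then show ?thesis using x u Sym_subgroup_comp[OF K] by (cases ij) (simp add: f_def)
  qed
  have sub: "subgroup (f ` ?I) (Sym 6)"
  proof (rule subgroup_SymI)
    show "p permutes {1..6}" if "p \<in> f ` ?I" for p using that fK Sym_subgroup_perm[OF K] by blast
    show "id \<in> f ` ?I" using f0 by (intro image_eqI[of _ _ "(0, 0)"]) simp_all
    show "p \<circ> r \<in> f ` ?I" if pr: "p \<in> f ` ?I" "r \<in> f ` ?I" for p r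
    proof -
      obtain i j k l where "p = f (i, j)" "r = f (k, l)" using pr by auto
      then show ?thesis using ff[of i j k l] by (intro image_eqI[of _ _ "((i + k) mod 3, (j + l) mod 3)"]) simp_all
    qed
    show "inv' p \<in> f ` ?I" if p: "p \<in> f ` ?I" for p
    proof -
      obtain i j where ij: "p = f (i, j)" using p by auto
      \<comment> \<open>In exponent three the inverse is the square, so both exponents are doubled
        modulo 3.\<close>
      have "p \<circ> f ((2 * i) mod 3, (2 * j) mod 3) = f (0, 0)" "f ((2 * i) mod 3, (2 * j) mod 3) \<circ> p = f (0, 0)"
        unfolding ij ff by (simp_all add: mod_add_right_eq mod_add_left_eq)
      then have "inv' p = f ((2 * i) mod 3, (2 * j) mod 3)"
        unfolding f0 by (intro inv_unique_comp)
      then show ?thesis by (intro image_eqI[of _ _ "((2 * i) mod 3, (2 * j) mod 3)"]) simp_all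
    qed
  qed
  have "inj_on f ?I"
  proof (rule inj_onI)
    fix s t assume st: "s \<in> ?I" "t \<in> ?I" "f s = f t"
    obtain i j k l where ij: "s = (i, j)" "t = (k, l)" "i < 3" "j < 3" "k < 3" "l < 3" using st(1,2) by auto
    have u1: "(?u ^^ n) 1 = 1" for n by (induction n) (simp_all add: cyc_def)
    have x4: "?u 4 = 5" "?u 5 = 6" "?x 1 = 2" "?x 2 = 3" by (simp_all add: cyc_def)
    have low: "n < 3 \<Longrightarrow> n = 0 \<or> n = 1 \<or> n = 2" for n :: nat by auto
    have x1: "n < 3 \<Longrightarrow> (?x ^^ n) 1 = n + 1" and u4: "n < 3 \<Longrightarrow> (?u ^^ n) 4 = n + 4" for n
      using low[of n] x4 by (auto simp: p1 p2)
    have xf: "(?x ^^ n) z = z" if "z \<in> {4, 5, 6}" for n z using that by (induction n) (auto simp: cyc_def)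
    have "f (i, j) 1 = i + 1" "f (k, l) 1 = k + 1" using x1 ij u1 by (simp_all add: f_def)
    moreover have "f (i, j) 4 = j + 4" "f (k, l) 4 = l + 4"
    proof -
      have "n < 3 \<Longrightarrow> n + 4 \<in> {4, 5, 6::nat}" for n by auto
      then show "f (i, j) 4 = j + 4" "f (k, l) 4 = l + 4" using u4 ij xf by (simp_all add: f_def)
    qed
    ultimately show "s = t" using st(3) ij by simp
  qed
  then have "card (f ` ?I) = 9" by (simp add: card_image card_cartesian_product)
  moreover have "f ` ?I \<subseteq> K" using fK by blast
  ultimately show ?thesis using Sym_subgroup_card_dvd[OF sub K] by simp
qed

lemma pconj_cyc_mem:
  assumes "h permutes {1..6}" shows "cyc (h a) (h b) (h c) \<in> pconj h K \<longleftrightarrow> cyc a b c \<in> K"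
proof -
  have "inv' h \<circ> cyc (h a) (h b) (h c) \<circ> h = cyc a b c"
    unfolding cyc_conj[OF assms, symmetric] by (simp add: fun_eq_iff permutes_inverses[OF assms])
  then show ?thesis by (simp only: pconj_mem[OF assms])
qed

lemma pconj_inv_pconj:
  assumes "h permutes {1..6}" shows "pconj h (pconj (inv' h) K) = K"
proof -
  have "inv' (inv' h) \<circ> (inv' h \<circ> p \<circ> h) \<circ> inv' h = p" for p
    unfolding permutes_inv_inv[OF assms] by (simp add: fun_eq_iff permutes_inverses[OF assms])
  then show ?thesis by (auto simp: pconj_mem[OF assms] pconj_mem[OF permutes_inv[OF assms]])
qed

text \<open>A subgroup of order twelve containing \<open>(1 2 3)\<close> and \<open>(1 2 4)\<close> meets \<open>A4\<close> in more than six
  elements, hence is \<open>A4\<close>.\<close>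

lemma eq_A4:
  assumes K: "subgroup K (Sym 6)" and c: "card K = 12" and x: "cyc 1 2 3 \<in> K" and w: "cyc 1 2 4 \<in> K"
  shows "K = A4"
proof -
  let ?x = "cyc 1 2 3" and ?w = "cyc 1 2 4"
  have d: "distinct [1, 2, 3::nat]" "distinct [1, 2, 4::nat]" by auto
  have A: "?x \<in> A4" "?w \<in> A4"
    using cyc_permutes[OF d(1), of "{1..6}"] cyc_permutes[OF d(2), of "{1..6}"] evenperm_cyc[OF d(1)] evenperm_cyc[OF d(2)]
    by (simp_all add: A4_def cyc_def)
  have int: "subgroup (K \<inter> A4) (Sym 6)"
    by (rule group.subgroups_Inter_pair[OF group_Sym K subgroup_A4])
  have cl: "p \<circ> r \<in> K \<inter> A4" if "p \<in> K \<inter> A4" "r \<in> K \<inter> A4" for p r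
    by (rule Sym_subgroup_comp[OF int that])
  have xI: "?x \<in> K \<inter> A4" and wI: "?w \<in> K \<inter> A4" using x w A by blast+
  \<comment> \<open>Seven elements of the intersection, told apart by the images of 1 and 2; a
    divisor of 12 that is at least 7 equals 12.\<close>
  let ?L = "[id, ?x, ?x \<circ> ?x, ?w, ?w \<circ> ?w, ?x \<circ> ?w, ?w \<circ> ?x]"
  have ev: "?x 1 = 2" "?x 2 = 3" "?x 3 = 1" "?x 4 = 4" "?w 1 = 2" "?w 2 = 4" "?w 4 = 1" "?w 3 = 3"
    by (simp_all add: cyc_def)
  have "map (\<lambda>p. (p 1, p 2)) ?L = [(1, 2), (2, 3), (3, 1), (2, 4), (4, 1), (3, 4), (4, 3)]" by (simp add: ev)
  moreover have "distinct [(1, 2), (2, 3), (3, 1), (2, 4), (4, 1), (3, 4), (4, 3::nat) :: nat \<times> nat]" by simp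
  ultimately have "distinct (map (\<lambda>p. (p 1, p 2)) ?L)" by (simp only:)
  then have "distinct ?L" unfolding distinct_map by blast
  then have "card (set ?L) = 7" using distinct_card[of ?L] by simp
  moreover have "set ?L \<subseteq> K \<inter> A4"
    using cl[OF xI xI] cl[OF wI wI] cl[OF xI wI] cl[OF wI xI] xI wI Sym_subgroup_id[OF int] by simp
  then have "card (set ?L) \<le> card (K \<inter> A4)" by (rule card_mono[OF Sym_subgroup_finite[OF int]])
  ultimately have ge: "7 \<le> card (K \<inter> A4)" by simp
  have "card (K \<inter> A4) dvd 12" using Sym_subgroup_card_dvd[OF int K] c by simp
  then obtain k where k: "12 = card (K \<inter> A4) * k" by (rule dvdE)
  have "k = 1"
  proof (rule ccontr)
    assume "k \<noteq> 1"
    moreover have "k \<noteq> 0" using k by (intro notI) simp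
    ultimately have "2 \<le> k" by simp
    then have "7 * 2 \<le> card (K \<inter> A4) * k" using ge by (rule mult_le_mono[rotated])
    then show False using k by simp
  qed
  then have "card (K \<inter> A4) = 12" using k by simp
  then have "K \<inter> A4 = K" "K \<inter> A4 = A4"
    using c card_A4 Sym_subgroup_finite[OF K] Sym_subgroup_finite[OF subgroup_A4]
    by (intro card_subset_eq, simp_all)+
  then show ?thesis by (rule trans[OF sym])
qed

lemma not_9_dvd_12: "\<not> 9 dvd (12::nat)"
  by (simp add: dvd_eq_mod_eq_0)

lemma cyc_sq: "distinct [a, b, c] \<Longrightarrow> cyc a b c \<circ> cyc a b c = cyc a c b"
  by (auto simp: fun_eq_iff cyc_def)

lemma cyc_perm3:
  assumes "distinct [a, b, c]" "{a, b, c} = {d, e, f}" "cyc a b c \<in> K" "subgroup K (Sym 6)"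
  shows "cyc d e f \<in> K"
proof -
  have "cyc a c b \<in> K" using Sym_subgroup_comp[OF assms(4,3,3)] cyc_sq[OF assms(1)] by simp
  moreover have "cyc d e f = cyc a b c \<or> cyc d e f = cyc a c b"
  proof -
    have "card {d, e, f} = 3" unfolding assms(2)[symmetric] using assms(1) by simp
    then have df: "distinct [d, e, f]" by (auto simp: card_insert_if split: if_splits)
    have "d \<in> {a, b, c}" "e \<in> {a, b, c}" "f \<in> {a, b, c}" using assms(2) by blast+
    then show ?thesis using df assms(1) cyc_rotate[of a b c] cyc_rotate[of b c a] cyc_rotate[of a c b] cyc_rotate[of c b a]
      by (elim insertE emptyE) simp_all
  qed
  ultimately show ?thesis using assms(3) by auto
qed

text \<open>Two three-cycles of a subgroup of order twelve either generate the same subgroup or have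
  exactly two common points: disjoint ones would generate a subgroup of order nine, and the product
  of two with one common point is a five-cycle.\<close>

lemma order_12_not_normal:
  assumes K: "subgroup K (Sym 6)" and c: "card K = 12" and x: "cyc 1 2 3 \<in> K"
    and y: "cyc a b d \<in> K" "distinct [a, b, d]" "{a, b, d} \<subseteq> {1..6}" "{a, b, d} \<noteq> {1, 2, 3}"
  obtains h where "h permutes {1..6}" "K = pconj h A4"
proof -
  note result = that
  have three: "z = 1 \<or> z = 2 \<or> z = 3 \<or> z \<in> {4, 5, 6}" if "z \<in> {1..6}" for z :: nat using that by auto
  have xs: "cyc p q r \<in> K" if "{p, q, r} = {1, 2, 3}" for p q r
    by (rule cyc_perm3[OF _ that[symmetric] x K]) simp
  have ys: "cyc p q r \<in> K" if "{p, q, r} = {a, b, d}" for p q r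
    by (rule cyc_perm3[OF y(2) that[symmetric] y(1) K])
  have one: False
    if m: "p \<in> {1, 2, 3}" "q \<notin> {1, 2, 3}" "r \<notin> {1, 2, 3}" "{p, q, r} = {a, b, d}" for p q r
  proof -
    obtain u v where uv: "{p, u, v} = {1, 2, 3}" "distinct [p, u, v]"
      using m(1) by (elim insertE emptyE) (rule that[of 2 3], simp_all, rule that[of 1 3], auto, rule that[of 1 2], auto)
    have "card {p, q, r} = 3" unfolding m(4) using y(2) by simp
    then have dr: "distinct [p, q, r]" by (auto simp: card_insert_if split: if_splits)
    define z where "z = cyc p u v \<circ> cyc p q r"
    have zK: "z \<in> K" unfolding z_def by (rule Sym_subgroup_comp[OF K xs[OF uv(1)] ys[OF m(4)]])
    have qr: "q \<noteq> u" "q \<noteq> v" "r \<noteq> u" "r \<noteq> v" using m uv(1) by auto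
    have ev: "z p = q" "z q = r" "z r = u" "z u = v" "z v = p"
      using dr uv(2) qr by (auto simp: z_def cyc_def)
    \<comment> \<open>The product \<open>z\<close> is a five-cycle on the union of the supports, so
      its twelfth power is its square and sends \<open>p\<close> to \<open>r\<close>; yet it must be
      the identity in a group of order twelve.\<close>
    have "(z ^^ 12) p = p" using Sym_subgroup_funpow_card[OF K zK] c by simp
    moreover have "(z ^^ 12) p = r"
    proof -
      have "(12::nat) = Suc (Suc (Suc (Suc (Suc (Suc (Suc (Suc (Suc (Suc (Suc (Suc 0)))))))))))" by simp
      then show ?thesis by (simp only: funpow.simps o_apply id_apply ev)
    qed
    ultimately show False using dr by simp
  qed
  have two: thesis
    if m: "p \<in> {1, 2, 3}" "q \<in> {1, 2, 3}" "r \<notin> {1, 2, 3}" "{p, q, r} = {a, b, d}" for p q r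
  proof -
    have "card {p, q, r} = 3" unfolding m(4) using y(2) by simp
    then have dr: "distinct [p, q, r]" by (auto simp: card_insert_if split: if_splits)
    obtain u where u: "{p, q, u} = {1, 2, 3}" "u \<in> {1, 2, 3}" "distinct [p, q, u]"
    proof -
      have "\<exists>u\<in>{1, 2, 3}. {p, q, u} = {1, 2, 3} \<and> distinct [p, q, u]"
        using m(1,2) dr by (elim insertE emptyE) auto
      then show ?thesis using that by blast
    qed
    have pq: "distinct [p, q, u]" "{p, q, u} \<subseteq> {1..6}" using u by auto
    obtain h1 where h1: "h1 permutes {1..6}" "h1 1 = p" "h1 2 = q" "h1 3 = u"
      using even_perm_ex[OF pq] by blast
    have r6: "r \<in> {1..6}" using m(4) y(3) by blast
    \<comment> \<open>Renaming \<open>p\<close>, \<open>q\<close>, \<open>u\<close>,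
      \<open>r\<close> as 1, 2, 3, 4 reduces to \<open>eq_A4\<close>.\<close>
    obtain h where h: "h permutes {1..6}" "h 4 = r" "\<And>x. x \<in> {1, 2, 3} \<Longrightarrow> h x = h1 x"
      by (rule permutes_extend[OF h1(1), of 4 r "{1, 2, 3}"]) (use r6 h1 u(1) m(3) in auto)
    have hv: "h 1 = p" "h 2 = q" "h 3 = u" using h(3) h1 by simp_all
    let ?K = "pconj (inv' h) K"
    note ih = permutes_inv[OF h(1)]
    have hh: "pconj h ?K = K" by (rule pconj_inv_pconj[OF h(1)])
    have "cyc 1 2 3 \<in> ?K" "cyc 1 2 4 \<in> ?K"
      using pconj_cyc_mem[OF h(1), of 1 2 3 ?K] pconj_cyc_mem[OF h(1), of 1 2 4 ?K] xs[OF u(1)] ys[OF m(4)]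
      unfolding hh hv h(2) by simp_all
    then have "?K = A4" using eq_A4 pconj_subgroup[OF ih K] c by simp
    then show thesis using result[OF h(1)] hh by simp
  qed
  define W where "W = {1, 2, 3::nat}"
  have ny: "\<not> (a \<in> W \<and> b \<in> W \<and> d \<in> W)"
  proof
    assume "a \<in> W \<and> b \<in> W \<and> d \<in> W"
    then have "{a, b, d} \<subseteq> {1, 2, 3}" unfolding W_def by simp
    then have "{a, b, d} = {1, 2, 3}" using y(2) by (intro card_subset_eq) auto
    then show False using y(4) by simp
  qed
  have nz: "\<not> (a \<notin> W \<and> b \<notin> W \<and> d \<notin> W)"
  proof
    assume "a \<notin> W \<and> b \<notin> W \<and> d \<notin> W"
    then have "{a, b, d} \<subseteq> {4, 5, 6}" using three[of a] three[of b] three[of d] y(3) by (auto simp: W_def)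
    then have "{a, b, d} = {4, 5, 6}" using y(2) by (intro card_subset_eq) auto
    then have "cyc 4 5 6 \<in> K" by (intro ys) simp
    then show False using nine_dvd_card[OF K x] c not_9_dvd_12 by simp
  qed
  note one' = one[folded W_def] and two' = two[folded W_def]
  consider "a \<in> W" "b \<in> W" "d \<notin> W" | "a \<in> W" "d \<in> W" "b \<notin> W" | "b \<in> W" "d \<in> W" "a \<notin> W"
    | "a \<in> W" "b \<notin> W" "d \<notin> W" | "b \<in> W" "a \<notin> W" "d \<notin> W" | "d \<in> W" "a \<notin> W" "b \<notin> W"
    using ny nz by blast
  then show thesis
  proof cases
    case 1 then show ?thesis using two'[of a b d] by simp
  next
    case 2 then show ?thesis using two'[of a d b] by (simp add: insert_commute)
  next
    case 3 then show ?thesis using two'[of b d a] by (simp add: insert_commute)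
  next
    case 4 then show ?thesis using one'[of a b d] by simp
  next
    case 5 then show ?thesis using one'[of b a d] by (simp add: insert_commute)
  next
    case 6 then show ?thesis using one'[of d a b] by (simp add: insert_commute)
  qed
qed

text \<open>Such a \<open>K\<close> also preserves {4, 5, 6}. No element rotates {4, 5, 6}, since a
  product of it with a power of (1 2 3) would lead to a subgroup of order nine. So \<open>K\<close>
  acts there by the identity and transpositions only, all fixing one common point, and
  \<open>K\<close> lies in a conjugate of \<open>D12\<close>, which has the same order.\<close>

lemma order_12_normal:
  assumes K: "subgroup K (Sym 6)" and c: "card K = 12" and x: "cyc 1 2 3 \<in> K"
    and N: "\<And>y. y \<in> K \<Longrightarrow> y ` {1, 2, 3} = {1, 2, 3}"
  obtains h where "h permutes {1..6}" "K = pconj h D12"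
proof -
  let ?x = "cyc 1 2 3"
  have six: "{1..6} = {1, 2, 3} \<union> {4, 5, 6::nat}" by auto
  have perm: "y permutes {1..6}" if "y \<in> K" for y by (rule Sym_subgroup_perm[OF K that])
  have N': "y ` {4, 5, 6} = {4, 5, 6}" if y: "y \<in> K" for y
  proof -
    have "{4, 5, 6} = {1..6} - {1, 2, 3::nat}" unfolding six by auto
    moreover have "y ` ({1..6} - {1, 2, 3}) = y ` {1..6} - y ` {1, 2, 3}"
      by (rule image_set_diff[OF permutes_inj[OF perm[OF y]]])
    ultimately show ?thesis using permutes_image[OF perm[OF y]] N[OF y] by simp
  qed
  have no456: "cyc 4 5 6 \<notin> K" using nine_dvd_card[OF K x] c not_9_dvd_12 by auto
  have no465: "cyc 4 6 5 \<notin> K" using cyc_perm3[of 4 6 5 4 5 6 K] no456 K by (auto simp: insert_commute)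
  have ev: "?x 1 = 2" "?x 2 = 3" "?x 3 = 1" "?x 4 = 4" "?x 5 = 5" "?x 6 = 6"
    "cyc 4 5 6 1 = 1" "cyc 4 5 6 2 = 2" "cyc 4 5 6 3 = 3" "cyc 4 5 6 4 = 5" "cyc 4 5 6 5 = 6" "cyc 4 5 6 6 = 4"
    "cyc 4 6 5 1 = 1" "cyc 4 6 5 2 = 2" "cyc 4 6 5 3 = 3" "cyc 4 6 5 4 = 6" "cyc 4 6 5 5 = 4" "cyc 4 6 5 6 = 5"
    by (simp_all add: cyc_def)
  have ext: "p = r" if "p permutes {1..6}" "r permutes {1..6}" "p 1 = r 1" "p 2 = r 2" "p 3 = r 3"
    "p 4 = r 4" "p 5 = r 5" "p 6 = r 6" for p r :: "nat \<Rightarrow> nat"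
  proof
    fix z :: nat
    have "\<forall>i\<in>{1..6}. p i = r i" unfolding all6 using that by simp
    then show "p z = r z" using permutes_not_in[OF that(1), of z] permutes_not_in[OF that(2), of z] by (cases "z \<in> {1..6}") simp_all
  qed
  have c456: "cyc 4 5 6 permutes {1..6}" "cyc 4 6 5 permutes {1..6}" by (auto intro!: cyc_permutes)
  have fxp: "y 4 = 4 \<or> y 5 = 5 \<or> y 6 = 6" if y: "y \<in> K" for y
  proof (rule ccontr)
    assume no: "\<not> (y 4 = 4 \<or> y 5 = 5 \<or> y 6 = 6)"
    have inj: "y i = y j \<longleftrightarrow> i = j" for i j by (rule permutes_inject[OF perm[OF y]])
    have m4: "y 4 \<in> {4, 5, 6}" "y 5 \<in> {4, 5, 6}" "y 6 \<in> {4, 5, 6}" using N'[OF y] by blast+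
    have m1: "y 1 \<in> {1, 2, 3}" "y 2 \<in> {1, 2, 3}" "y 3 \<in> {1, 2, 3}" using N[OF y] by blast+
    have i4: "y 4 \<noteq> y 5" "y 4 \<noteq> y 6" "y 5 \<noteq> y 6" "y 1 \<noteq> y 2" "y 1 \<noteq> y 3" "y 2 \<noteq> y 3"
      using inj by simp_all
    have y456: "y 4 = 5 \<and> y 5 = 6 \<and> y 6 = 4 \<or> y 4 = 6 \<and> y 5 = 4 \<and> y 6 = 5"
      using m4 i4(1-3) no by (elim insertE emptyE) simp_all
    have y123: "y 1 = 1 \<and> y 2 = 2 \<and> y 3 = 3 \<or> y 1 = 2 \<and> y 2 = 3 \<and> y 3 = 1 \<or> y 1 = 3 \<and> y 2 = 1 \<and> y 3 = 2 \<or>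
        y 1 = 1 \<and> y 2 = 3 \<and> y 3 = 2 \<or> y 1 = 3 \<and> y 2 = 2 \<and> y 3 = 1 \<or> y 1 = 2 \<and> y 2 = 1 \<and> y 3 = 3"
      using m1 i4(4-6) by (elim insertE emptyE) simp_all
    note comp = Sym_subgroup_comp[OF K]
    \<comment> \<open>The fourth power of \<open>y\<close> still acts as \<open>y\<close> on {4, 5,
      6}, but on {1, 2, 3} it is an even permutation, which a power of (1 2 3) cancels. What remains
      is (4 5 6) or its inverse.\<close>
    define w where "w = y \<circ> (y \<circ> (y \<circ> y))"
    have wK: "w \<in> K" "w \<circ> ?x \<in> K" "w \<circ> (?x \<circ> ?x) \<in> K" unfolding w_def using comp y x by blast+
    have bad: False if "u \<in> K" "u 1 = 1" "u 2 = 2" "u 3 = 3" "u 4 = y 4" "u 5 = y 5" "u 6 = y 6" for u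
    proof -
      have "u = cyc 4 5 6 \<or> u = cyc 4 6 5"
        using y456
      proof (elim disjE)
        assume "y 4 = 5 \<and> y 5 = 6 \<and> y 6 = 4"
        then have "u = cyc 4 5 6" using that by (intro ext perm c456) (simp_all add: ev)
        then show ?thesis ..
      next
        assume "y 4 = 6 \<and> y 5 = 4 \<and> y 6 = 5"
        then have "u = cyc 4 6 5" using that by (intro ext perm c456) (simp_all add: ev)
        then show ?thesis ..
      qed
      then show False using that(1) no456 no465 by blast
    qed
    have w456: "w 4 = y 4" "w 5 = y 5" "w 6 = y 6" using y456 by (elim disjE conjE; simp add: w_def)+
    consider "w 1 = 1" "w 2 = 2" "w 3 = 3" | "w 1 = 2" "w 2 = 3" "w 3 = 1" | "w 1 = 3" "w 2 = 1" "w 3 = 2"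
      using y123 by (elim disjE conjE) (simp_all add: w_def)
    then show False
    proof cases
      case 1
      then show ?thesis using bad[OF wK(1)] w456 by simp
    next
      case 2
      then show ?thesis using bad[OF wK(3)] w456 by (simp add: ev)
    next
      case 3
      then show ?thesis using bad[OF wK(2)] w456 by (simp add: ev)
    qed
  qed
  \<comment> \<open>Two different transpositions of {4, 5, 6} have as product a rotation, which
    \<open>fxp\<close> forbids.\<close>
  have common: "\<exists>i\<in>{4, 5, 6}. \<forall>y\<in>K. y i = i"
  proof (rule ccontr)
    assume no: "\<not> (\<exists>i\<in>{4, 5, 6}. \<forall>y\<in>K. y i = i)"
    obtain p where p: "p \<in> K" "p 4 \<noteq> 4" using no by blast
    obtain r where r: "r \<in> K" "r 5 \<noteq> 5" using no by blast
    obtain s where s: "s \<in> K" "s 6 \<noteq> 6" using no by blast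
    have sw: "y 4 = 4 \<and> (y 5 = 5 \<and> y 6 = 6 \<or> y 5 = 6 \<and> y 6 = 5) \<or> y 5 = 5 \<and> y 4 = 6 \<and> y 6 = 4 \<or> y 6 = 6 \<and> y 4 = 5 \<and> y 5 = 4"
      if y: "y \<in> K" for y
    proof -
      have "y 4 \<in> {4, 5, 6}" "y 5 \<in> {4, 5, 6}" "y 6 \<in> {4, 5, 6}" using N'[OF y] by blast+
      moreover have "y 4 \<noteq> y 5" "y 4 \<noteq> y 6" "y 5 \<noteq> y 6" using permutes_inject[OF perm[OF y]] by simp_all
      ultimately show ?thesis using fxp[OF y] by (elim insertE emptyE) simp_all
    qed
    have pr: "p \<circ> r \<in> K" and ps: "p \<circ> s \<in> K" using Sym_subgroup_comp[OF K] p(1) r(1) s(1) by blast+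
    consider "p 5 = 5" "p 4 = 6" "p 6 = 4" | "p 6 = 6" "p 4 = 5" "p 5 = 4" using sw[OF p(1)] p(2) by blast
    then show False
    proof cases
      case 1
      have "r 4 = 4 \<and> r 5 = 6 \<and> r 6 = 5 \<or> r 6 = 6 \<and> r 4 = 5 \<and> r 5 = 4" using sw[OF r(1)] r(2) by blast
      then show ?thesis using fxp[OF pr] 1 by (elim disjE conjE) simp_all
    next
      case 2
      have "s 4 = 4 \<and> s 5 = 6 \<and> s 6 = 5 \<or> s 5 = 5 \<and> s 4 = 6 \<and> s 6 = 4" using sw[OF s(1)] s(2) by blast
      then show ?thesis using fxp[OF ps] 2 by (elim disjE conjE) simp_all
    qed
  qed
  then obtain i where i: "i \<in> {4, 5, 6}" "\<forall>y\<in>K. y i = i" by blast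
  have t: "tr i 6 permutes {1..6}" using i(1) by (intro permutes_swap_id) auto
  let ?h = "tr i 6"
  have inv: "inv' ?h = ?h" by (rule inv_unique_comp) simp_all
  have himg: "?h ` {4, 5} = {4, 5, 6} - {i}"
    using i(1) by (elim insertE emptyE) (auto simp: Transposition.transpose_def)
  have "K \<subseteq> pconj ?h D12"
  proof
    fix y assume y: "y \<in> K"
    let ?d = "?h \<circ> y \<circ> ?h"
    have yi0: "y i = i" using i(2) y by blast
    have "?d permutes {1..6}" by (rule permutes_compose[OF t permutes_compose[OF perm[OF y] t]])
    moreover have "?d 6 = 6" using yi0 by simp
    moreover have "?d ` {4, 5} = {4, 5}"
    proof -
      have "y ` ({4, 5, 6} - {i}) = y ` {4, 5, 6} - y ` {i}"
        by (rule image_set_diff[OF permutes_inj[OF perm[OF y]]])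
      also have "\<dots> = {4, 5, 6} - {i}" unfolding N'[OF y] using yi0 by simp
      finally have yi: "y ` (?h ` {4, 5}) = ?h ` {4, 5}" unfolding himg .
      have "?d ` {4, 5} = ?h ` (y ` (?h ` {4, 5}))" by (simp only: image_comp o_assoc)
      also have "\<dots> = {4, 5}" unfolding yi by (simp add: image_comp del: image_insert)
      finally show ?thesis .
    qed
    ultimately have "?d \<in> D12" by (simp add: D12_def)
    then show "y \<in> pconj ?h D12" unfolding pconj_mem[OF t] inv .
  qed
  then have "K = pconj ?h D12"
    using pconj_subgroup[OF t subgroup_D12] c card_D12 Sym_subgroup_finite
    by (intro card_subset_eq) simp_all
  then show ?thesis using that[OF t] by blast
qed

text \<open>Move the three-cycle to (1 2 3). Either the whole subgroup preserves {1, 2, 3}, or some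
  conjugate of (1 2 3) inside it has another support; the two preceding lemmas settle these
  cases.\<close>

lemma order_12_three_cycle:
  assumes K: "subgroup K (Sym 6)" and c: "card K = 12"
    and p: "cyc a b d \<in> K" "distinct [a, b, d]" "{a, b, d} \<subseteq> {1..6}"
  obtains h where "h permutes {1..6}" "K = pconj h A4 \<or> K = pconj h D12"
proof -
  obtain g where g: "g permutes {1..6}" "g 1 = a" "g 2 = b" "g 3 = d" using even_perm_ex[OF p(2,3)] by blast
  note ig = permutes_inv[OF g(1)]
  let ?K = "pconj (inv' g) K"
  have gK: "pconj g ?K = K" by (rule pconj_inv_pconj[OF g(1)])
  have K': "subgroup ?K (Sym 6)" "card ?K = 12" using pconj_subgroup[OF ig K] c by simp_all
  have x: "cyc 1 2 3 \<in> ?K" using pconj_cyc_mem[OF g(1), of 1 2 3 ?K] p(1) unfolding gK g(2-4) by simp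
  have "\<exists>h. h permutes {1..6} \<and> (?K = pconj h A4 \<or> ?K = pconj h D12)"
  proof (cases "\<forall>y\<in>?K. y ` {1, 2, 3} = {1, 2, 3}")
    case True
    then show ?thesis using order_12_normal[OF K' x] by metis
  next
    case False
    then obtain y where y: "y \<in> ?K" "{y 1, y 2, y 3} \<noteq> {1, 2, 3}" by auto
    note yp = Sym_subgroup_perm[OF K'(1) y(1)]
    have "y \<circ> cyc 1 2 3 \<circ> inv' y \<in> ?K"
      using Sym_subgroup_comp[OF K'(1)] Sym_subgroup_inv[OF K'(1)] x y(1) by blast
    then have "cyc (y 1) (y 2) (y 3) \<in> ?K" unfolding cyc_conj[OF yp] .
    moreover have "distinct [y 1, y 2, y 3]" using permutes_inject[OF yp] by simp
    moreover have "{y 1, y 2, y 3} \<subseteq> {1..6}"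
      using permutes_in_image[OF yp, of 1] permutes_in_image[OF yp, of 2] permutes_in_image[OF yp, of 3] by simp
    ultimately show ?thesis using order_12_not_normal[OF K' x] y(2) by metis
  qed
  then obtain h where h: "h permutes {1..6}" "?K = pconj h A4 \<or> ?K = pconj h D12" by blast
  have "pconj g (pconj h H) = pconj (g \<circ> h) H" for H
  proof -
    have "inv' (g \<circ> h) = inv' h \<circ> inv' g"
      using permutes_bij[OF g(1)] permutes_bij[OF h(1)] by (rule o_inv_distrib)
    then show ?thesis unfolding pconj_def image_image by (simp only: o_assoc)
  qed
  then have "K = pconj (g \<circ> h) A4 \<or> K = pconj (g \<circ> h) D12" using h(2) gK by auto
  then show ?thesis using that[OF permutes_compose[OF h(1) g(1)]] by blast
qed

lemma six_hom_outer6: "six_hom (carrier (Sym 6)) outer6"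
proof (rule six_hom_iso)
  show "outer6 \<in> iso (Sym 6) (Sym 6)"
    using outer6_outer_involution[of "Sym 6"] outer_involution_iff[of "Sym 6" outer6] by blast
qed simp

lemma outer6_inv: "p permutes {1..6} \<Longrightarrow> outer6 (inv' p) = inv' (outer6 p)"
  by (rule outer6_eq[OF syn_rel_inv[OF syn_rel_outer6]])

lemma fixed_outer6_three:
  assumes "p permutes {1..6}" "fixed 6 p = 3" shows "fixed 6 (outer6 p) = 0"
proof -
  obtain a b c where abc: "distinct [a, b, c]" "{a, b, c} \<subseteq> {1..6}" "p = cyc a b c"
    using fixed_3_cyc[OF assms] by blast
  show ?thesis unfolding abc(3)
    by (rule six_hom.fixed_\<phi>_three_cycle[OF six_hom_outer6 _ abc(1,2)]) (simp add: fixed_outer6_cyc)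
qed

lemma fixed_outer6_transpose:
  assumes "p permutes {1..6}" "fixed 6 p = 4" shows "fixed 6 (outer6 p) = 0"
proof -
  obtain a b where ab: "a \<noteq> b" "a \<in> {1..6}" "b \<in> {1..6}" "p = tr a b"
    using fixed_4_transpose[OF assms] by blast
  show ?thesis unfolding ab(4)
    by (rule six_hom.fixed_\<phi>_transpose[OF six_hom_outer6 _ _ ab(1-3)])
       (use assms(1) ab(4) in \<open>simp_all add: fixed_outer6_cyc carrier_Sym\<close>)
qed

text \<open>Sylow's theorem for the prime three, as 12 = 3 times 4.\<close>

lemma order_3_ex:
  assumes K: "subgroup K (Sym q)" and c: "card K = 12"
  obtains x where "x \<in> K" "x \<noteq> id" "x \<circ> (x \<circ> x) = id"
proof -
  have G: "group (Sym q\<lparr>carrier := K\<rparr>)" by (rule group.subgroup_imp_group[OF group_Sym K])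
  have o: "order (Sym q\<lparr>carrier := K\<rparr>) = 3 ^ 1 * 4" using c by (simp add: order_def)
  have fin: "finite (carrier (Sym q\<lparr>carrier := K\<rparr>))" using Sym_subgroup_finite[OF K] by simp
  have "\<exists>P. subgroup P (Sym q\<lparr>carrier := K\<rparr>) \<and> card P = 3 ^ 1"
    by (rule sylow_thm[OF _ G o fin]) simp
  then obtain P where P: "subgroup P (Sym q\<lparr>carrier := K\<rparr>)" "card P = 3" by auto
  have PK: "P \<subseteq> K" using subgroup.subset[OF P(1)] by simp
  have P': "subgroup P (Sym q)" by (rule group.incl_subgroup[OF group_Sym K P(1)])
  have "\<not> P \<subseteq> {id}"
  proof
    assume "P \<subseteq> {id}"
    then have "card P \<le> card {id :: nat \<Rightarrow> nat}" by (intro card_mono) simp_all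
    then show False using P(2) by simp
  qed
  then obtain x where x: "x \<in> P" "x \<noteq> id" by blast
  have p3: "p ^^ 3 = p \<circ> (p \<circ> p)" for p :: "nat \<Rightarrow> nat"
    by (simp add: numeral_3_eq_3 comp_assoc)
  have "x \<circ> (x \<circ> x) = id" using Sym_subgroup_funpow_card[OF P' x(1)] unfolding P(2) p3 .
  then show ?thesis using that x PK by blast
qed

text \<open>The six points split into the orbits of 1 and of some \<open>d\<close>; listing both in
  cyclic order defines \<open>h\<close>.\<close>

lemma fixfree_order_3_conj:
  assumes x: "x permutes {1..6}" and x3: "x \<circ> (x \<circ> x) = id" and f: "fixed 6 x = 0"
  obtains h where "h permutes {1..6}" "x = h \<circ> (cyc 1 2 3 \<circ> cyc 4 5 6) \<circ> inv' h"
proof -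
  have xxx: "x (x (x i)) = i" for i using fun_cong[OF x3, of i] by simp
  have inj: "x i = x j \<longleftrightarrow> i = j" for i j by (rule permutes_inject[OF x])
  have "{i \<in> {1..6}. x i = i} = {}" using f by (simp add: fixed_def)
  then have ne: "x i \<noteq> i" if "i \<in> {1..6}" for i using that by blast
  have mem: "x i \<in> {1..6} \<longleftrightarrow> i \<in> {1..6}" for i by (rule permutes_in_image[OF x])
  have one: "1 \<in> {1..6::nat}" by simp
  have "\<not> {1..6} \<subseteq> {1, x 1, x (x 1)}"
  proof
    assume "{1..6} \<subseteq> {1, x 1, x (x 1)}"
    then have "card {1..6::nat} \<le> card {1, x 1, x (x 1)}" by (intro card_mono) simp_all
    also have "\<dots> \<le> 3" by (simp add: card_insert_if)
    finally show False by simp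
  qed
  then obtain d where d: "d \<in> {1..6}" "d \<notin> {1, x 1, x (x 1)}" by blast
  define g where "g = [1, x 1, x (x 1), d, x d, x (x d)]"
  have o: "x i \<noteq> i" "x (x i) \<noteq> i" "x (x i) \<noteq> x i" if "i \<in> {1..6}" for i
    using ne[OF that] xxx[of i] inj[of "x i" i] by auto
  have dd: "d \<noteq> 1" "d \<noteq> x 1" "d \<noteq> x (x 1)" using d(2) by simp_all
  have dd': "x d \<noteq> 1" "x d \<noteq> x 1" "x d \<noteq> x (x 1)" "x (x d) \<noteq> 1" "x (x d) \<noteq> x 1" "x (x d) \<noteq> x (x 1)"
  proof -
    show "x d \<noteq> x 1" "x d \<noteq> x (x 1)" "x (x d) \<noteq> x (x 1)" using dd by (simp_all add: inj)
    show "x d \<noteq> 1"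
    proof
      assume "x d = 1"
      then have "x (x (x d)) = x (x 1)" by simp
      then show False using dd(3) by (simp add: xxx)
    qed
    show "x (x d) \<noteq> 1"
    proof
      assume "x (x d) = 1"
      then have "x (x (x d)) = x 1" by simp
      then show False using dd(2) by (simp add: xxx)
    qed
    show "x (x d) \<noteq> x 1"
    proof
      assume "x (x d) = x 1"
      then have "x (x (x d)) = x (x 1)" by simp
      then show False using dd(3) by (simp add: xxx)
    qed
  qed
  have dist: "distinct g" unfolding g_def
    using o[OF one] o[OF d(1)] dd dd' o[OF one, symmetric] o[OF d(1), symmetric] dd[symmetric] dd'[symmetric]
    by (simp only: distinct.simps list.set insert_iff empty_iff simp_thms)
  have setg: "set g \<subseteq> {1..6}" unfolding g_def using one d(1) mem by (simp del: atLeastAtMost_iff)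
  define h where "h i = (if i \<in> {1..6} then g ! (i - 1) else i)" for i
  have hv: "h 1 = 1" "h 2 = x 1" "h 3 = x (x 1)" "h 4 = d" "h 5 = x d" "h 6 = x (x d)"
    by (simp_all add: h_def g_def)
  have six: "{1..6} = {1, 2, 3, 4, 5, 6::nat}" by auto
  have img: "h ` {1..6} = set g" unfolding six by (simp add: hv) (simp add: g_def)
  have "card (set g) = 6" using distinct_card[OF dist] by (simp add: g_def)
  then have "inj_on h {1..6}" using img by (intro eq_card_imp_inj_on) simp_all
  moreover have "h ` {1..6} \<subseteq> {1..6}" using img setg by simp
  ultimately have "bij_betw h {1..6} {1..6}"
    using endo_inj_surj[of "{1..6}" h] by (simp add: bij_betw_def)
  then have h: "h permutes {1..6}"
  proof (rule bij_imp_permutes)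
    show "h z = z" if "z \<notin> {1..6}" for z unfolding h_def using that by (rule if_not_P)
  qed
  let ?x0 = "cyc 1 2 3 \<circ> cyc 4 5 6"
  have ev: "?x0 1 = 2" "?x0 2 = 3" "?x0 3 = 1" "?x0 4 = 5" "?x0 5 = 6" "?x0 6 = 4"
    by (simp_all add: cyc_def)
  have x0o: "?x0 i = i" if "i \<notin> {1..6}" for i
  proof -
    have "i \<notin> {4, 5, 6}" "i \<notin> {1, 2, 3}" using that by auto
    then show ?thesis by (simp add: cyc_def)
  qed
  have "\<forall>i\<in>{1..6}. x (h i) = h (?x0 i)" unfolding all6 by (simp only: ev hv xxx simp_thms)
  then have xh: "x (h i) = h (?x0 i)" for i
    using x0o[of i] permutes_not_in[OF h, of i] permutes_not_in[OF x, of i] by (cases "i \<in> {1..6}") simp_all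
  have "x i = (h \<circ> ?x0 \<circ> inv' h) i" for i
    using xh[of "inv' h i"] by (simp add: permutes_inverses[OF h])
  then have "x = h \<circ> ?x0 \<circ> inv' h" by (rule ext)
  then show ?thesis using that[OF h] by blast
qed

lemma outer6_conj:
  "h permutes {1..6} \<Longrightarrow> p permutes {1..6} \<Longrightarrow> outer6 (h \<circ> p \<circ> inv' h) = outer6 h \<circ> outer6 p \<circ> inv' (outer6 h)"
  by (simp add: outer6_comp permutes_compose permutes_inv outer6_inv)

text \<open>The element \<open>outer6 (cyc 1 2 3)\<close> is also of order three without fixed
  points, hence conjugate to \<open>x\<close>. Applying the involution \<open>outer6\<close> makes
  \<open>outer6 x\<close> conjugate to (1 2 3).\<close>

lemma fixed_outer6_fixfree_order_3:
  assumes x: "x permutes {1..6}" "x \<circ> (x \<circ> x) = id" "fixed 6 x = 0"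
  shows "fixed 6 (outer6 x) = 3"
proof -
  let ?x0 = "cyc 1 2 3 \<circ> cyc 4 5 6" and ?c = "cyc 1 2 3"
  have d: "distinct [1, 2, 3::nat]" "{1, 2, 3} \<subseteq> {1..6::nat}" by auto
  have c: "?c permutes {1..6}" by (rule cyc_permutes[OF d])
  have "?c \<circ> (?c \<circ> ?c) = id" by (simp add: fun_eq_iff cyc_cyc_cyc[OF d(1)])
  then have oc: "outer6 ?c \<circ> (outer6 ?c \<circ> outer6 ?c) = id"
    using outer6_comp[OF c permutes_compose[OF c c]] outer6_comp[OF c c] outer6_eq[OF syn_rel_id] by simp
  obtain h where h: "h permutes {1..6}" "x = h \<circ> ?x0 \<circ> inv' h" using fixfree_order_3_conj[OF x] by blast
  obtain k where k: "k permutes {1..6}" "outer6 ?c = k \<circ> ?x0 \<circ> inv' k"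
    using fixfree_order_3_conj[OF outer6_permutes[OF c] oc fixed_outer6_cyc] by blast
  have x0: "?x0 permutes {1..6}" by (intro permutes_compose cyc_permutes) auto
  have "fixed 6 (outer6 x) = fixed 6 (outer6 ?x0)"
    unfolding h(2) outer6_conj[OF h(1) x0] by (rule fixed_conj[OF outer6_permutes[OF h(1)]])
  also have "\<dots> = fixed 6 (outer6 (outer6 ?c))"
    unfolding k(2) outer6_conj[OF k(1) x0] by (rule fixed_conj[OF outer6_permutes[OF k(1)], symmetric])
  also have "\<dots> = 3" unfolding outer6_outer6[OF c] by (rule fixed_cyc[OF d])
  finally show ?thesis .
qed

lemma outer6_image_subgroup:
  assumes K: "subgroup K (Sym 6)"
  shows "subgroup (outer6 ` K) (Sym 6)" "card (outer6 ` K) = card K" "outer6 ` outer6 ` K = K"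
proof -
  have perm: "p permutes {1..6}" if "p \<in> K" for p by (rule Sym_subgroup_perm[OF K that])
  show "subgroup (outer6 ` K) (Sym 6)"
  proof (rule subgroup_SymI)
    show "p permutes {1..6}" if "p \<in> outer6 ` K" for p using that perm outer6_permutes by blast
    show "id \<in> outer6 ` K" using Sym_subgroup_id[OF K] outer6_eq[OF syn_rel_id] by (intro image_eqI[of _ _ id]) simp_all
    show "p \<circ> r \<in> outer6 ` K" if pr: "p \<in> outer6 ` K" "r \<in> outer6 ` K" for p r
    proof -
      obtain a b where ab: "a \<in> K" "b \<in> K" "p = outer6 a" "r = outer6 b" using pr by blast
      have "p \<circ> r = outer6 (a \<circ> b)" unfolding ab(3,4) by (rule outer6_comp[OF perm[OF ab(1)] perm[OF ab(2)], symmetric])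
      then show ?thesis using Sym_subgroup_comp[OF K ab(1,2)] by blast
    qed
    show "inv' p \<in> outer6 ` K" if p: "p \<in> outer6 ` K" for p
    proof -
      obtain a where a: "a \<in> K" "p = outer6 a" using p by blast
      have "inv' p = outer6 (inv' a)" unfolding a(2) by (rule outer6_inv[OF perm[OF a(1)], symmetric])
      then show ?thesis using Sym_subgroup_inv[OF K a(1)] by blast
    qed
  qed
  have "inj_on outer6 K"
    by (rule inj_on_inverseI[of _ outer6]) (rule outer6_outer6[OF perm])
  then show "card (outer6 ` K) = card K" by (rule card_image)
  have "outer6 ` outer6 ` K = (\<lambda>p. p) ` K"
    unfolding image_image by (rule image_cong[OF refl]) (rule outer6_outer6[OF perm])
  then show "outer6 ` outer6 ` K = K" by simp
qed

lemma outer6_pconj: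
  assumes h: "h permutes {1..6}" and K: "subgroup K (Sym 6)"
  shows "outer6 ` pconj h K = pconj (outer6 h) (outer6 ` K)"
  unfolding pconj_def image_image
  by (rule image_cong[OF refl]) (rule outer6_conj[OF h Sym_subgroup_perm[OF K]])

abbreviation order_12_reps :: "(nat \<Rightarrow> nat) set list"
  where "order_12_reps \<equiv> [A4, D12, outer6 ` A4, outer6 ` D12]"

lemma order_12_reps_subgroups: "H \<in> set order_12_reps \<Longrightarrow> subgroup H (Sym 6) \<and> card H = 12"
  using subgroup_A4 subgroup_D12 outer6_image_subgroup(1,2)[OF subgroup_A4]
    outer6_image_subgroup(1,2)[OF subgroup_D12] card_A4 card_D12 by auto

lemma order_12_conjugate:
  assumes K: "subgroup K (Sym 6)" and c: "card K = 12"
  obtains H where "H \<in> set order_12_reps" "conjugate (Sym 6) H K"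
proof -
  obtain x where x: "x \<in> K" "x \<noteq> id" "x \<circ> (x \<circ> x) = id" using order_3_ex[OF K c] by blast
  note xp = Sym_subgroup_perm[OF K x(1)]
  have xxx: "x (x (x i)) = i" for i using fun_cong[OF x(3), of i] by simp
  have sub: "H \<subseteq> carrier (Sym 6)" if "H \<in> set order_12_reps" for H
    using order_12_reps_subgroups[OF that] subgroup.subset by blast
  have mem: "A4 \<in> set order_12_reps" "D12 \<in> set order_12_reps"
    "outer6 ` A4 \<in> set order_12_reps" "outer6 ` D12 \<in> set order_12_reps" by simp_all
  have key: "\<exists>h. h permutes {1..6} \<and> (L = pconj h A4 \<or> L = pconj h D12)"
    if L: "subgroup L (Sym 6)" "card L = 12" "y \<in> L" "fixed 6 y = 3" for L y
  proof -
    obtain a b d where abd: "distinct [a, b, d]" "{a, b, d} \<subseteq> {1..6}" "y = cyc a b d"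
      using fixed_3_cyc[OF Sym_subgroup_perm[OF L(1,3)] L(4)] by blast
    show ?thesis using order_12_three_cycle[OF L(1,2) _ abd(1,2)] L(3) unfolding abd(3) by blast
  qed
  show ?thesis
  proof (cases "fixed 6 x = 3")
    case True
    obtain h where h: "h permutes {1..6}" "K = pconj h A4 \<or> K = pconj h D12" using key[OF K c x(1) True] by blast
    then show ?thesis
      using conjugate_pconj[OF h(1) sub[OF mem(1)]] conjugate_pconj[OF h(1) sub[OF mem(2)]]
        that[OF mem(1)] that[OF mem(2)] by (elim disjE) simp_all
  next
    case False
    then have f0: "fixed 6 x = 0" using fixed_order_3[OF xp x(2) xxx] by blast
    note o = outer6_image_subgroup[OF K]
    have "outer6 x \<in> outer6 ` K" using x(1) by (rule imageI)
    from key[OF o(1) _ this fixed_outer6_fixfree_order_3[OF xp x(3) f0]]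
    obtain h where h: "h permutes {1..6}" "outer6 ` K = pconj h A4 \<or> outer6 ` K = pconj h D12"
      using o(2) c by auto
    have "K = pconj (outer6 h) (outer6 ` A4) \<or> K = pconj (outer6 h) (outer6 ` D12)"
      using h(2) o(3) unfolding outer6_pconj[OF h(1) subgroup_A4, symmetric] outer6_pconj[OF h(1) subgroup_D12, symmetric]
      by (elim disjE) simp_all
    then show ?thesis
      using conjugate_pconj[OF outer6_permutes[OF h(1)] sub[OF mem(3)]]
        conjugate_pconj[OF outer6_permutes[OF h(1)] sub[OF mem(4)]]
        that[OF mem(3)] that[OF mem(4)] by (elim disjE) simp_all
  qed
qed

text \<open>Containing a three-cycle is invariant under conjugation and separates the first two
  groups from the last two. Containing a transposition separates \<open>D12\<close> from
  \<open>A4\<close>, and \<open>outer6\<close> transfers this to their images.\<close>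

lemma order_12_reps_not_conjugate:
  assumes i: "i < 4" and j: "j < 4" and c: "conjugate (Sym 6) (order_12_reps ! i) (order_12_reps ! j)"
  shows "i = j"
proof -
  define t3 where "t3 K \<longleftrightarrow> (\<exists>p\<in>K. fixed 6 p = 3)" for K
  define t4 where "t4 K \<longleftrightarrow> (\<exists>p\<in>K. fixed 6 p = 4)" for K
  have H: "subgroup (order_12_reps ! k) (Sym 6)" if "k < 4" for k
    using order_12_reps_subgroups[of "order_12_reps ! k"] nth_mem[of k order_12_reps] that by simp
  have Hs: "H \<subseteq> carrier (Sym 6)" if "subgroup H (Sym 6)" for H using subgroup.subset[OF that] .
  have inv: "(\<exists>p\<in>K. fixed 6 p = n) \<longleftrightarrow> (\<exists>p\<in>H. fixed 6 p = n)"
    if sH: "subgroup H (Sym 6)" and cHK: "conjugate (Sym 6) H K" for H K n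
  proof -
    obtain g where g: "g permutes {1..6}" "K = (\<lambda>h. g \<circ> h \<circ> inv' g) ` H"
      using cHK Sym_conjugate_iff[OF Hs[OF sH]] by blast
    show ?thesis unfolding g(2) by (simp only: bex_simps fixed_conj[OF g(1)])
  qed
  have perm: "p permutes {1..6}" if "p \<in> A4 \<or> p \<in> D12" for p using that by (auto simp: A4_def D12_def)
  have A3: "t3 A4" and D3: "t3 D12"
  proof -
    have d: "distinct [1, 2, 3::nat]" "{1, 2, 3} \<subseteq> {1..6::nat}" by auto
    have e: "cyc 1 2 3 4 = 4" "cyc 1 2 3 5 = 5" "cyc 1 2 3 6 = 6" by (simp_all add: cyc_def)
    have "cyc 1 2 3 \<in> A4" "cyc 1 2 3 \<in> D12"
      using cyc_permutes[OF d] evenperm_cyc[OF d(1)] e by (simp_all add: A4_def D12_def)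
    then show "t3 A4" "t3 D12" using fixed_cyc[OF d] unfolding t3_def by blast+
  qed
  \<comment> \<open>All elements of \<open>A4\<close> and \<open>D12\<close> fix 6, while
    \<open>outer6\<close> turns a three-cycle into an element without fixed points.\<close>
  have O3: "\<not> t3 (outer6 ` A4)" "\<not> t3 (outer6 ` D12)"
  proof -
    have "fixed 6 (outer6 p) \<noteq> 3" if p: "p \<in> A4 \<or> p \<in> D12" for p
    proof
      note pp = perm[OF p]
      assume "fixed 6 (outer6 p) = 3"
      from fixed_outer6_three[OF outer6_permutes[OF pp] this] have "fixed 6 p = 0" by (simp add: outer6_outer6[OF pp])
      then have "{i \<in> {1..6}. p i = i} = {}" by (simp add: fixed_def)
      moreover have "p 6 = 6" using p by (auto simp: A4_def D12_def)
      then have "6 \<in> {i \<in> {1..6}. p i = i}" by simp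
      ultimately show False by blast
    qed
    then show "\<not> t3 (outer6 ` A4)" "\<not> t3 (outer6 ` D12)" unfolding t3_def by blast+
  qed
  have A4': "\<not> t4 A4"
  proof -
    have "fixed 6 p \<noteq> 4" if p: "p \<in> A4" for p
    proof
      assume "fixed 6 p = 4"
      then obtain a b where "a \<noteq> b" "p = tr a b" using fixed_4_transpose[OF perm] p by blast
      then show False using p by (simp add: A4_def evenperm_transpose)
    qed
    then show ?thesis unfolding t4_def by blast
  qed
  have D4': "t4 D12"
  proof -
    have "tr 4 5 permutes {1..6}" by (rule permutes_swap_id) auto
    then have "tr 4 5 \<in> D12" by (auto simp: D12_def Transposition.transpose_def)
    moreover have "fixed 6 (tr 4 5) = 4" by (rule fixed_tr) auto
    ultimately show ?thesis unfolding t4_def by blast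
  qed
  have o: "conjugate (Sym 6) (outer6 ` L) (outer6 ` M)" if c: "conjugate (Sym 6) L M" and L: "subgroup L (Sym 6)" for L M
  proof -
    obtain g where g: "g permutes {1..6}" "M = pconj g L"
      using c Sym_conjugate_iff[OF Hs[OF L]] unfolding pconj_def by blast
    show ?thesis unfolding g(2) outer6_pconj[OF g(1) L]
      by (rule conjugate_pconj[OF outer6_permutes[OF g(1)] Hs[OF outer6_image_subgroup(1)[OF L]]])
  qed
  note oo = outer6_image_subgroup(3)[OF subgroup_A4] outer6_image_subgroup(3)[OF subgroup_D12]
  define T3 where "T3 k \<longleftrightarrow> t3 (order_12_reps ! k)" for k
  have T3: "T3 0" "T3 1" "\<not> T3 2" "\<not> T3 3" using A3 D3 O3 by (simp_all add: T3_def numeral_3_eq_3 numeral_2_eq_2)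
  have e3: "T3 i = T3 j" using inv[OF H[OF i] c, of 3] unfolding T3_def t3_def by simp
  have AD: "\<not> conjugate (Sym 6) A4 D12" using inv[OF subgroup_A4, of D12 4] A4' D4' unfolding t4_def by blast
  have DA: "\<not> conjugate (Sym 6) D12 A4" using inv[OF subgroup_D12, of A4 4] A4' D4' unfolding t4_def by blast
  have oAD: "\<not> conjugate (Sym 6) (outer6 ` A4) (outer6 ` D12)"
    using o[OF _ outer6_image_subgroup(1)[OF subgroup_A4], of "outer6 ` D12"] AD unfolding oo by blast
  have oDA: "\<not> conjugate (Sym 6) (outer6 ` D12) (outer6 ` A4)"
    using o[OF _ outer6_image_subgroup(1)[OF subgroup_D12], of "outer6 ` A4"] DA unfolding oo by blast
  have nth: "order_12_reps ! 0 = A4" "order_12_reps ! 1 = D12"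
    "order_12_reps ! 2 = outer6 ` A4" "order_12_reps ! 3 = outer6 ` D12"
    by (simp_all add: numeral_3_eq_3 numeral_2_eq_2 One_nat_def)
  have lt4: "k < 4 \<Longrightarrow> k = 0 \<or> k = 1 \<or> k = 2 \<or> k = 3" for k :: nat by auto
  show ?thesis
    using lt4[OF i] lt4[OF j] e3 T3 c AD DA oAD oDA by (elim disjE) (simp_all add: nth)
qed

lemma class_reps_order_12: "class_reps (Sym 6) (subgroups_of_order (Sym 6) 12) order_12_reps"
  unfolding class_reps_def
proof (intro conjI ballI)
  show "set order_12_reps \<subseteq> subgroups_of_order (Sym 6) 12"
    using order_12_reps_subgroups by (auto simp: subgroups_of_order_def)
  fix K assume "K \<in> subgroups_of_order (Sym 6) 12"
  then have K: "subgroup K (Sym 6)" "card K = 12" by (auto simp: subgroups_of_order_def)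
  obtain H where H: "H \<in> set order_12_reps" "conjugate (Sym 6) H K" using order_12_conjugate[OF K] by blast
  then obtain i where i: "i < length order_12_reps" "order_12_reps ! i = H" by (auto simp only: in_set_conv_nth)
  have sub: "order_12_reps ! k \<subseteq> carrier (Sym 6)" if "k < length order_12_reps" for k
    using order_12_reps_subgroups[OF nth_mem[OF that]] subgroup.subset by blast
  show "\<exists>!i. i < length order_12_reps \<and> conjugate (Sym 6) (order_12_reps ! i) K"
  proof (rule ex1I)
    show "i < length order_12_reps \<and> conjugate (Sym 6) (order_12_reps ! i) K" using i H(2) by simp
    fix j assume j: "j < length order_12_reps \<and> conjugate (Sym 6) (order_12_reps ! j) K"
    have "conjugate (Sym 6) K (order_12_reps ! i)"
      by (rule conjugate_sym[OF group_Sym sub[OF i(1)]]) (simp only: i(2) H(2))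
    then have "conjugate (Sym 6) (order_12_reps ! j) (order_12_reps ! i)"
      using conjugate_trans[OF group_Sym sub] j by blast
    then show "j = i" using order_12_reps_not_conjugate j i(1) by simp
  qed
qed

text \<open>Match every member of \<open>Ks\<close> with the member of \<open>Hs\<close> in its
  class. Two members matched alike would be conjugate, hence equal in position. This reduces
  arbitrary representatives to the explicit ones.\<close>

lemma class_reps_bij:
  assumes G: "group G" and \<F>: "\<And>H. H \<in> \<F> \<Longrightarrow> H \<subseteq> carrier G"
    and Hs: "class_reps G \<F> Hs" and Ks: "class_reps G \<F> Ks" and len: "length Hs = length Ks"
  obtains \<pi> where "bij_betw \<pi> {..<length Ks} {..<length Ks}"
    "\<forall>j<length Ks. conjugate G (Hs ! \<pi> j) (Ks ! j)"
proof -
  let ?n = "length Ks"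
  have mem: "Ks ! j \<in> \<F>" "Hs ! j \<in> \<F>" if "j < ?n" for j
    using Ks Hs that len nth_mem unfolding class_reps_def by (metis subsetD)+
  have "\<forall>j. \<exists>i. j < ?n \<longrightarrow> i < ?n \<and> conjugate G (Hs ! i) (Ks ! j)"
    using Hs mem(1) len unfolding class_reps_def by metis
  then obtain \<pi> where \<pi>: "\<And>j. j < ?n \<Longrightarrow> \<pi> j < ?n \<and> conjugate G (Hs ! \<pi> j) (Ks ! j)" by metis
  have "inj_on \<pi> {..<?n}"
  proof (rule inj_onI)
    fix j k assume "j \<in> {..<?n}" "k \<in> {..<?n}" and eq: "\<pi> j = \<pi> k"
    then have jk: "j < ?n" "k < ?n" by simp_all
    have s: "Hs ! \<pi> j \<subseteq> carrier G" using \<F> mem(2) \<pi>[OF jk(1)] by blast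
    have "conjugate G (Ks ! j) (Hs ! \<pi> j)" using conjugate_sym[OF G s] \<pi>[OF jk(1)] by blast
    then have "conjugate G (Ks ! j) (Ks ! k)"
      using conjugate_trans[OF G \<F>[OF mem(1)[OF jk(1)]]] \<pi>[OF jk(2)] eq by simp
    moreover have "conjugate G (Ks ! k) (Ks ! k)" by (rule conjugate_refl[OF G \<F>[OF mem(1)[OF jk(2)]]])
    moreover have "\<exists>!i. i < ?n \<and> conjugate G (Ks ! i) (Ks ! k)"
      using Ks mem(1)[OF jk(2)] unfolding class_reps_def by blast
    ultimately show "j = k" using jk by blast
  qed
  moreover have "\<pi> ` {..<?n} \<subseteq> {..<?n}" using \<pi> by auto
  ultimately have "bij_betw \<pi> {..<?n} {..<?n}"
    using endo_inj_surj[of "{..<?n}" \<pi>] by (simp add: bij_betw_def)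
  then show ?thesis using that \<pi> by blast
qed

section \<open>Possible vectors of fixed-point counts on the four coset spaces\<close>

section \<open>The numbers of fixed points\<close>

text \<open>The index \<open>k\<close> follows the order of \<open>order_12_reps\<close>.\<close>

definition fix12 :: "nat \<Rightarrow> (nat \<Rightarrow> nat) \<Rightarrow> nat"
  where "fix12 k t = [fixA t, fixD t, fixA (outer6 t), fixD (outer6 t)] ! k"

lemma fixed_order_12_reps:
  assumes k: "k < 4" and c: "conjugate (Sym 6) (order_12_reps ! k) K" and K: "subgroup K (Sym 6)"
    and l: "labelling (Sym 6) K q l" and t: "t permutes {1..6}"
  shows "fixed q (coset_rep (Sym 6) q l t) = fix12 k t"
proof -
  have s: "A4 \<subseteq> {p. p permutes {1..6}}" "D12 \<subseteq> {p. p permutes {1..6}}" by (auto simp: A4_def D12_def)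
  have sub: "subgroup (order_12_reps ! k) (Sym 6)"
    using order_12_reps_subgroups[of "order_12_reps ! k"] nth_mem[of k order_12_reps] k by simp
  note ot = outer6_permutes[OF t]
  note oA = fixed_coset_map[OF coset_map_outer6[OF coset_map_A4 s(1)] _ _ K l t,
    unfolded image_outer6[of "\<lambda>g. (g 5, g 6, evenperm g)"] card_fix_A4[OF ot]]
  note oD = fixed_coset_map[OF coset_map_outer6[OF coset_map_D12 s(2)] _ _ K l t,
    unfolded image_outer6[of "\<lambda>g. (g 6, g ` {4, 5})"] card_fix_D12[OF ot]]
  note A = fixed_coset_map[OF coset_map_A4 _ _ K l t, unfolded card_fix_A4[OF t]]
  note D = fixed_coset_map[OF coset_map_D12 _ _ K l t, unfolded card_fix_D12[OF t]]
  have lt4: "k = 0 \<or> k = 1 \<or> k = 2 \<or> k = 3" using k by auto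
  then show ?thesis
    using c subgroup.subset[OF sub] A D oA oD
    by (elim disjE) (simp_all add: fix12_def numeral_3_eq_3 numeral_2_eq_2 One_nat_def)
qed

text \<open>Interchanged pairs are pairwise disjoint and consist of moved points.\<close>

lemma swapped_bound:
  assumes t: "t permutes {1..6}" shows "2 * card (swapped t) + fixed 6 t \<le> 6"
proof -
  have fin: "finite (swapped t)" unfolding swapped_def by (rule finite_subset[of _ "Pow {1..6}"]) auto
  have pair: "S = {x, t x}" if S: "S \<in> swapped t" "x \<in> S" for S x
  proof -
    have "t x \<in> S" "t x \<noteq> x" "card S = 2" "finite S"
      using S unfolding swapped_def by (auto intro: card_ge_0_finite)
    then show ?thesis using S(2) by (intro card_subset_eq[symmetric]) auto
  qed
  have "card (\<Union>(swapped t)) = (\<Sum>S\<in>swapped t. card S)"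
  proof (rule card_Union_disjoint)
    show "pairwise disjnt (swapped t)" unfolding pairwise_def disjnt_def using pair by blast
    show "finite S" if "S \<in> swapped t" for S using that unfolding swapped_def by (auto intro: card_ge_0_finite)
  qed
  also have "\<dots> = (\<Sum>S\<in>swapped t. 2)" by (rule sum.cong) (auto simp: swapped_def)
  finally have "card (\<Union>(swapped t)) = 2 * card (swapped t)" by simp
  moreover have "\<Union>(swapped t) \<subseteq> {i \<in> {1..6}. t i \<noteq> i}" unfolding swapped_def by blast
  then have "card (\<Union>(swapped t)) \<le> moved 6 t" unfolding moved_def by (intro card_mono) auto
  ultimately show ?thesis using fixed_add_moved[of 6 t] by simp
qed

lemma fixA_fixD_le:
  assumes t: "t permutes {1..6}" and f: "fixed 6 t \<le> 2"
  shows "fixA t \<le> 4" "fixD t \<le> 4"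
proof -
  have F: "fixed 6 t = 0 \<or> fixed 6 t = 1 \<or> fixed 6 t = 2" using f by auto
  then show "fixA t \<le> 4" by (auto simp: fixA_def)
  show "fixD t \<le> 4" using F swapped_bound[OF t] by (elim disjE) (simp_all add: fixD_def choose_two)
qed

lemma fixA_fixD_0: "fixed 6 t = 0 \<Longrightarrow> fixA t = 0 \<and> fixD t = 0"
  by (simp add: fixA_def fixD_def)

lemma fixA_fixD_3:
  assumes t: "t permutes {1..6}" "fixed 6 t = 3" shows "fixA t = 12" "fixD t = 3"
proof -
  obtain a b c where abc: "distinct [a, b, c]" "{a, b, c} \<subseteq> {1..6}" "t = cyc a b c"
    using fixed_3_cyc[OF t] by blast
  show "fixA t = 12" using t(2) evenperm_cyc[OF abc(1)] unfolding abc(3) by (simp add: fixA_def)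
  have "swapped t = {}"
  proof (rule ccontr)
    assume "swapped t \<noteq> {}"
    then obtain S where S: "S \<in> swapped t" by blast
    then obtain x y where xy: "S = {x, y}" "x \<noteq> y" unfolding swapped_def card_2_iff by blast
    have "{t x, t y} = {x, y}" "t x \<noteq> x" "t y \<noteq> y" using S unfolding xy(1) swapped_def by auto
    then have "t x = y" "t y = x" by (auto simp: doubleton_eq_iff)
    then have "t (t (t x)) = y" by simp
    then show False using cyc_cyc_cyc[OF abc(1), of x] xy(2) unfolding abc(3) by simp
  qed
  then show "fixD t = 3" using t(2) by (simp add: fixD_def choose_two)
qed

lemma fixA_fixD_4:
  assumes t: "t permutes {1..6}" "fixed 6 t = 4" shows "fixA t = 0" "fixD t = 16"
proof -
  obtain a b where ab: "a \<noteq> b" "a \<in> {1..6}" "b \<in> {1..6}" "t = tr a b" using fixed_4_transpose[OF t] by blast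
  show "fixA t = 0" using ab(1) unfolding ab(4) by (simp add: fixA_def evenperm_transpose)
  have "swapped t = {{a, b}}"
  proof (intro equalityI subsetI)
    fix S assume S: "S \<in> swapped t"
    have "S \<subseteq> {a, b}" using S unfolding ab(4) swapped_def by (auto simp: Transposition.transpose_def split: if_splits)
    moreover have "card S = card {a, b}" using S ab(1) unfolding swapped_def by simp
    ultimately have "S = {a, b}" by (intro card_subset_eq) simp_all
    then show "S \<in> {{a, b}}" by simp
  next
    fix S assume "S \<in> {{a, b}}"
    then show "S \<in> swapped t" using ab by (auto simp: swapped_def)
  qed
  then show "fixD t = 16" using t(2) by (simp add: fixD_def choose_two)
qed

text \<open>A permutation with more than two fixed points is a three-cycle, with counts 12 and 3, or
  a transposition, with counts 0 and 16; its \<open>outer6\<close>-image then has no fixed points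
  and contributes zeros. The other two rows arise when \<open>outer6 t\<close> is of this
  kind.\<close>

lemma fix12_cases:
  assumes t: "t permutes {1..6}" "t \<noteq> id"
  shows "(\<forall>k<4. fix12 k t \<le> 4) \<or> map (\<lambda>k. fix12 k t) [0, 1, 2, 3] \<in> {[0, 16, 0, 0], [12, 3, 0, 0], [0, 0, 0, 16], [0, 0, 12, 3]}"
proof -
  note ot = outer6_permutes[OF t(1)]
  have "outer6 t \<noteq> id"
  proof
    assume "outer6 t = id"
    then have "outer6 (outer6 t) = id" using outer6_eq[OF syn_rel_id] by simp
    then show False using t(2) outer6_outer6[OF t(1)] by simp
  qed
  note F = fixed_le_4[OF t] fixed_le_4[OF ot this]
  note oo = outer6_outer6[OF t(1)]
  have e: "fix12 0 t = fixA t" "fix12 1 t = fixD t" "fix12 2 t = fixA (outer6 t)" "fix12 3 t = fixD (outer6 t)"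
    by (simp_all add: fix12_def numeral_3_eq_3 numeral_2_eq_2 One_nat_def)
  have lt4: "k < 4 \<Longrightarrow> k = 0 \<or> k = 1 \<or> k = 2 \<or> k = 3" for k :: nat by auto
  consider "fixed 6 t = 3" | "fixed 6 t = 4" | "fixed 6 (outer6 t) = 3" | "fixed 6 (outer6 t) = 4"
    | "fixed 6 t \<le> 2" "fixed 6 (outer6 t) \<le> 2" using F by linarith
  then show ?thesis
  proof cases
    case 1
    then show ?thesis using fixA_fixD_3[OF t(1)] fixA_fixD_0[OF fixed_outer6_three[OF t(1) 1]] by (simp add: e)
  next
    case 2
    then show ?thesis using fixA_fixD_4[OF t(1)] fixA_fixD_0[OF fixed_outer6_transpose[OF t(1) 2]] by (simp add: e)
  next
    case 3
    then show ?thesis using fixA_fixD_3[OF ot] fixA_fixD_0[OF fixed_outer6_three[OF ot 3]] oo by (simp add: e)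
  next
    case 4
    then show ?thesis using fixA_fixD_4[OF ot] fixA_fixD_0[OF fixed_outer6_transpose[OF ot 4]] oo by (simp add: e)
  next
    case 5
    have "fix12 k t \<le> 4" if "k < 4" for k
      using lt4[OF that] fixA_fixD_le[OF t(1) 5(1)] fixA_fixD_le[OF ot 5(2)] e by (elim disjE) simp_all
    then show ?thesis by blast
  qed
qed

lemma fix12_attained:
  "\<exists>t. t permutes {1..6} \<and> t \<noteq> id \<and> map (\<lambda>k. fix12 k t) [0, 1, 2, 3] = [0, 16, 0, 0]"
  "\<exists>t. t permutes {1..6} \<and> t \<noteq> id \<and> map (\<lambda>k. fix12 k t) [0, 1, 2, 3] = [12, 3, 0, 0]"
  "\<exists>t. t permutes {1..6} \<and> t \<noteq> id \<and> map (\<lambda>k. fix12 k t) [0, 1, 2, 3] = [0, 0, 0, 16]"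
  "\<exists>t. t permutes {1..6} \<and> t \<noteq> id \<and> map (\<lambda>k. fix12 k t) [0, 1, 2, 3] = [0, 0, 12, 3]"
proof -
  have e: "fix12 0 t = fixA t" "fix12 1 t = fixD t" "fix12 2 t = fixA (outer6 t)" "fix12 3 t = fixD (outer6 t)" for t
    by (simp_all add: fix12_def numeral_3_eq_3 numeral_2_eq_2 One_nat_def)
  have nid: "u \<noteq> id" if "fixed 6 u \<noteq> 6" for u using that fixed_id[of 6] by blast
  let ?t = "tr 1 2" and ?c = "cyc 1 2 3"
  have tp: "?t permutes {1..6}" by (rule tr12_permutes)
  have tf: "fixed 6 ?t = 4" by (rule fixed_tr) auto
  have d: "distinct [1, 2, 3::nat]" "{1, 2, 3} \<subseteq> {1..6::nat}" by auto
  have cp: "?c permutes {1..6}" by (rule cyc_permutes[OF d])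
  have cf: "fixed 6 ?c = 3" by (rule fixed_cyc[OF d])
  have ot: "fixed 6 (outer6 ?t) = 0" by (rule fixed_outer6_transpose[OF tp tf])
  have oc: "fixed 6 (outer6 ?c) = 0" by (rule fixed_outer6_three[OF cp cf])
  show "\<exists>t. t permutes {1..6} \<and> t \<noteq> id \<and> map (\<lambda>k. fix12 k t) [0, 1, 2, 3] = [0, 16, 0, 0]"
    using tp nid[of ?t] tf fixA_fixD_4[OF tp tf] fixA_fixD_0[OF ot] by (intro exI[of _ ?t]) (simp add: e)
  show "\<exists>t. t permutes {1..6} \<and> t \<noteq> id \<and> map (\<lambda>k. fix12 k t) [0, 1, 2, 3] = [12, 3, 0, 0]"
    using cp nid[of ?c] cf fixA_fixD_3[OF cp cf] fixA_fixD_0[OF oc] by (intro exI[of _ ?c]) (simp add: e)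
  show "\<exists>t. t permutes {1..6} \<and> t \<noteq> id \<and> map (\<lambda>k. fix12 k t) [0, 1, 2, 3] = [0, 0, 0, 16]"
    using outer6_permutes[OF tp] nid[of "outer6 ?t"] ot fixA_fixD_4[OF tp tf] fixA_fixD_0[OF ot] outer6_outer6[OF tp]
    by (intro exI[of _ "outer6 ?t"]) (simp add: e)
  show "\<exists>t. t permutes {1..6} \<and> t \<noteq> id \<and> map (\<lambda>k. fix12 k t) [0, 1, 2, 3] = [0, 0, 12, 3]"
    using outer6_permutes[OF cp] nid[of "outer6 ?c"] oc fixA_fixD_3[OF cp cf] fixA_fixD_0[OF oc] outer6_outer6[OF cp]
    by (intro exI[of _ "outer6 ?c"]) (simp add: e)
qed

section \<open>Minimum distances in degree sixty as a function of the multiplicities\<close>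

section \<open>The codes of the actions of degree sixty\<close>

lemma count_list_full: "count_list xs k = length xs \<Longrightarrow> x \<in> set xs \<Longrightarrow> x = k"
proof (induction xs)
  case (Cons y ys)
  then show ?case using count_le_length[of ys k] by (auto split: if_splits)
qed simp

lemma sum_list_count_4:
  fixes f :: "nat \<Rightarrow> nat"
  assumes "set ks \<subseteq> {..<4}"
  shows "(\<Sum>k\<leftarrow>ks. f k) =
    count_list ks 0 * f 0 + count_list ks 1 * f 1 + count_list ks 2 * f 2 + count_list ks 3 * f 3"
  using assms
proof (induction ks)
  case (Cons k ks)
  then have "k = 0 \<or> k = 1 \<or> k = 2 \<or> k = 3" by auto
  moreover have "(\<Sum>k\<leftarrow>ks. f k) =
    count_list ks 0 * f 0 + count_list ks 1 * f 1 + count_list ks 2 * f 2 + count_list ks 3 * f 3"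
    using Cons by simp
  ultimately show ?case by (elim disjE) (simp_all add: add_mult_distrib)
qed simp

lemma count_list_distinct: "distinct xs \<Longrightarrow> x \<in> set xs \<Longrightarrow> count_list xs x = 1"
  by (induction xs) (auto simp: count_list_0_iff)

text \<open>The largest total number of fixed points of a nonidentity element when class
  \<open>k\<close> is used \<open>count_list ks k\<close> times; the four terms are the four
  exceptional rows of \<open>fix12_cases\<close>.\<close>

definition code_max :: "nat list \<Rightarrow> nat"
  where "code_max ks = max (max (16 * count_list ks 1) (12 * count_list ks 0 + 3 * count_list ks 1))
    (max (16 * count_list ks 3) (12 * count_list ks 2 + 3 * count_list ks 3))"

text \<open>Elements outside the exceptional rows contribute at most 4 times 4 = 16. This never
  exceeds \<open>code_max\<close>: one entry 1 or 3 already gives 16, and without such entries 0 or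
  2 occurs at least twice, giving 24.\<close>

lemma fix12_sum_le:
  assumes ks: "set ks \<subseteq> {..<4}" "length ks = 4" and t: "t permutes {1..6}" "t \<noteq> id"
  shows "(\<Sum>k\<leftarrow>ks. fix12 k t) \<le> code_max ks"
proof -
  have len: "count_list ks 0 + count_list ks 1 + count_list ks 2 + count_list ks 3 = 4"
    using sum_list_count_4[OF ks(1), of "\<lambda>_. 1"] ks(2) by (simp add: sum_list_triv)
  show ?thesis
    using fix12_cases[OF t]
  proof
    assume "\<forall>k<4. fix12 k t \<le> 4"
    then have "(\<Sum>k\<leftarrow>ks. fix12 k t) \<le> (\<Sum>k\<leftarrow>ks. 4)" using ks(1) by (intro sum_list_mono) auto
    also have "\<dots> = 16" using ks(2) by (simp add: sum_list_triv)
    also have "16 \<le> code_max ks"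
    proof (cases "count_list ks 1 = 0 \<and> count_list ks 3 = 0")
      case True
      then have "count_list ks 0 \<ge> 2 \<or> count_list ks 2 \<ge> 2" using len by linarith
      then show ?thesis by (auto simp: code_max_def le_max_iff_disj)
    next
      case False
      then show ?thesis by (auto simp: code_max_def le_max_iff_disj)
    qed
    finally show ?thesis .
  next
    assume "map (\<lambda>k. fix12 k t) [0, 1, 2, 3] \<in> {[0, 16, 0, 0], [12, 3, 0, 0], [0, 0, 0, 16], [0, 0, 12, 3]}"
    then show ?thesis
      unfolding sum_list_count_4[OF ks(1)] code_max_def
      by (elim insertE emptyE) (simp_all add: le_max_iff_disj)
  qed
qed

lemma fix12_sum_attained:
  assumes ks: "set ks \<subseteq> {..<4}"
  obtains t where "t permutes {1..6}" "t \<noteq> id" "(\<Sum>k\<leftarrow>ks. fix12 k t) = code_max ks"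
proof -
  note s = sum_list_count_4[OF ks]
  have "code_max ks \<in> {16 * count_list ks 1, 12 * count_list ks 0 + 3 * count_list ks 1,
      16 * count_list ks 3, 12 * count_list ks 2 + 3 * count_list ks 3}"
    by (simp add: code_max_def max_def)
  then consider "code_max ks = 16 * count_list ks 1" | "code_max ks = 12 * count_list ks 0 + 3 * count_list ks 1"
    | "code_max ks = 16 * count_list ks 3" | "code_max ks = 12 * count_list ks 2 + 3 * count_list ks 3" by blast
  then show ?thesis
  proof cases
    case 1
    obtain t where t: "t permutes {1..6} \<and> t \<noteq> id \<and> map (\<lambda>k. fix12 k t) [0, 1, 2, 3] = [0, 16, 0, 0]"
      using fix12_attained(1) ..
    then have v: "map (\<lambda>k. fix12 k t) [0, 1, 2, 3] = [0, 16, 0, 0]" by (elim conjE)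
    have "(\<Sum>k\<leftarrow>ks. fix12 k t) = code_max ks" unfolding s[of "\<lambda>k. fix12 k t"] 1 using v by simp
    then show ?thesis using t by (intro that[of t]) (elim conjE, assumption)+
  next
    case 2
    obtain t where t: "t permutes {1..6} \<and> t \<noteq> id \<and> map (\<lambda>k. fix12 k t) [0, 1, 2, 3] = [12, 3, 0, 0]"
      using fix12_attained(2) ..
    then have v: "map (\<lambda>k. fix12 k t) [0, 1, 2, 3] = [12, 3, 0, 0]" by (elim conjE)
    have "(\<Sum>k\<leftarrow>ks. fix12 k t) = code_max ks" unfolding s[of "\<lambda>k. fix12 k t"] 2 using v by simp
    then show ?thesis using t by (intro that[of t]) (elim conjE, assumption)+
  next
    case 3
    obtain t where t: "t permutes {1..6} \<and> t \<noteq> id \<and> map (\<lambda>k. fix12 k t) [0, 1, 2, 3] = [0, 0, 0, 16]"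
      using fix12_attained(3) ..
    then have v: "map (\<lambda>k. fix12 k t) [0, 1, 2, 3] = [0, 0, 0, 16]" by (elim conjE)
    have "(\<Sum>k\<leftarrow>ks. fix12 k t) = code_max ks" unfolding s[of "\<lambda>k. fix12 k t"] 3 using v by simp
    then show ?thesis using t by (intro that[of t]) (elim conjE, assumption)+
  next
    case 4
    obtain t where t: "t permutes {1..6} \<and> t \<noteq> id \<and> map (\<lambda>k. fix12 k t) [0, 1, 2, 3] = [0, 0, 12, 3]"
      using fix12_attained(4) ..
    then have v: "map (\<lambda>k. fix12 k t) [0, 1, 2, 3] = [0, 0, 12, 3]" by (elim conjE)
    have "(\<Sum>k\<leftarrow>ks. fix12 k t) = code_max ks" unfolding s[of "\<lambda>k. fix12 k t"] 4 using v by simp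
    then show ?thesis using t by (intro that[of t]) (elim conjE, assumption)+
  qed
qed

text \<open>Subtracted from 240, the bounds 64, 48, 36 and 16 become the distances 176, 192, 204 and
  224.\<close>

lemma code_max_le:
  assumes ks: "set ks \<subseteq> {..<4}" "length ks = 4"
  shows "code_max ks \<le> 64"
    and "\<forall>k<4. count_list ks k \<le> 3 \<Longrightarrow> code_max ks \<le> 48"
    and "count_list ks 1 = 0 \<Longrightarrow> count_list ks 3 = 0 \<Longrightarrow> \<forall>k<4. count_list ks k \<le> 3 \<Longrightarrow> code_max ks \<le> 36"
    and "16 \<le> code_max ks"
proof -
  have len: "count_list ks 0 + count_list ks 1 + count_list ks 2 + count_list ks 3 = 4"
    using sum_list_count_4[OF ks(1), of "\<lambda>_. 1"] ks(2) by (simp add: sum_list_triv)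
  show "code_max ks \<le> 64" using len by (simp add: code_max_def)
  show "code_max ks \<le> 48" if c: "\<forall>k<4. count_list ks k \<le> 3"
  proof -
    have "count_list ks 1 \<le> 3" "count_list ks 3 \<le> 3" using c by simp_all
    then show ?thesis using len by (simp add: code_max_def)
  qed
  show "code_max ks \<le> 36" if z: "count_list ks 1 = 0" "count_list ks 3 = 0" and c: "\<forall>k<4. count_list ks k \<le> 3"
  proof -
    have "count_list ks 0 \<le> 3" "count_list ks 2 \<le> 3" using c by simp_all
    then show ?thesis using z by (simp add: code_max_def)
  qed
  show "16 \<le> code_max ks"
  proof (cases "count_list ks 1 = 0 \<and> count_list ks 3 = 0")
    case True
    then have "count_list ks 0 \<ge> 2 \<or> count_list ks 2 \<ge> 2" using len by linarith
    then show ?thesis by (auto simp: code_max_def le_max_iff_disj)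
  next
    case False
    then show ?thesis by (auto simp: code_max_def le_max_iff_disj)
  qed
qed

text \<open>Arbitrary representatives and labellings, tied to the explicit list by the matching
  \<open>\<pi>\<close>. A value \<open>\<pi> j\<close> of 1 or 3 marks the class of
  \<open>D12\<close> or of its outer image.\<close>

context
  fixes Hs :: "(nat \<Rightarrow> nat) set list" and l :: "nat \<Rightarrow> nat \<Rightarrow> (nat \<Rightarrow> nat) set"
    and \<rho> :: "nat \<Rightarrow> (nat \<Rightarrow> nat) \<Rightarrow> nat \<Rightarrow> nat" and \<pi> :: "nat \<Rightarrow> nat"
  assumes len: "length Hs = 4" and reps: "class_reps (Sym 6) (subgroups_of_order (Sym 6) 12) Hs"
    and lab: "\<And>i. i < 4 \<Longrightarrow> labelling (Sym 6) (Hs ! i) 60 (l i)"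
    and \<rho>: "\<And>i. i < 4 \<Longrightarrow> \<rho> i = coset_rep (Sym 6) 60 (l i)"
    and \<pi>: "bij_betw \<pi> {..<4} {..<4}"
    and conj: "\<And>j. j < 4 \<Longrightarrow> conjugate (Sym 6) (order_12_reps ! \<pi> j) (Hs ! j)"
begin

lemma Hs_subgroup:
  assumes "j < 4" shows "subgroup (Hs ! j) (Sym 6)"
proof -
  have "Hs ! j \<in> set Hs" using assms len by simp
  then have "Hs ! j \<in> subgroups_of_order (Sym 6) 12" using reps unfolding class_reps_def by blast
  then show ?thesis unfolding subgroups_of_order_def by blast
qed

lemma \<pi>_less: "j < 4 \<Longrightarrow> \<pi> j < 4"
  using bij_betwE[OF \<pi>] by simp

lemma \<rho>_hom: "j < 4 \<Longrightarrow> \<rho> j \<in> hom (Sym 6) (Sym 60)"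
  using coset_rep_hom[OF group_Sym Hs_subgroup lab] \<rho> by simp

lemma fixed_\<rho>:
  assumes "j < 4" "t permutes {1..6}" shows "fixed 60 (\<rho> j t) = fix12 (\<pi> j) t"
  unfolding \<rho>[OF assms(1)]
  by (rule fixed_order_12_reps[OF \<pi>_less[OF assms(1)] conj[OF assms(1)] Hs_subgroup[OF assms(1)] lab[OF assms(1)] assms(2)])

lemma weight_\<rho>:
  assumes "set J \<subseteq> {..<4}" "t permutes {1..6}"
  shows "weight 60 (map \<rho> J) t + (\<Sum>k\<leftarrow>map \<pi> J. fix12 k t) = 60 * length J"
  using assms(1)
proof (induction J)
  case Nil
  then show ?case by (simp add: weight_def)
next
  case (Cons j J)
  then have "j < 4" by simp
  then have "moved 60 (\<rho> j t) + fix12 (\<pi> j) t = 60"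
    using fixed_add_moved[of 60 "\<rho> j t"] fixed_\<rho>[OF _ assms(2)] by simp
  then show ?case using Cons by (simp add: weight_def)
qed

text \<open>Four blocks of sixty points make 240, from which the largest possible number of fixed
  points is subtracted.\<close>

lemma delta_tw_\<rho>:
  assumes J: "set J \<subseteq> {..<4}" "length J = 4"
  shows "delta_tw (Sym 6) 60 (map \<rho> J) = 240 - code_max (map \<pi> J)"
proof -
  have hom: "set (map \<rho> J) \<subseteq> hom (Sym 6) (Sym 60)" using J(1) \<rho>_hom by auto
  have ks: "set (map \<pi> J) \<subseteq> {..<4}" "length (map \<pi> J) = 4" using J \<pi>_less by auto
  have w: "weight 60 (map \<rho> J) t = 240 - (\<Sum>k\<leftarrow>map \<pi> J. fix12 k t)" if "t permutes {1..6}" for t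
    using weight_\<rho>[OF J(1) that] J(2) by simp
  obtain t where t: "t permutes {1..6}" "t \<noteq> id" "(\<Sum>k\<leftarrow>map \<pi> J. fix12 k t) = code_max (map \<pi> J)"
    using fix12_sum_attained[OF ks(1)] by blast
  show ?thesis
  proof (rule delta_tw_eqI[OF group_Sym hom])
    show "t \<in> carrier (Sym 6)" using t(1) by (simp add: carrier_Sym)
    show "weight 60 (map \<rho> J) t = 240 - code_max (map \<pi> J)" using w[OF t(1)] t(3) by simp
    show "0 < 240 - code_max (map \<pi> J)" using code_max_le(1)[OF ks] by simp
    fix s assume "s \<in> carrier (Sym 6)"
    then have s: "s permutes {1..6}" by (simp add: carrier_Sym)
    show "weight 60 (map \<rho> J) s = 0 \<or> 240 - code_max (map \<pi> J) \<le> weight 60 (map \<rho> J) s"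
    proof (cases "s = id")
      case True
      then show ?thesis using weight_one[OF group_Sym hom] by (simp add: one_Sym)
    next
      case False
      then show ?thesis unfolding w[OF s] using fix12_sum_le[OF ks s] by (intro disjI2 diff_le_mono2)
    qed
  qed
qed

lemma delta_tw_replicate_\<rho>:
  assumes "j < 4"
  shows "delta_tw (Sym 6) 60 (replicate 4 (\<rho> j)) = (if \<pi> j = 1 \<or> \<pi> j = 3 then 176 else 192)"
proof -
  have c: "count_list (replicate n k) i = (if i = k then n else 0)" for n k i :: nat
    by (induction n) auto
  have k: "\<pi> j = 0 \<or> \<pi> j = 1 \<or> \<pi> j = 2 \<or> \<pi> j = 3" using \<pi>_less[OF assms] by auto
  have "delta_tw (Sym 6) 60 (map \<rho> (replicate 4 j)) = 240 - code_max (map \<pi> (replicate 4 j))"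
    using assms by (intro delta_tw_\<rho>) auto
  then have "delta_tw (Sym 6) 60 (replicate 4 (\<rho> j)) = 240 - code_max (replicate 4 (\<pi> j))"
    by (simp only: map_replicate)
  then show ?thesis using k by (elim disjE) (simp_all add: code_max_def c)
qed

lemma delta_rep_\<rho>:
  assumes J: "set J \<subseteq> {..<4}" "length J = 4"
  shows "delta_rep (Sym 6) 60 (map \<rho> J) = Min ((\<lambda>j. if \<pi> j = 1 \<or> \<pi> j = 3 then 176 else 192) ` set J)"
proof -
  have "delta_rep (Sym 6) 60 (map \<rho> J) = Min ((\<lambda>j. delta_tw (Sym 6) 60 (replicate 4 (\<rho> j))) ` set J)"
    unfolding delta_rep_eq using J(2) by (simp add: image_image)
  also have "(\<lambda>j. delta_tw (Sym 6) 60 (replicate 4 (\<rho> j))) ` set J = (\<lambda>j. if \<pi> j = 1 \<or> \<pi> j = 3 then 176 else 192) ` set J"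
    using J(1) delta_tw_replicate_\<rho> by (intro image_cong) auto
  finally show ?thesis .
qed

text \<open>Repetition codes have distance 192 for the two classes of \<open>A4\<close> type and 176
  for the two of \<open>D12\<close> type. The value 176 of the twisted codes comes from repeating
  one \<open>D12\<close>-type action, the value 224 from using each class once.\<close>

lemma order_12_codes:
  defines "\<I> \<equiv> {I. length I = 4 \<and> set I \<subseteq> \<rho> ` {..<4}}"
  shows "(\<forall>I\<in>\<I>. delta_rep (Sym 6) 60 I \<in> {176..192}) \<and>
    (\<exists>I\<in>\<I>. delta_rep (Sym 6) 60 I = 176) \<and> (\<exists>I\<in>\<I>. delta_rep (Sym 6) 60 I = 192) \<and>
    (\<forall>I\<in>\<I>. delta_tw (Sym 6) 60 I \<in> {176..224}) \<and>
    (\<exists>I\<in>\<I>. delta_tw (Sym 6) 60 I = 176) \<and> (\<exists>I\<in>\<I>. delta_tw (Sym 6) 60 I = 224) \<and>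
    (\<forall>I\<in>\<I>. card (set I) > 1 \<longrightarrow> delta_tw (Sym 6) 60 I > delta_rep (Sym 6) 60 I)"
proof -
  let ?d = "\<lambda>j. if \<pi> j = 1 \<or> \<pi> j = 3 then 176 else 192 :: nat"
  have ex: "\<exists>J. I = map \<rho> J \<and> set J \<subseteq> {..<4} \<and> length J = 4" if "I \<in> \<I>" for I
  proof -
    have "I \<in> lists (\<rho> ` {..<4})" using that unfolding \<I>_def by auto
    then obtain J where "J \<in> lists {..<4}" "I = map \<rho> J" unfolding lists_image by blast
    then show ?thesis using that unfolding \<I>_def by auto
  qed
  have mem: "map \<rho> J \<in> \<I>" if "set J \<subseteq> {..<4}" "length J = 4" for J
    using that unfolding \<I>_def by auto
  have ks: "set (map \<pi> J) \<subseteq> {..<4}" "length (map \<pi> J) = 4" if "set J \<subseteq> {..<4}" "length J = 4" for J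
    using that \<pi>_less by auto
  \<comment> \<open>Indices \<open>a\<close> and \<open>b\<close> of the representatives in the
    classes of \<open>A4\<close> and of \<open>D12\<close>, which serve as witnesses for the extreme
    values.\<close>
  have "0 \<in> \<pi> ` {..<4}" using \<pi> by (simp add: bij_betw_def)
  then obtain a where a: "a < 4" "\<pi> a = 0" by auto
  have "1 \<in> \<pi> ` {..<4}" using \<pi> by (simp add: bij_betw_def)
  then obtain b where b: "b < 4" "\<pi> b = 1" by auto
  have ra: "set (replicate 4 a) \<subseteq> {..<4}" and rb: "set (replicate 4 b) \<subseteq> {..<4}" using a(1) b(1) by simp_all
  have four: "length (replicate 4 j) = 4" for j :: nat by simp
  have rep_in: "delta_rep (Sym 6) 60 (map \<rho> J) \<in> {176..192}" if J: "set J \<subseteq> {..<4}" "length J = 4" for J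
  proof -
    have "set J \<noteq> {}" using J(2) by auto
    then have "Min (?d ` set J) \<in> ?d ` set J"
      by (intro Min_in finite_imageI finite_set) (simp only: image_is_empty not_False_eq_True)
    then show ?thesis unfolding delta_rep_\<rho>[OF J] by auto
  qed
  have rb176: "delta_rep (Sym 6) 60 (map \<rho> (replicate 4 b)) = 176" and ra192: "delta_rep (Sym 6) 60 (map \<rho> (replicate 4 a)) = 192"
    unfolding delta_rep_\<rho>[OF ra four] delta_rep_\<rho>[OF rb four] using a b by simp_all
  have tb176: "delta_tw (Sym 6) 60 (map \<rho> (replicate 4 b)) = 176"
    using delta_tw_replicate_\<rho>[OF b(1)] b(2) by (simp add: map_replicate)
  have t224: "delta_tw (Sym 6) 60 (map \<rho> [0, 1, 2, 3]) = 224"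
  proof -
    have J: "set [0, 1, 2, 3] \<subseteq> {..<4::nat}" "length [0, 1, 2, 3::nat] = 4" by auto
    have set4: "{..<4} = {0, 1, 2, 3::nat}" by auto
    define M where "M = map \<pi> [0, 1, 2, 3]"
    have "inj_on \<pi> {0, 1, 2, 3} \<and> \<pi> ` {0, 1, 2, 3} = {0, 1, 2, 3}" using \<pi> unfolding bij_betw_def set4 .
    then have inj: "inj_on \<pi> {0, 1, 2, 3}" and im: "\<pi> ` {0, 1, 2, 3} = {0, 1, 2, 3}" by (rule conjunct1, rule conjunct2)
    have "distinct [0, 1, 2, 3::nat]" by simp
    then have "distinct M" unfolding M_def distinct_map list.set using inj by (rule conjI)
    moreover have "set M = {0, 1, 2, 3}" unfolding M_def set_map list.set by (rule im)
    ultimately have "count_list M k = 1" if "k \<in> {0, 1, 2, 3}" for k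
      using that by (simp only: count_list_distinct)
    then have "code_max M = 16" by (simp add: code_max_def)
    then have "code_max (map \<pi> [0, 1, 2, 3]) = 16" unfolding M_def .
    then show ?thesis unfolding delta_tw_\<rho>[OF J] by simp
  qed
  have lt: "delta_rep (Sym 6) 60 (map \<rho> J) < delta_tw (Sym 6) 60 (map \<rho> J)"
    if J: "set J \<subseteq> {..<4}" "length J = 4" and c: "card (set (map \<rho> J)) > 1" for J
  proof -
    \<comment> \<open>As \<open>\<pi>\<close> is injective, a class used four times would make all
      four entries equal, against \<open>c\<close>.\<close>
    have c3: "\<forall>k<4. count_list (map \<pi> J) k \<le> 3"
    proof (intro allI impI, rule ccontr)
      fix k assume "\<not> count_list (map \<pi> J) k \<le> 3"
      then have "count_list (map \<pi> J) k = length (map \<pi> J)"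
        using count_le_length[of "map \<pi> J" k] ks(2)[OF J] by simp
      then have all: "\<pi> j = k" if "j \<in> set J" for j
        using count_list_full[of "map \<pi> J" k "\<pi> j"] that by simp
      obtain j0 where j0: "j0 \<in> set J" using J(2) by (cases J) auto
      have "j = j0" if "j \<in> set J" for j
      proof (rule inj_onD[OF bij_betw_imp_inj_on[OF \<pi>]])
        show "\<pi> j = \<pi> j0" unfolding all[OF that] all[OF j0] by (rule refl)
        show "j \<in> {..<4}" "j0 \<in> {..<4}" by (rule subsetD[OF J(1) that], rule subsetD[OF J(1) j0])
      qed
      then have "set J \<subseteq> {j0}" by (intro subsetI) (simp only: singleton_iff)
      then have "set (map \<rho> J) \<subseteq> {\<rho> j0}" unfolding set_map using image_mono[of "set J" "{j0}" \<rho>] by (simp only: image_insert image_empty)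
      then have "card (set (map \<rho> J)) \<le> card {\<rho> j0}" by (intro card_mono finite.emptyI finite.insertI)
      then show False using c unfolding is_singletonI[unfolded is_singleton_altdef] by linarith
    qed
    show ?thesis
    \<comment> \<open>If a \<open>D12\<close>-type action occurs, at most 176 stands against at
      least 240 - 48 = 192; otherwise at most 192 stands against at least 240 - 36 = 204.\<close>
    proof (cases "\<exists>j\<in>set J. \<pi> j = 1 \<or> \<pi> j = 3")
      case True
      then obtain j where "j \<in> set J" "\<pi> j = 1 \<or> \<pi> j = 3" by blast
      then have "176 \<in> ?d ` set J" by (intro image_eqI[of _ _ j]) simp_all
      then have "Min (?d ` set J) \<le> 176" by (intro Min_le) simp_all
      then show ?thesis
        unfolding delta_rep_\<rho>[OF J] delta_tw_\<rho>[OF J] using code_max_le(2)[OF ks[OF J] c3] by simp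
    next
      case False
      then have "count_list (map \<pi> J) 1 = 0" "count_list (map \<pi> J) 3 = 0" by (auto simp: count_list_0_iff)
      from code_max_le(3)[OF ks[OF J] this c3] show ?thesis
        using rep_in[OF J] unfolding delta_tw_\<rho>[OF J] atLeastAtMost_iff by linarith
    qed
  qed
  have tw: "delta_tw (Sym 6) 60 (map \<rho> J) \<in> {176..224}" if J: "set J \<subseteq> {..<4}" "length J = 4" for J
    unfolding delta_tw_\<rho>[OF J] using code_max_le(1,4)[OF ks[OF J]] unfolding atLeastAtMost_iff by linarith
  have J4: "map \<rho> [0, 1, 2, 3] \<in> \<I>" by (rule mem) auto
  show ?thesis
  proof (intro conjI ballI impI)
    fix I assume "I \<in> \<I>"
    then obtain J where J: "I = map \<rho> J" "set J \<subseteq> {..<4}" "length J = 4" using ex by blast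
    show "delta_rep (Sym 6) 60 I \<in> {176..192}" unfolding J(1) by (rule rep_in[OF J(2,3)])
    show "delta_tw (Sym 6) 60 I \<in> {176..224}" unfolding J(1) by (rule tw[OF J(2,3)])
    show "delta_rep (Sym 6) 60 I < delta_tw (Sym 6) 60 I" if "1 < card (set I)"
      using that unfolding J(1) by (rule lt[OF J(2,3)])
  next
    show "\<exists>I\<in>\<I>. delta_rep (Sym 6) 60 I = 176" by (rule bexI, rule rb176, rule mem[OF rb four])
    show "\<exists>I\<in>\<I>. delta_rep (Sym 6) 60 I = 192" by (rule bexI, rule ra192, rule mem[OF ra four])
    show "\<exists>I\<in>\<I>. delta_tw (Sym 6) 60 I = 176" by (rule bexI, rule tb176, rule mem[OF rb four])
    show "\<exists>I\<in>\<I>. delta_tw (Sym 6) 60 I = 224" by (rule bexI, rule t224, rule J4)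
  qed
qed

end

theorem theorem1p1:
  shows
    "(\<forall>(T :: ('a, 'b) monoid_scheme) (q :: nat) (I :: ('a \<Rightarrow> nat \<Rightarrow> nat) list).
        group T \<and> q > 0 \<and> I \<noteq> [] \<and> set I \<subseteq> hom T (Sym q) \<longrightarrow>
          freq_perm_array q (length I) (twisted_code T q I) \<and>
          ((\<forall>\<rho>\<in>set I. \<forall>\<sigma>\<in>set I. kernel T (Sym q) \<rho> = kernel T (Sym q) \<sigma>) \<or>
           (\<exists>\<rho>\<in>set I. kernel T (Sym q) \<rho> = carrier T) \<longrightarrow>
             delta_tw T q I \<ge> delta_rep T q I)) \<and>

     ((\<exists>\<rho>\<^sub>2. outer_involution (Sym 6) (Sym 6) \<rho>\<^sub>2) \<and>
      (\<forall>\<rho>\<^sub>2. outer_involution (Sym 6) (Sym 6) \<rho>\<^sub>2 \<longrightarrow>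
         delta_rep (Sym 6) 6 [id, \<rho>\<^sub>2] = 4 \<and> delta_tw (Sym 6) 6 [id, \<rho>\<^sub>2] = 8)) \<and>

     ((\<exists>\<rho>\<^sub>2. outer_involution (Sym 6) (Alt 6) \<rho>\<^sub>2) \<and>
      (\<forall>\<rho>\<^sub>2. outer_involution (Sym 6) (Alt 6) \<rho>\<^sub>2 \<longrightarrow>
         delta_rep (Alt 6) 6 [id, \<rho>\<^sub>2] = 6 \<and> delta_tw (Alt 6) 6 [id, \<rho>\<^sub>2] = 8)) \<and>

     (ASL32 = AGL32 \<and>
      (\<exists>H\<^sub>1 H\<^sub>2. class_reps ASL32 (complements ASL32 translation_subgroup) [H\<^sub>1, H\<^sub>2]) \<and>
      (\<forall>H\<^sub>1 H\<^sub>2 l\<^sub>1 l\<^sub>2.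
         class_reps ASL32 (complements ASL32 translation_subgroup) [H\<^sub>1, H\<^sub>2] \<and>
         labelling ASL32 H\<^sub>1 8 l\<^sub>1 \<and> labelling ASL32 H\<^sub>2 8 l\<^sub>2 \<longrightarrow>
           delta_rep ASL32 8 [coset_rep ASL32 8 l\<^sub>1, coset_rep ASL32 8 l\<^sub>2] = 8 \<and>
           delta_tw ASL32 8 [coset_rep ASL32 8 l\<^sub>1, coset_rep ASL32 8 l\<^sub>2] = 12)) \<and>

     ((\<exists>Hs. length Hs = 4 \<and> class_reps (Sym 6) (subgroups_of_order (Sym 6) 12) Hs) \<and>
      (\<forall>Hs l \<rho> \<I>.
         length Hs = 4 \<and> class_reps (Sym 6) (subgroups_of_order (Sym 6) 12) Hs \<and>
         (\<forall>i<4. labelling (Sym 6) (Hs ! i) 60 (l i) \<and> \<rho> i = coset_rep (Sym 6) 60 (l i)) \<and>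
         \<I> = {I. length I = 4 \<and> set I \<subseteq> \<rho> ` {..<4}} \<longrightarrow>
           (\<forall>I\<in>\<I>. delta_rep (Sym 6) 60 I \<in> {176..192}) \<and>
           (\<exists>I\<in>\<I>. delta_rep (Sym 6) 60 I = 176) \<and> (\<exists>I\<in>\<I>. delta_rep (Sym 6) 60 I = 192) \<and>
           (\<forall>I\<in>\<I>. delta_tw (Sym 6) 60 I \<in> {176..224}) \<and>
           (\<exists>I\<in>\<I>. delta_tw (Sym 6) 60 I = 176) \<and> (\<exists>I\<in>\<I>. delta_tw (Sym 6) 60 I = 224) \<and>
           (\<forall>I\<in>\<I>. card (set I) > 1 \<longrightarrow> delta_tw (Sym 6) 60 I > delta_rep (Sym 6) 60 I)))"
proof (intro conjI allI impI)
  fix T :: "('a, 'b) monoid_scheme" and q :: nat and I :: "('a \<Rightarrow> nat \<Rightarrow> nat) list"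
  assume h: "group T \<and> q > 0 \<and> I \<noteq> [] \<and> set I \<subseteq> hom T (Sym q)"
  then have T: "group T" and I: "I \<noteq> []" "set I \<subseteq> hom T (Sym q)" by simp_all
  show "freq_perm_array q (length I) (twisted_code T q I)" by (rule freq_perm_array_twisted[OF I(2)])
  assume "(\<forall>\<rho>\<in>set I. \<forall>\<sigma>\<in>set I. kernel T (Sym q) \<rho> = kernel T (Sym q) \<sigma>) \<or>
    (\<exists>\<rho>\<in>set I. kernel T (Sym q) \<rho> = carrier T)"
  then show "delta_rep T q I \<le> delta_tw T q I" by (rule delta_rep_le_delta_tw[OF T I])
next
  show "\<exists>\<rho>\<^sub>2. outer_involution (Sym 6) (Sym 6) \<rho>\<^sub>2"
    by (rule exI, rule outer6_outer_involution, simp)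
next
  fix \<phi> assume "outer_involution (Sym 6) (Sym 6) \<phi>"
  then show "delta_rep (Sym 6) 6 [id, \<phi>] = 4" "delta_tw (Sym 6) 6 [id, \<phi>] = 8"
    using Sym6_codes[of \<phi>] by simp_all
next
  show "\<exists>\<rho>\<^sub>2. outer_involution (Sym 6) (Alt 6) \<rho>\<^sub>2"
    by (rule exI, rule outer6_outer_involution, simp)
next
  fix \<phi> assume "outer_involution (Sym 6) (Alt 6) \<phi>"
  then show "delta_rep (Alt 6) 6 [id, \<phi>] = 6" "delta_tw (Alt 6) 6 [id, \<phi>] = 8"
    using Alt6_codes[of \<phi>] by simp_all
next
  show "ASL32 = AGL32" by (rule ASL32_eq_AGL32)
  show "\<exists>H\<^sub>1 H\<^sub>2. class_reps ASL32 (complements ASL32 translation_subgroup) [H\<^sub>1, H\<^sub>2]"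
    by (intro exI) (rule class_reps_GL3_K2)
next
  fix H K l m
  assume "class_reps ASL32 (complements ASL32 translation_subgroup) [H, K] \<and>
    labelling ASL32 H 8 l \<and> labelling ASL32 K 8 m"
  then have h: "class_reps ASL32 (complements ASL32 translation_subgroup) [H, K]"
    "labelling ASL32 H 8 l" "labelling ASL32 K 8 m" by blast+
  show "delta_rep ASL32 8 [coset_rep ASL32 8 l, coset_rep ASL32 8 m] = 8" by (rule ASL32_codes(1)[OF h])
  show "delta_tw ASL32 8 [coset_rep ASL32 8 l, coset_rep ASL32 8 m] = 12" by (rule ASL32_codes(2)[OF h])
next
  show "\<exists>Hs. length Hs = 4 \<and> class_reps (Sym 6) (subgroups_of_order (Sym 6) 12) Hs"
    using class_reps_order_12 by (intro exI[of _ order_12_reps] conjI) simp_all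
next
  fix Hs l and \<rho> :: "nat \<Rightarrow> (nat \<Rightarrow> nat) \<Rightarrow> nat \<Rightarrow> nat" and \<I>
  assume h: "length Hs = 4 \<and> class_reps (Sym 6) (subgroups_of_order (Sym 6) 12) Hs \<and>
    (\<forall>i<4. labelling (Sym 6) (Hs ! i) 60 (l i) \<and> \<rho> i = coset_rep (Sym 6) 60 (l i)) \<and>
    \<I> = {I. length I = 4 \<and> set I \<subseteq> \<rho> ` {..<4}}"
  then have len: "length Hs = 4" and r: "class_reps (Sym 6) (subgroups_of_order (Sym 6) 12) Hs"
    and \<I>: "\<I> = {I. length I = 4 \<and> set I \<subseteq> \<rho> ` {..<4}}" by blast+
  have l: "labelling (Sym 6) (Hs ! i) 60 (l i)" and \<rho>: "\<rho> i = coset_rep (Sym 6) 60 (l i)"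
    if "i < 4" for i using h that by blast+
  have sub: "H \<subseteq> carrier (Sym 6)" if "H \<in> subgroups_of_order (Sym 6) 12" for H
    using that subgroup.subset unfolding subgroups_of_order_def by blast
  have reps: "length order_12_reps = length Hs" using len by simp
  obtain \<pi> where \<pi>: "bij_betw \<pi> {..<length Hs} {..<length Hs}"
    "\<forall>j<length Hs. conjugate (Sym 6) (order_12_reps ! \<pi> j) (Hs ! j)"
    by (rule class_reps_bij[OF group_Sym _ class_reps_order_12 r reps]) (erule sub, blast)
  have \<pi>': "bij_betw \<pi> {..<4} {..<4}" using \<pi>(1) unfolding len .
  have conj: "conjugate (Sym 6) (order_12_reps ! \<pi> j) (Hs ! j)" if "j < 4" for j
    using \<pi>(2) that unfolding len by blast
  have codes: "(\<forall>I\<in>\<I>. delta_rep (Sym 6) 60 I \<in> {176..192}) \<and>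
    (\<exists>I\<in>\<I>. delta_rep (Sym 6) 60 I = 176) \<and> (\<exists>I\<in>\<I>. delta_rep (Sym 6) 60 I = 192) \<and>
    (\<forall>I\<in>\<I>. delta_tw (Sym 6) 60 I \<in> {176..224}) \<and>
    (\<exists>I\<in>\<I>. delta_tw (Sym 6) 60 I = 176) \<and> (\<exists>I\<in>\<I>. delta_tw (Sym 6) 60 I = 224) \<and>
    (\<forall>I\<in>\<I>. card (set I) > 1 \<longrightarrow> delta_tw (Sym 6) 60 I > delta_rep (Sym 6) 60 I)"
    unfolding \<I> by (rule order_12_codes[OF len r l \<rho> \<pi>' conj])
  show "\<forall>I\<in>\<I>. delta_rep (Sym 6) 60 I \<in> {176..192}" using codes by (elim conjE)
  show "\<exists>I\<in>\<I>. delta_rep (Sym 6) 60 I = 176" using codes by (elim conjE)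
  show "\<exists>I\<in>\<I>. delta_rep (Sym 6) 60 I = 192" using codes by (elim conjE)
  show "\<forall>I\<in>\<I>. delta_tw (Sym 6) 60 I \<in> {176..224}" using codes by (elim conjE)
  show "\<exists>I\<in>\<I>. delta_tw (Sym 6) 60 I = 176" using codes by (elim conjE)
  show "\<exists>I\<in>\<I>. delta_tw (Sym 6) 60 I = 224" using codes by (elim conjE)
  show "\<forall>I\<in>\<I>. card (set I) > 1 \<longrightarrow> delta_tw (Sym 6) 60 I > delta_rep (Sym 6) 60 I" using codes by (elim conjE)
qed

end
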